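(* Let $3\le r<\infty$, $l\in\mathbf N$, $n=l2^r$, $0\le m\le\infty$, and let $\mathbf F=\mathbf R$ or $\mathbf F=\mathbf C$. Suppose that $V$ is a closed subset of $\mathcal A_r^l$ and that a function $f:V\to\mathcal A_{r,\mathbf F}$ is of class $C^m$ on $V$ in terms of functions $f_k:V\to\mathcal A_{r,\mathbf F}$, $k\in\mathbf N_0^{n}$, $|k|<m+1$. Then there exists a function $F$ such that: (1) $F\in C^m(\mathcal A_r^l,\mathcal A_{r,\mathbf F})$; (2) $\partial_z^kF(z)=f_k(z)$ for each $z\in V$ and each $k\in\mathbf N_0^n$ with $|k|\le m$ if $m<\infty$, and with $|k|<\infty$ if $m=\infty$; (3) $F$ is $\mathcal A_r$-analytic on $\mathcal A_r^l\setminus V$.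
   Context: Cayley-Dickson algebras. $\mathcal A_0=\mathbf R$, and $\mathcal A_{r+1}$ is obtained from $\mathcal A_r$ by doubling: its elements are $a+b\mathbf l$ with $a,b\in\mathcal A_r$, componentwise addition, conjugation $(a+b\mathbf l)^*=a^*-b\mathbf l$ and product $(a+b\mathbf l)(c+d\mathbf l)=(ac-d^*b)+(da+bc^* )\mathbf l$. So $\mathcal A_1=\mathbf C$, $\mathcal A_2$ is the quaternions, $\mathcal A_3$ the octonions. The standard $\mathbf R$-basis is $i_0=1,i_1,\dots,i_{2^r-1}$, with $i_j^2=-1$ for $j\ge1$ and $i_ji_k=-i_ki_j$ for $j\neq k$, $j,k\ge 1$. For $x=\sum_j x_ji_j$, $x_j\in\mathbf R$, put $\pi_j(x)=x_j$ and $|x|^2=xx^*=\sum_jx_j^2$. Put $\mathcal A_{r,\mathbf R}=\mathcal A_r$ and $\mathcal A_{r,\mathbf C}=\mathcal A_r\oplus\mathcal A_r\mathbf i$, where $\mathbf i^2=-1$ and $\mathbf i$ commutes with $\mathcal A_r$; $|x+\mathbf iy|^2=|x|^2+|y|^2$ for $x,y\in\mathcal A_r$. For $z=({}_1z,\dots,{}_lz)\in\mathcal A_r^l$ put $|z|^2=\sum_p|{}_pz|^2$ and $\pi(z)=(\pi_j({}_pz))_{p=1,\dots,l;\,j=0,\dots,2^r-1}\in\mathbf R^{n}$, $n=l2^r$. $\mathbf N=\{1,2,\dots\}$, $\mathbf N_0=\{0,1,2,\dots\}$. Multi-indices. For $k=(k(p,j))\in\mathbf N_0^n$ ($p=1,\dots,l$,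 $j=0,\dots,2^r-1$): $|k|=\sum k(p,j)$, $k!=\prod k(p,j)!$, $u^k=\prod u_{p,j}^{k(p,j)}$ for $u\in\mathbf R^n$, and $\partial_z^k$ is the partial derivative of order $k(p,j)$ in each real coordinate $\pi_j({}_pz)$; $\partial_z^0G=G$. For open $U\subset\mathcal A_r^l$, $C^m(U,\mathcal A_{r,\mathbf F})$ is the set of functions that are $m$ times continuously differentiable in the real coordinates. Class $C^m$ on an arbitrary subset $V\subset\mathcal A_r^l$. For $0\le m<\infty$, $f=f_0$ is of class $C^m$ on $V$ in terms of the functions $f_k:V\to\mathcal A_{r,\mathbf F}$ ($|k|\le m$) if for all $|k|\le m$ and $y,z\in V$ $$f_k(y)=\sum_{|s|\le m-|k|}\frac{f_{k+s}(z)}{s!}(\pi(y-z))^s+Y_k(y;z),$$ where for each $z\in V$ and $\epsilon>0$ there is $\delta>0$ such that $|Y_k(x;y)|\le|x-y|^{m-|k|}\epsilon$ for all $x,y\in V$ with $|x-z|<\delta$, $|y-z|<\delta$ and all $|k|\le m$. It is of class $C^\infty$ in terms of $\{f_k:k\in\mathbf N_0^n\}$ if this holds for each $m\in\mathbf N$. $\mathcal A_r$-analyticity. A word is a finite product, with any placement of brackets, of constants from $\mathcal A_r$ and of the variables ${}_1z,\dots,{}_lz$ (conjugates $({}_pz)^*$ do not occur as letters; this is the condition $D_{z^*}f=0$); its degree is the number of occurrences of variables. A function $f:U\to\mathcal A_r$ on an open set $U\subset\mathcal A_r^l$ is $\mathcal A_r$-analytic if each $\xi\in U$ has an open neighborhood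 $U_\xi\subset U$ on which $f$ is the evaluation of a phrase (series of words): $f(z)=\sum_{q\ge0}P_q(z-\xi)$, each $P_q$ a finite sum of words of degree $q$, the series converging uniformly on $U_\xi$. (Since $w^*=(2^r-2)^{-1}\{-w+\sum_{k=1}^{2^r-1}i_k(wi_k^* )\}$ for $w\in\mathcal A_r$, the real coordinates $\pi_j({}_pz)$ are themselves sums of words.) A function $f=\mbox{}_0f+\mathbf i\,\mbox{}_1f$ with values in $\mathcal A_{r,\mathbf C}$, ${}_vf\in\mathcal A_r$, is $\mathcal A_r$-analytic if ${}_0f$ and ${}_1f$ are. *)

theory Defs
  imports "HOL-Analysis.Analysis" "HOL-Library.Extended_Nat"
begin

section \<open>Cayley--Dickson algebras\<close>

text \<open>
  Elements of the algebra of level \<open>r\<close> are first handled as coordinate sequences vanishing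
  from index \<open>2 ^ r\<close> on. The element \<open>a + b l\<close> of level \<open>r + 1\<close> has the coordinates of \<open>a\<close> at
  \<open>0, \<dots>, 2 ^ r - 1\<close> and those of \<open>b\<close> at \<open>2 ^ r, \<dots>, 2 ^ (r + 1) - 1\<close>.
\<close>

definition dbl :: "nat \<Rightarrow> (nat \<Rightarrow> real) \<Rightarrow> (nat \<Rightarrow> real) \<Rightarrow> nat \<Rightarrow> real" where
  "dbl r a b = (\<lambda>j. if j < 2 ^ r then a j else b (j - 2 ^ r))"

definition lower :: "nat \<Rightarrow> (nat \<Rightarrow> real) \<Rightarrow> nat \<Rightarrow> real" where
  "lower r x = (\<lambda>j. if j < 2 ^ r then x j else 0)"

definition upper :: "nat \<Rightarrow> (nat \<Rightarrow> real) \<Rightarrow> nat \<Rightarrow> real" where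
  "upper r x = (\<lambda>j. if j < 2 ^ r then x (2 ^ r + j) else 0)"

primrec seq_conj :: "nat \<Rightarrow> (nat \<Rightarrow> real) \<Rightarrow> nat \<Rightarrow> real" where
  "seq_conj 0 x = x"
| "seq_conj (Suc r) x = dbl r (seq_conj r (lower r x)) (\<lambda>j. - upper r x j)"

primrec seq_mult :: "nat \<Rightarrow> (nat \<Rightarrow> real) \<Rightarrow> (nat \<Rightarrow> real) \<Rightarrow> nat \<Rightarrow> real" where
  "seq_mult 0 x y = (\<lambda>j. if j = 0 then x 0 * y 0 else 0)"
| "seq_mult (Suc r) x y =
    (let a = lower r x; b = upper r x; c = lower r y; d = upper r y
     in dbl r (\<lambda>j. seq_mult r a c j - seq_mult r (seq_conj r d) b j)
              (\<lambda>j. seq_mult r d a j + seq_mult r b (seq_conj r c) j))"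

lemma seq_mult_vanishes: "2 ^ r \<le> j \<Longrightarrow> seq_mult r x y j = 0"
  by (induction r arbitrary: x y j) (auto simp: dbl_def Let_def)

text \<open>The algebra of level \<open>r = CARD('r)\<close>, with \<open>cd_coord x j\<close> the \<open>j\<close>-th real coordinate.\<close>

typedef ('r::finite) cd = "{x :: nat \<Rightarrow> real. \<forall>j\<ge>2 ^ CARD('r). x j = 0}"
  morphisms cd_coord Abs_cd
  by (rule exI[of _ "\<lambda>_. 0"]) simp

setup_lifting type_definition_cd

lemma cd_coord_vanishes: "2 ^ CARD('r) \<le> j \<Longrightarrow> cd_coord (x :: 'r::finite cd) j = 0"
  using cd_coord[of x] by simp

lemma cd_eq_iff:
  "x = y \<longleftrightarrow> (\<forall>j < 2 ^ CARD('r). cd_coord x j = cd_coord y j)" for x y :: "'r::finite cd"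
  by (metis cd_coord_inject cd_coord_vanishes ext not_less)

instantiation cd :: (finite) times
begin

lift_definition times_cd :: "'a cd \<Rightarrow> 'a cd \<Rightarrow> 'a cd" is "seq_mult CARD('a)"
  by (simp add: seq_mult_vanishes)

instance ..

end

lift_definition cd_unit :: "nat \<Rightarrow> 'r::finite cd"
  is "\<lambda>i j. if j = i \<and> i < 2 ^ CARD('r) then 1 else 0"
  by simp

instantiation cd :: (finite) real_vector
begin

lift_definition zero_cd :: "'a cd" is "\<lambda>j. 0" by simp
lift_definition plus_cd :: "'a cd \<Rightarrow> 'a cd \<Rightarrow> 'a cd" is "\<lambda>x y j. x j + y j" by simp
lift_definition minus_cd :: "'a cd \<Rightarrow> 'a cd \<Rightarrow> 'a cd" is "\<lambda>x y j. x j - y j" by simp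
lift_definition uminus_cd :: "'a cd \<Rightarrow> 'a cd" is "\<lambda>x j. - x j" by simp
lift_definition scaleR_cd :: "real \<Rightarrow> 'a cd \<Rightarrow> 'a cd" is "\<lambda>c x j. c * x j" by simp

instance
  by standard (transfer, simp add: algebra_simps fun_eq_iff)+

end

instantiation cd :: (finite) real_inner
begin

definition inner_cd :: "'a cd \<Rightarrow> 'a cd \<Rightarrow> real" where
  "inner_cd x y = (\<Sum>j<2 ^ CARD('a). cd_coord x j * cd_coord y j)"

definition norm_cd :: "'a cd \<Rightarrow> real" where
  "norm_cd x = sqrt (x \<bullet> x)"

definition sgn_cd :: "'a cd \<Rightarrow> 'a cd" where
  "sgn_cd x = x /\<^sub>R norm x"

definition dist_cd :: "'a cd \<Rightarrow> 'a cd \<Rightarrow> real" where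
  "dist_cd x y = norm (x - y)"

definition uniformity_cd :: "('a cd \<times> 'a cd) filter" where
  "uniformity_cd = (INF e\<in>{0<..}. principal {(x, y). dist x y < e})"

definition open_cd :: "'a cd set \<Rightarrow> bool" where
  "open_cd U \<longleftrightarrow> (\<forall>x\<in>U. eventually (\<lambda>(x', y). x' = x \<longrightarrow> y \<in> U) uniformity)"

instance
proof
  fix x y z :: "'a cd" and c :: real
  show "x \<bullet> y = y \<bullet> x"
    by (simp add: inner_cd_def mult.commute)
  show "(x + y) \<bullet> z = x \<bullet> z + y \<bullet> z"
    by (simp add: inner_cd_def plus_cd.rep_eq algebra_simps sum.distrib)
  show "(c *\<^sub>R x) \<bullet> y = c * (x \<bullet> y)"
    by (simp add: inner_cd_def scaleR_cd.rep_eq algebra_simps sum_distrib_left)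
  show "0 \<le> x \<bullet> x"
    by (simp add: inner_cd_def sum_nonneg)
  show "x \<bullet> x = 0 \<longleftrightarrow> x = 0"
    by (auto simp: inner_cd_def sum_nonneg_eq_0_iff cd_eq_iff zero_cd.rep_eq)
qed (simp_all add: norm_cd_def sgn_cd_def dist_cd_def uniformity_cd_def open_cd_def)

end

lemma inner_cd_unit:
  "i < 2 ^ CARD('r) \<Longrightarrow> x \<bullet> cd_unit i = cd_coord x i" for x :: "'r::finite cd"
  by (simp add: inner_cd_def cd_unit.rep_eq if_distrib cong: if_cong)

instantiation cd :: (finite) euclidean_space
begin

definition Basis_cd :: "'a cd set" where
  "Basis_cd = cd_unit ` {..<2 ^ CARD('a)}"

instance
proof
  show "(Basis :: 'a cd set) \<noteq> {}"
    by (auto simp: Basis_cd_def lessThan_empty_iff)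
  show "finite (Basis :: 'a cd set)"
    by (simp add: Basis_cd_def)
  show "u \<bullet> v = (if u = v then 1 else 0)" if "u \<in> Basis" "v \<in> Basis" for u v :: "'a cd"
  proof -
    from that obtain i j where ij: "i < 2 ^ CARD('a)" "j < 2 ^ CARD('a)"
      "u = cd_unit i" "v = cd_unit j"
      by (auto simp: Basis_cd_def)
    then have coord: "u \<bullet> v = (if i = j then 1 else 0)" "cd_coord v j = 1"
      "cd_coord u j = (if i = j then 1 else 0)"
      by (auto simp: inner_cd_unit cd_unit.rep_eq)
    then have "u = v \<longleftrightarrow> i = j"
      using ij by (cases "i = j") auto
    with coord show ?thesis
      by simp
  qed
  show "(\<forall>u\<in>Basis. x \<bullet> u = 0) \<longleftrightarrow> x = 0" for x :: "'a cd"
    by (auto simp: Basis_cd_def inner_cd_unit cd_eq_iff zero_cd.rep_eq)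
qed

end

text \<open>
  The complexified algebra is represented by pairs: \<open>x + i y\<close> is \<open>(x, y)\<close>, and the product
  norm gives \<open>|x + i y|\<^sup>2 = |x|\<^sup>2 + |y|\<^sup>2\<close>.
\<close>

type_synonym 'r cd_complex = "'r cd \<times> 'r cd"


section \<open>Multi-indices and partial derivatives\<close>

text \<open>
  The real coordinates of a point of a Euclidean space are its inner products with the elements
  of \<open>Basis\<close>; in \<open>'r cd ^ 'l\<close> these are the \<open>j\<close>-th coordinates of the \<open>p\<close>-th components
  (lemmas \<open>Basis_cd_power\<close> and \<open>inner_axis_cd_unit\<close> below). Multi-indices are
  therefore functions on the space, vanishing off \<open>Basis\<close>.
\<close>

lemma Basis_cd_power:
  "(Basis :: ('r::finite cd ^ 'l) set) = {axis p (cd_unit j) | p j. j < 2 ^ CARD('r)}"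
  by (auto simp: Basis_vec_def Basis_cd_def)

lemma inner_axis_cd_unit:
  "j < 2 ^ CARD('r) \<Longrightarrow> z \<bullet> axis p (cd_unit j) = cd_coord (z $ p) j"
  for z :: "'r::finite cd ^ 'l"
  by (simp add: inner_axis inner_cd_unit)

type_synonym 'a mindex = "'a \<Rightarrow> nat"

definition mindices :: "'a::euclidean_space mindex set" where
  "mindices = {k. \<forall>b. b \<notin> Basis \<longrightarrow> k b = 0}"

definition mlength :: "'a::euclidean_space mindex \<Rightarrow> nat" where
  "mlength k = (\<Sum>b\<in>Basis. k b)"

lemma finite_mindices: "finite {s \<in> (mindices :: 'a::euclidean_space mindex set). mlength s \<le> N}"
proof -
  have "s b \<le> N" if "b \<in> Basis" "mlength s \<le> N" for s :: "'a mindex" and b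
    using that member_le_sum[of b Basis s] by (simp add: mlength_def)
  then have "{s \<in> (mindices :: 'a mindex set). mlength s \<le> N} \<subseteq>
      {s. \<forall>b. (b \<in> Basis \<longrightarrow> s b \<in> {..N}) \<and> (b \<notin> Basis \<longrightarrow> s b = 0)}"
    by (auto simp: mindices_def)
  then show ?thesis
    by (rule finite_subset) (rule finite_set_of_finite_funs; simp)
qed

definition mfact :: "'a::euclidean_space mindex \<Rightarrow> real" where
  "mfact k = (\<Prod>b\<in>Basis. fact (k b))"

definition mpower :: "'a::euclidean_space \<Rightarrow> 'a mindex \<Rightarrow> real" where
  "mpower u k = (\<Prod>b\<in>Basis. (u \<bullet> b) ^ k b)"

definition pderiv_dir ::
    "'a::euclidean_space \<Rightarrow> ('a \<Rightarrow> 'b::real_normed_vector) \<Rightarrow> 'a \<Rightarrow> 'b" where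
  "pderiv_dir b G z = vector_derivative (\<lambda>t. G (z + t *\<^sub>R b)) (at 0)"

definition pderivs ::
    "'a::euclidean_space list \<Rightarrow> ('a \<Rightarrow> 'b::real_normed_vector) \<Rightarrow> 'a \<Rightarrow> 'b" where
  "pderivs bs G = foldr pderiv_dir bs G"

text \<open>
  \<open>C\<^sup>m\<close> on an open set \<open>U\<close>: all iterated partial derivatives of order at most \<open>m\<close>, taken in any
  order, exist and are continuous.
\<close>

definition cont_diff_on ::
    "enat \<Rightarrow> 'a::euclidean_space set \<Rightarrow> ('a \<Rightarrow> 'b::real_normed_vector) \<Rightarrow> bool" where
  "cont_diff_on m U G \<longleftrightarrow>
    (\<forall>bs. set bs \<subseteq> Basis \<and> enat (length bs) \<le> m \<longrightarrow>
      continuous_on U (pderivs bs G) \<and>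
      (enat (length bs) < m \<longrightarrow>
        (\<forall>b\<in>Basis. \<forall>z\<in>U. (\<lambda>t. pderivs bs G (z + t *\<^sub>R b)) differentiable (at 0))))"

text \<open>
  For the mixed derivative \<open>\<partial>\<^sup>k\<close> an enumeration of \<open>Basis\<close> has to be fixed; for functions
  of class \<open>C\<^sup>m\<close> and \<open>|k| \<le> m\<close> the result does not depend on it.
\<close>

definition basis_list :: "'a::euclidean_space list" where
  "basis_list = (SOME bs. distinct bs \<and> set bs = Basis)"

definition mpderiv ::
    "'a::euclidean_space mindex \<Rightarrow> ('a \<Rightarrow> 'b::real_normed_vector) \<Rightarrow> 'a \<Rightarrow> 'b" where
  "mpderiv k G = pderivs (concat (map (\<lambda>b. replicate (k b) b) basis_list)) G"


section \<open>Functions of class \<open>C\<^sup>m\<close> on an arbitrary set\<close>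

definition taylor_rem ::
    "nat \<Rightarrow> ('a::euclidean_space mindex \<Rightarrow> 'a \<Rightarrow> 'b::real_normed_vector) \<Rightarrow>
     'a mindex \<Rightarrow> 'a \<Rightarrow> 'a \<Rightarrow> 'b" where
  "taylor_rem m f k y z =
    f k y - (\<Sum>s \<in> {s \<in> mindices. mlength s \<le> m - mlength k}.
              (mpower (y - z) s / mfact s) *\<^sub>R f (\<lambda>b. k b + s b) z)"

definition class_C_fin ::
    "nat \<Rightarrow> 'a::euclidean_space set \<Rightarrow> ('a mindex \<Rightarrow> 'a \<Rightarrow> 'b::real_normed_vector) \<Rightarrow> bool" where
  "class_C_fin m V f \<longleftrightarrow>
    (\<forall>z\<in>V. \<forall>\<epsilon>>0. \<exists>\<delta>>0. \<forall>x\<in>V. \<forall>y\<in>V. norm (x - z) < \<delta> \<and> norm (y - z) < \<delta> \<longrightarrow>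
      (\<forall>k\<in>mindices. mlength k \<le> m \<longrightarrow>
        norm (taylor_rem m f k x y) \<le> norm (x - y) ^ (m - mlength k) * \<epsilon>))"

definition class_C ::
    "enat \<Rightarrow> 'a::euclidean_space set \<Rightarrow> ('a mindex \<Rightarrow> 'a \<Rightarrow> 'b::real_normed_vector) \<Rightarrow> bool" where
  "class_C m V f \<longleftrightarrow>
    (case m of enat N \<Rightarrow> class_C_fin N V f | \<infinity> \<Rightarrow> (\<forall>N\<ge>1. class_C_fin N V f))"


section \<open>Analyticity over a Cayley--Dickson algebra\<close>

text \<open>
  Words are fully bracketed products of constants and variables; the variables are indexed by
  the components of a point of \<open>'r cd ^ 'l\<close>.
\<close>

datatype ('c, 'l) cd_word =
  Const 'c | Var 'l | Mult "('c, 'l) cd_word" "('c, 'l) cd_word"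

primrec word_degree :: "('c, 'l) cd_word \<Rightarrow> nat" where
  "word_degree (Const c) = 0"
| "word_degree (Var p) = 1"
| "word_degree (Mult v w) = word_degree v + word_degree w"

primrec word_eval :: "('r::finite cd, 'l::finite) cd_word \<Rightarrow> 'r cd ^ 'l \<Rightarrow> 'r cd" where
  "word_eval (Const c) z = c"
| "word_eval (Var p) z = z $ p"
| "word_eval (Mult v w) z = word_eval v z * word_eval w z"

definition cd_analytic_on ::
    "('r::finite cd ^ 'l::finite \<Rightarrow> 'r cd) \<Rightarrow> ('r cd ^ 'l) set \<Rightarrow> bool" where
  "cd_analytic_on f U \<longleftrightarrow>
    (\<forall>\<xi>\<in>U. \<exists>W. open W \<and> \<xi> \<in> W \<and> W \<subseteq> U \<and>
      (\<exists>P :: nat \<Rightarrow> ('r cd, 'l) cd_word list.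
        (\<forall>q. \<forall>w\<in>set (P q). word_degree w = q) \<and>
        uniform_limit W (\<lambda>N z. \<Sum>q<N. \<Sum>w\<leftarrow>P q. word_eval w (z - \<xi>)) f sequentially))"

definition cd_complex_analytic_on ::
    "('r::finite cd ^ 'l::finite \<Rightarrow> 'r cd_complex) \<Rightarrow> ('r cd ^ 'l) set \<Rightarrow> bool" where
  "cd_complex_analytic_on f U \<longleftrightarrow>
    cd_analytic_on (\<lambda>z. fst (f z)) U \<and> cd_analytic_on (\<lambda>z. snd (f z)) U"

end

theory Submission
  imports Defs "HOL-Probability.Distributions"
begin

text \<open>
  Everything reduces to real-valued jets. Whitney's construction (a sum of bump functions of radius
  comparable to the distance from \<open>V\<close>, weighted by Taylor polynomials at nearby points of \<open>V\<close>, of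
  slowly growing degree if $m = \infty$) gives an extension \<open>F0\<close> that is smooth off \<open>V\<close>.

  Any function \<open>h\<close> smooth off \<open>V\<close> becomes analytic there after adding some \<open>D\<close>, \<open>|D| \<le> 1\<close>, that is smooth
  on the whole space: split \<open>h\<close> by a partition of unity and convolve the pieces with narrow Gaussians.
  Let \<open>u \<ge> 0\<close> be smooth, flat on \<open>V\<close> and positive elsewhere, and choose \<open>D1\<close>, \<open>D2\<close> in this way for
  \<open>1 / u\<close> and \<open>F0 / u\<close>. Then \<open>F = (F0 / u + D2) / (1 / u + D1)\<close> is analytic off \<open>V\<close>, and since
  \<open>F - F0 = u (D2 - F0 D1) / (1 + u D1)\<close> has the flat factor \<open>u\<close>, \<open>F\<close> has the same jet on \<open>V\<close> as \<open>F0\<close>.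

  Finally, the real coordinates are sums of words, so every homogeneous polynomial in them is one.
\<close>

section \<open>Calculus of $C^k$ functions\<close>

text \<open>Correcting \<open>F0\<close> directly by analytic functions would require control of
  every derivative near \<open>V\<close>, at a rate tied to the distance. With the quotient a
  correction need only be bounded and smooth, as the flat factor \<open>u\<close> erases its jet.
  Two corrections are needed because \<open>u\<close> itself need not be analytic: an analytic
  \<open>F0 / u + D2\<close> cannot simply be multiplied back by \<open>u\<close>.

  The obstacle is the sum of infinitely many mollified pieces. Each is entire, but narrow Gaussians
  have huge Taylor coefficients, so analyticity of the summands says nothing about the sum. What
  saves it: at distance \<delta> from the support, the coefficients of a mollified piece are bounded
  by a quantity exponentially small in 1 / \<epsilon>^2 times a geometric rate depending only on
  \<delta>. Hence \<open>analytic\<close> records both a bound and a rate: at a point off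
  \<open>V\<close> almost all pieces share one rate with summable bounds, and the finitely many
  others are entire and fit any rate. Narrowing the n-th Gaussian further makes the n-th error small
  in C^n, so that \<open>D\<close> is smooth across \<open>V\<close>.\<close>

abbreviation has_dir_deriv ::
    "'a::euclidean_space \<Rightarrow> ('a \<Rightarrow> 'b::real_normed_vector) \<Rightarrow> 'a \<Rightarrow> 'b \<Rightarrow> bool" where
  "has_dir_deriv b f z d \<equiv> ((\<lambda>t. f (z + t *\<^sub>R b)) has_vector_derivative d) (at 0)"

lemma pderiv_dir_eqI: "has_dir_deriv b f z d \<Longrightarrow> pderiv_dir b f z = d"
  by (simp add: pderiv_dir_def vector_derivative_at)

lemma has_dir_deriv_pderiv_dir:
  "(\<lambda>t. f (z + t *\<^sub>R b)) differentiable (at 0) \<Longrightarrow> has_dir_deriv b f z (pderiv_dir b f z)"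
  by (simp add: pderiv_dir_def vector_derivative_works)

lemma has_dir_deriv_cong:
  assumes "open U" "z \<in> U" "\<And>x. x \<in> U \<Longrightarrow> f x = g x" "has_dir_deriv b f z d"
  shows "has_dir_deriv b g z d"
proof -
  let ?T = "(\<lambda>t::real. z + t *\<^sub>R b) -` U"
  have "open ?T"
    by (intro open_vimage assms continuous_intros)
  then show ?thesis
    by (rule has_vector_derivative_transform_within_open[OF assms(4)]) (use assms in auto)
qed

lemma dir_differentiable_cong:
  fixes f :: "'a::euclidean_space \<Rightarrow> 'b::real_normed_vector"
  assumes "open U" "z \<in> U" "\<And>x. x \<in> U \<Longrightarrow> f x = g x" "(\<lambda>t. f (z + t *\<^sub>R b)) differentiable (at 0)"
  shows "(\<lambda>t. g (z + t *\<^sub>R b)) differentiable (at 0)"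
proof -
  have "has_dir_deriv b f z (pderiv_dir b f z)"
    using assms(4) by (rule has_dir_deriv_pderiv_dir)
  then have "has_dir_deriv b g z (pderiv_dir b f z)"
    using has_dir_deriv_cong[of U z f g b "pderiv_dir b f z"] assms(1-3) by blast
  then show ?thesis by (rule differentiableI_vector)
qed

lemma has_dir_deriv_along:
  assumes "has_dir_deriv b f (z + s *\<^sub>R b) d"
  shows "((\<lambda>t. f (z + t *\<^sub>R b)) has_vector_derivative d) (at s)"
proof -
  have *: "((\<lambda>t. t - s) has_real_derivative 1) (at s)"
    by (auto intro!: derivative_eq_intros)
  have "((\<lambda>t. f ((z + s *\<^sub>R b) + (t - s) *\<^sub>R b)) has_vector_derivative (1 *\<^sub>R d)) (at s)"
    using vector_diff_chain_at[of "\<lambda>t. t - s" 1 s "\<lambda>t. f ((z + s *\<^sub>R b) + t *\<^sub>R b)" d] assms *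
    by (simp add: o_def has_real_derivative_iff_has_vector_derivative)
  then show ?thesis
    by (simp add: algebra_simps)
qed

text \<open>\<open>cont_diff_on\<close> quantifies over whole lists of directions. Here the
  derivative applied first is split off instead, so that closure properties go by induction on the
  order: the derivative of a product or quotient is again built from functions of one class lower.
  \<open>cont_diff_on_iff_Ck\<close> connects the two.\<close>

primrec Ck :: "nat \<Rightarrow> 'a::euclidean_space set \<Rightarrow> ('a \<Rightarrow> 'b::real_normed_vector) \<Rightarrow> bool" where
  "Ck 0 U f = continuous_on U f"
| "Ck (Suc n) U f = (continuous_on U f \<and>
     (\<forall>b\<in>Basis. (\<forall>z\<in>U. (\<lambda>t. f (z + t *\<^sub>R b)) differentiable (at 0)) \<and> Ck n U (pderiv_dir b f)))"

lemma Ck_continuous: "Ck n U f \<Longrightarrow> continuous_on U f"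
  by (cases n) auto

lemma Ck_has_dir_deriv:
  "Ck n U f \<Longrightarrow> 0 < n \<Longrightarrow> b \<in> Basis \<Longrightarrow> z \<in> U \<Longrightarrow> has_dir_deriv b f z (pderiv_dir b f z)"
  by (cases n) (auto intro: has_dir_deriv_pderiv_dir)

lemma pderiv_dir_cong:
  assumes "open U" "z \<in> U" "\<And>x. x \<in> U \<Longrightarrow> f x = g x"
  shows "pderiv_dir b f z = pderiv_dir b g z"
proof -
  have "has_dir_deriv b f z d \<longleftrightarrow> has_dir_deriv b g z d" for d
    using has_dir_deriv_cong[of U z f g b d] has_dir_deriv_cong[of U z g f b d] assms by auto
  then show ?thesis
    by (simp add: pderiv_dir_def vector_derivative_def)
qed

lemma Ck_cong:
  assumes "open U" "\<And>x. x \<in> U \<Longrightarrow> f x = g x"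
  shows "Ck n U f \<longleftrightarrow> Ck n U g"
  using assms(2)
proof (induction n arbitrary: f g)
  case 0
  then show ?case by (simp cong: continuous_on_cong)
next
  case (Suc n)
  have "(\<lambda>t. f (z + t *\<^sub>R b)) differentiable (at 0) \<longleftrightarrow> (\<lambda>t. g (z + t *\<^sub>R b)) differentiable (at 0)"
    if "z \<in> U" for z b
    using dir_differentiable_cong[OF assms(1) that, of f g b] dir_differentiable_cong[OF assms(1) that, of g f b]
      Suc.prems by auto
  moreover have "Ck n U (pderiv_dir b f) \<longleftrightarrow> Ck n U (pderiv_dir b g)" for b
    by (rule Suc.IH) (rule pderiv_dir_cong[OF assms(1) _ Suc.prems])
  moreover have "continuous_on U f \<longleftrightarrow> continuous_on U g"
    using Suc.prems by (simp cong: continuous_on_cong)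
  ultimately show ?case by simp
qed

lemma Ck_subset: "Ck n U f \<Longrightarrow> W \<subseteq> U \<Longrightarrow> Ck n W f"
  by (induction n arbitrary: f) (auto intro: continuous_on_subset)

lemma Ck_lower: "Ck n U f \<Longrightarrow> k \<le> n \<Longrightarrow> Ck k U f"
proof (induction n arbitrary: k f)
  case (Suc n)
  then show ?case by (cases k) auto
qed auto

text \<open>The candidate \<open>g\<close> comes out of the derivation rules and need only agree
  with \<open>pderiv_dir b f\<close> on \<open>U\<close>; openness of \<open>U\<close> makes such
  agreement pass to all further derivatives.\<close>

lemma CkI:
  assumes "open U" "continuous_on U f"
    and "\<And>b. b \<in> Basis \<Longrightarrow> \<exists>g. (\<forall>z\<in>U. has_dir_deriv b f z (g z)) \<and> Ck n U g"
  shows "Ck (Suc n) U f"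
proof -
  have "(\<forall>z\<in>U. (\<lambda>t. f (z + t *\<^sub>R b)) differentiable (at 0)) \<and> Ck n U (pderiv_dir b f)"
    if b: "b \<in> Basis" for b
  proof -
    obtain g where g: "\<And>z. z \<in> U \<Longrightarrow> has_dir_deriv b f z (g z)" "Ck n U g"
      using assms(3)[OF b] by blast
    have "pderiv_dir b f z = g z" if "z \<in> U" for z using g(1)[OF that] by (rule pderiv_dir_eqI)
    then show ?thesis
      using Ck_cong[OF assms(1), of "pderiv_dir b f" g n] g(2) g(1)[THEN differentiableI_vector]
      by auto
  qed
  then show ?thesis using assms(2) by simp
qed

text \<open>Serves functions whose formula changes from place to place: locally finite sums, and
  pieces extended by zero across \<open>V\<close>.\<close>

lemma Ck_local:
  assumes "\<And>z. z \<in> U \<Longrightarrow> \<exists>W. open W \<and> z \<in> W \<and> Ck n W f"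
  shows "Ck n U f"
  using assms
proof (induction n arbitrary: f)
  case 0
  have "continuous (at z within U) f" if "z \<in> U" for z
    using 0[OF that] by (metis Ck.simps(1) continuous_on_eq_continuous_at continuous_at_imp_continuous_at_within)
  then show ?case by (simp add: continuous_on_eq_continuous_within)
next
  case (Suc n)
  have "continuous (at z within U) f" if "z \<in> U" for z
    using Suc.prems[OF that] by (metis Ck_continuous continuous_on_eq_continuous_at continuous_at_imp_continuous_at_within)
  then have "continuous_on U f" by (simp add: continuous_on_eq_continuous_within)
  moreover have "Ck n U (pderiv_dir b f)" if "b \<in> Basis" for b
    by (rule Suc.IH) (use Suc.prems that in \<open>fastforce\<close>)
  ultimately show ?case using Suc.prems by fastforce
qed

lemma pderivs_simps [simp]: "pderivs [] f = f" "pderivs (b # bs) f = pderiv_dir b (pderivs bs f)"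
  "pderivs (bs @ cs) f = pderivs bs (pderivs cs f)"
  by (simp_all add: pderivs_def)

lemma Ck_pderivs: "Ck n U f \<Longrightarrow> set bs \<subseteq> Basis \<Longrightarrow> length bs \<le> n \<Longrightarrow> Ck (n - length bs) U (pderivs bs f)"
proof (induction bs)
  case (Cons b bs)
  then have "Ck (Suc (n - length (b # bs))) U (pderivs bs f)"
    by (simp add: Suc_diff_Suc)
  then show ?case using Cons.prems by simp
qed simp

lemma cont_diff_on_iff_Ck:
  fixes f :: "'a::euclidean_space \<Rightarrow> 'b::real_normed_vector"
  shows "cont_diff_on (enat n) U f \<longleftrightarrow> Ck n U f"
proof
  assume f: "Ck n U f"
  show "cont_diff_on (enat n) U f"
    unfolding cont_diff_on_def
  proof (intro allI impI conjI ballI)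
    fix bs :: "'a list" assume bs: "set bs \<subseteq> Basis \<and> enat (length bs) \<le> enat n"
    then have C: "Ck (n - length bs) U (pderivs bs f)"
      using Ck_pderivs f by auto
    then show "continuous_on U (pderivs bs f)"
      by (rule Ck_continuous)
    fix b :: 'a and z assume "enat (length bs) < enat n" "b \<in> Basis" "z \<in> U"
    then show "(\<lambda>t. pderivs bs f (z + t *\<^sub>R b)) differentiable (at 0)"
      using Ck_has_dir_deriv[OF C] differentiableI_vector by fastforce
  qed
next
  assume "cont_diff_on (enat n) U f"
  then show "Ck n U f"
  proof (induction n arbitrary: f)
    case 0
    then show ?case by (auto simp: cont_diff_on_def dest: spec[of _ "[]"])
  next
    case (Suc n)
    have "continuous_on U f" "\<And>b z. b \<in> Basis \<Longrightarrow> z \<in> U \<Longrightarrow> (\<lambda>t. f (z + t *\<^sub>R b)) differentiable (at 0)"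
      using Suc.prems by (auto simp: cont_diff_on_def dest: spec[of _ "[]"])
    moreover have "Ck n U (pderiv_dir b f)" if "b \<in> Basis" for b
    proof (rule Suc.IH)
      have "pderivs bs (pderiv_dir b f) = pderivs (bs @ [b]) f" for bs by simp
      then show "cont_diff_on (enat n) U (pderiv_dir b f)"
        using that Suc.prems[unfolded cont_diff_on_def, rule_format, of "_ @ [b]"]
        unfolding cont_diff_on_def by simp
    qed
    ultimately show ?case by simp
  qed
qed

lemma cont_diff_on_infinity:
  fixes f :: "'a::euclidean_space \<Rightarrow> 'b::real_normed_vector"
  shows "cont_diff_on \<infinity> U f \<longleftrightarrow> (\<forall>n. Ck n U f)"
proof
  assume "cont_diff_on \<infinity> U f"
  then show "\<forall>n. Ck n U f"
    unfolding cont_diff_on_iff_Ck[symmetric] cont_diff_on_def by auto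
next
  assume C: "\<forall>n. Ck n U f"
  show "cont_diff_on \<infinity> U f"
    unfolding cont_diff_on_def
  proof (intro allI impI)
    fix bs :: "'a list" assume "set bs \<subseteq> Basis \<and> enat (length bs) \<le> \<infinity>"
    then show "continuous_on U (pderivs bs f) \<and> (enat (length bs) < \<infinity> \<longrightarrow>
        (\<forall>b\<in>Basis. \<forall>z\<in>U. (\<lambda>t. pderivs bs f (z + t *\<^sub>R b)) differentiable (at 0)))"
      using C[rule_format, of "Suc (length bs)", folded cont_diff_on_iff_Ck]
      unfolding cont_diff_on_def by auto
  qed
qed

text \<open>A formula for all derivatives at once certifies C^n: it suffices that each member is
  continuous and differentiates to the next. Jets, mollifications and series of functions are all
  handled this way.\<close>

lemma Ck_family:
  fixes J :: "'a::euclidean_space list \<Rightarrow> 'a \<Rightarrow> 'b::real_normed_vector"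
  assumes cont: "\<And>bs. set bs \<subseteq> Basis \<Longrightarrow> length bs \<le> n \<Longrightarrow> continuous_on UNIV (J bs)"
    and deriv: "\<And>bs b z. set bs \<subseteq> Basis \<Longrightarrow> length bs < n \<Longrightarrow> b \<in> Basis \<Longrightarrow> has_dir_deriv b (J bs) z (J (b # bs) z)"
  shows "Ck n UNIV (J [])" "\<And>bs. set bs \<subseteq> Basis \<Longrightarrow> length bs \<le> n \<Longrightarrow> pderivs bs (J []) = J bs"
proof -
  show *: "pderivs bs (J []) = J bs" if "set bs \<subseteq> Basis" "length bs \<le> n" for bs
    using that
  proof (induction bs)
    case (Cons b bs)
    then have "pderivs bs (J []) = J bs" by simp
    then show ?case using pderiv_dir_eqI[OF deriv[of bs b]] Cons.prems by (simp add: fun_eq_iff[symmetric])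
  qed simp
  have "cont_diff_on (enat n) UNIV (J [])"
    unfolding cont_diff_on_def using cont deriv[THEN differentiableI_vector] by (auto simp: *)
  then show "Ck n UNIV (J [])" by (simp add: cont_diff_on_iff_Ck)
qed

lemma pderivs_cong:
  assumes "open U" "z \<in> U" "\<And>x. x \<in> U \<Longrightarrow> f x = g x"
  shows "pderivs bs f z = pderivs bs g z"
  using assms(2)
proof (induction bs arbitrary: z)
  case (Cons b bs)
  then show ?case using pderiv_dir_cong[OF assms(1) Cons.prems(1), of "pderivs bs f"] by simp
qed (use assms in auto)

section \<open>Closure of C^k under linear and algebraic operations\<close>

lemma Ck_zero: "open U \<Longrightarrow> Ck n U (\<lambda>x. 0)"
proof (induction n)
  case (Suc n)
  show ?case by (rule CkI) (use Suc in \<open>auto intro!: exI[of _ "\<lambda>_. 0"]\<close>)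
qed simp

lemma Ck_const: "open U \<Longrightarrow> Ck n U (\<lambda>x. c)"
proof (induction n)
  case (Suc n)
  show ?case by (rule CkI) (use Suc Ck_zero in \<open>auto intro!: exI[of _ "\<lambda>_. 0"]\<close>)
qed simp

lemma Ck_add: "open U \<Longrightarrow> Ck n U f \<Longrightarrow> Ck n U g \<Longrightarrow> Ck n U (\<lambda>x. f x + g x)"
proof (induction n arbitrary: f g)
  case (Suc n)
  show ?case
  proof (rule CkI)
    fix b :: 'a assume "b \<in> Basis"
    then show "\<exists>h. (\<forall>z\<in>U. has_dir_deriv b (\<lambda>x. f x + g x) z (h z)) \<and> Ck n U h"
      using Suc by (intro exI[of _ "\<lambda>x. pderiv_dir b f x + pderiv_dir b g x"])
        (auto intro!: has_vector_derivative_add has_dir_deriv_pderiv_dir)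
  qed (use Suc in \<open>auto intro: continuous_intros\<close>)
qed (auto intro: continuous_intros)

lemma Ck_linear:
  fixes f :: "'a::euclidean_space \<Rightarrow> 'b::real_normed_vector"
  assumes "bounded_linear L"
  shows "open U \<Longrightarrow> Ck n U f \<Longrightarrow> Ck n U (\<lambda>x. L (f x))"
proof (induction n arbitrary: f)
  case 0
  then show ?case using bounded_linear.continuous_on[OF assms] by auto
next
  case (Suc n)
  show ?case
  proof (rule CkI)
    fix b :: 'a assume "b \<in> Basis"
    then show "\<exists>h. (\<forall>z\<in>U. has_dir_deriv b (\<lambda>x. L (f x)) z (h z)) \<and> Ck n U h"
      using Suc by (intro exI[of _ "\<lambda>x. L (pderiv_dir b f x)"])
        (auto intro!: bounded_linear.has_vector_derivative[OF assms] has_dir_deriv_pderiv_dir)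
  qed (use Suc bounded_linear.continuous_on[OF assms] in auto)
qed

lemma Ck_uminus: "open U \<Longrightarrow> Ck n U f \<Longrightarrow> Ck n U (\<lambda>x. - f x)"
  by (rule Ck_linear[OF bounded_linear_minus[OF bounded_linear_ident]])

lemma Ck_diff: "open U \<Longrightarrow> Ck n U f \<Longrightarrow> Ck n U g \<Longrightarrow> Ck n U (\<lambda>x. f x - g x)"
  using Ck_add[of U n f "\<lambda>x. - g x"] Ck_uminus by auto

lemma Ck_sum: "open U \<Longrightarrow> (\<And>i. i \<in> A \<Longrightarrow> Ck n U (f i)) \<Longrightarrow> Ck n U (\<lambda>x. \<Sum>i\<in>A. f i x)"
  by (induction A rule: infinite_finite_induct) (auto intro: Ck_zero Ck_add)

lemma Ck_inner:
  assumes "open U"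
  shows "Ck n U (\<lambda>x. x \<bullet> v)"
proof (cases n)
  case (Suc k)
  show ?thesis unfolding Suc
  proof (rule CkI[OF assms])
    fix b :: 'a
    have "has_dir_deriv b (\<lambda>x. x \<bullet> v) z (b \<bullet> v)" for z
      by (auto intro!: derivative_eq_intros simp: inner_add_left has_vector_derivative_def)
    then show "\<exists>g. (\<forall>z\<in>U. has_dir_deriv b (\<lambda>x. x \<bullet> v) z (g z)) \<and> Ck k U g"
      by (intro exI[of _ "\<lambda>_. b \<bullet> v"]) (simp add: Ck_const[OF assms])
  qed (auto intro: continuous_intros)
qed (auto intro: continuous_intros)

lemma has_dir_deriv_mult:
  fixes f g :: "'a::euclidean_space \<Rightarrow> real"
  assumes "has_dir_deriv b f z f'" "has_dir_deriv b g z g'"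
  shows "has_dir_deriv b (\<lambda>x. f x * g x) z (f' * g z + f z * g')"
  using has_vector_derivative_mult[OF assms] by (simp add: add.commute)

lemma Ck_mult:
  fixes f g :: "'a::euclidean_space \<Rightarrow> real"
  shows "open U \<Longrightarrow> Ck n U f \<Longrightarrow> Ck n U g \<Longrightarrow> Ck n U (\<lambda>x. f x * g x)"
proof (induction n arbitrary: f g)
  case (Suc n)
  have fg: "Ck n U f" "Ck n U g" using Suc.prems Ck_lower le_SucI by blast+
  show ?case
  proof (rule CkI)
    fix b :: 'a assume "b \<in> Basis"
    then show "\<exists>h. (\<forall>z\<in>U. has_dir_deriv b (\<lambda>x. f x * g x) z (h z)) \<and> Ck n U h"
      using Suc fg by (intro exI[of _ "\<lambda>x. pderiv_dir b f x * g x + f x * pderiv_dir b g x"])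
        (auto intro!: has_dir_deriv_mult has_dir_deriv_pderiv_dir Ck_add)
  qed (use Suc in \<open>auto intro: continuous_intros\<close>)
qed (auto intro: continuous_intros)

lemma has_dir_deriv_inverse:
  fixes f :: "'a::euclidean_space \<Rightarrow> real"
  assumes "has_dir_deriv b f z f'" "f z \<noteq> 0"
  shows "has_dir_deriv b (\<lambda>x. inverse (f x)) z (- (f' * (inverse (f z) * inverse (f z))))"
  using DERIV_inverse'[of "\<lambda>t. f (z + t *\<^sub>R b)" f' 0 UNIV] assms
  by (simp add: has_real_derivative_iff_has_vector_derivative mult_ac)

lemma Ck_inverse:
  fixes f :: "'a::euclidean_space \<Rightarrow> real"
  assumes "open U" "\<And>x. x \<in> U \<Longrightarrow> f x \<noteq> 0"
  shows "Ck n U f \<Longrightarrow> Ck n U (\<lambda>x. inverse (f x))"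
proof (induction n)
  case 0
  then show ?case using assms by (auto intro!: continuous_intros)
next
  case (Suc n)
  have f: "Ck n U f" using Suc.prems Ck_lower le_SucI by blast
  show ?case
  proof (rule CkI[OF assms(1)])
    fix b :: 'a assume "b \<in> Basis"
    then show "\<exists>h. (\<forall>z\<in>U. has_dir_deriv b (\<lambda>x. inverse (f x)) z (h z)) \<and> Ck n U h"
      using Suc f assms by (intro exI[of _ "\<lambda>x. - (pderiv_dir b f x * (inverse (f x) * inverse (f x)))"])
        (auto intro!: has_dir_deriv_inverse has_dir_deriv_pderiv_dir Ck_uminus Ck_mult)
  qed (use Suc assms in \<open>auto intro!: continuous_intros\<close>)
qed

lemma Ck_divide:
  fixes f g :: "'a::euclidean_space \<Rightarrow> real"
  assumes "open U" "\<And>x. x \<in> U \<Longrightarrow> g x \<noteq> 0" "Ck n U f" "Ck n U g"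
  shows "Ck n U (\<lambda>x. f x / g x)"
  unfolding divide_inverse by (intro Ck_mult Ck_inverse assms)

section \<open>Iterated derivatives of sums, linear images and flat products\<close>

lemma pderivs_add:
  fixes f :: "'a::euclidean_space \<Rightarrow> 'b::real_normed_vector"
  assumes "open U" "z \<in> U" "Ck n U f" "Ck n U g" "set bs \<subseteq> Basis" "length bs \<le> n"
  shows "pderivs bs (\<lambda>x. f x + g x) z = pderivs bs f z + pderivs bs g z"
  using assms(2,5,6)
proof (induction bs arbitrary: z)
  case (Cons b bs)
  have "has_dir_deriv b (\<lambda>x. pderivs bs f x + pderivs bs g x) z (pderivs (b # bs) f z + pderivs (b # bs) g z)"
    using Cons.prems Ck_has_dir_deriv[OF Ck_pderivs[OF assms(3), of bs]] Ck_has_dir_deriv[OF Ck_pderivs[OF assms(4), of bs]]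
    by (auto intro!: has_vector_derivative_add)
  then have "has_dir_deriv b (pderivs bs (\<lambda>x. f x + g x)) z (pderivs (b # bs) f z + pderivs (b # bs) g z)"
    by (rule has_dir_deriv_cong[OF assms(1) Cons.prems(1), rotated]) (use Cons in auto)
  then show ?case using pderiv_dir_eqI by auto
qed simp

lemma pderivs_linear:
  fixes f :: "'a::euclidean_space \<Rightarrow> 'b::real_normed_vector"
  assumes L: "bounded_linear L" and "open U" "z \<in> U" "Ck n U f" "set bs \<subseteq> Basis" "length bs \<le> n"
  shows "pderivs bs (\<lambda>x. L (f x)) z = L (pderivs bs f z)"
  using assms(3,5,6)
proof (induction bs arbitrary: z)
  case (Cons b bs)
  have "has_dir_deriv b (\<lambda>x. L (pderivs bs f x)) z (L (pderivs (b # bs) f z))"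
    using Cons.prems Ck_has_dir_deriv[OF Ck_pderivs[OF assms(4), of bs]]
    by (auto intro!: bounded_linear.has_vector_derivative[OF L])
  then have "has_dir_deriv b (pderivs bs (\<lambda>x. L (f x))) z (L (pderivs (b # bs) f z))"
    by (rule has_dir_deriv_cong[OF assms(2) Cons.prems(1), rotated]) (use Cons in auto)
  then show ?case using pderiv_dir_eqI by auto
qed simp

lemma pderivs_zero: "pderivs bs (\<lambda>x. 0) z = 0"
proof (induction bs arbitrary: z)
  case (Cons b bs)
  then show ?case by (simp add: pderiv_dir_def)
qed simp

lemma pderivs_vanish:
  assumes "open U" "z \<in> U" "\<And>x. x \<in> U \<Longrightarrow> f x = 0"
  shows "pderivs bs f z = 0"
  using pderivs_cong[OF assms(1,2), of f "\<lambda>_. 0" bs] assms(3) pderivs_zero by metis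

lemma pderivs_sum:
  assumes "open U" "z \<in> U" "\<And>i. i \<in> A \<Longrightarrow> Ck n U (f i)" "set bs \<subseteq> Basis" "length bs \<le> n"
  shows "pderivs bs (\<lambda>x. \<Sum>i\<in>A. f i x) z = (\<Sum>i\<in>A. pderivs bs (f i) z)"
  using assms(3)
proof (induction A rule: infinite_finite_induct)
  case (insert i A)
  then show ?case
    using pderivs_add[OF assms(1,2), of n "f i" "\<lambda>x. \<Sum>i\<in>A. f i x" bs] Ck_sum[OF assms(1), of A n f] assms
    by auto
qed (auto simp: pderivs_zero)

lemma pderivs_diff:
  assumes "open U" "z \<in> U" "Ck n U f" "Ck n U g" "set bs \<subseteq> Basis" "length bs \<le> n"
  shows "pderivs bs (\<lambda>x. f x - g x) z = pderivs bs f z - pderivs bs g z"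
  using pderivs_add[OF assms(1-3) Ck_uminus[OF assms(1,4)] assms(5,6)]
    pderivs_linear[OF bounded_linear_minus[OF bounded_linear_ident] assms(1,2,4,5,6)] by simp

text \<open>Avoids the general Leibniz formula. Splitting off the derivative applied first, which is
  the last list entry, leaves two products, each with a factor (\<open>f\<close> or its derivative)
  that is still flat at \<open>z\<close>, to order one less.\<close>

lemma pderivs_flat_mult:
  fixes f g :: "'a::euclidean_space \<Rightarrow> real"
  assumes "Ck n UNIV f" "Ck n UNIV g" "set bs \<subseteq> Basis" "length bs \<le> n"
    and "\<And>bs. set bs \<subseteq> Basis \<Longrightarrow> length bs \<le> n \<Longrightarrow> pderivs bs f z = 0"
  shows "pderivs bs (\<lambda>x. f x * g x) z = 0"
  using assms
proof (induction bs arbitrary: f g n rule: rev_induct)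
  case Nil
  then show ?case using Nil.prems(5)[of "[]"] by simp
next
  case (snoc b bs)
  obtain k where k: "n = Suc k" using snoc.prems(4) by (cases n) auto
  have b: "b \<in> Basis" using snoc.prems by auto
  have C: "Ck k UNIV f" "Ck k UNIV g" "Ck k UNIV (pderiv_dir b f)" "Ck k UNIV (pderiv_dir b g)"
    using Ck_lower[OF snoc.prems(1), of k] Ck_lower[OF snoc.prems(2), of k] snoc.prems(1,2) b k by auto
  have "has_dir_deriv b f x (pderiv_dir b f x)" "has_dir_deriv b g x (pderiv_dir b g x)" for x
    using Ck_has_dir_deriv[OF snoc.prems(1) _ b] Ck_has_dir_deriv[OF snoc.prems(2) _ b] k by auto
  then have "pderiv_dir b (\<lambda>x. f x * g x) x = pderiv_dir b f x * g x + f x * pderiv_dir b g x" for x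
    by (intro pderiv_dir_eqI has_dir_deriv_mult)
  then have eq: "pderiv_dir b (\<lambda>x. f x * g x) = (\<lambda>x. pderiv_dir b f x * g x + f x * pderiv_dir b g x)"
    by (rule ext)
  have "pderivs (bs @ [b]) (\<lambda>x. f x * g x) z
      = pderivs bs (\<lambda>x. pderiv_dir b f x * g x + f x * pderiv_dir b g x) z" by (simp add: eq)
  also have "\<dots> = pderivs bs (\<lambda>x. pderiv_dir b f x * g x) z + pderivs bs (\<lambda>x. f x * pderiv_dir b g x) z"
    by (rule pderivs_add[of UNIV _ k]) (use C snoc.prems k in \<open>auto intro!: Ck_mult simp del: Ck.simps\<close>)
  also have "pderivs bs (\<lambda>x. pderiv_dir b f x * g x) z = 0"
    by (rule snoc.IH[of k]) (use C snoc.prems(3,4) snoc.prems(5)[of "_ @ [b]"] k b in \<open>auto simp del: Ck.simps\<close>)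
  also have "pderivs bs (\<lambda>x. f x * pderiv_dir b g x) z = 0"
    by (rule snoc.IH[of k]) (use C snoc.prems(3-5) k in \<open>auto simp del: Ck.simps\<close>)
  finally show ?case by simp
qed

section \<open>Scaled $C^k$ bounds\<close>

text \<open>\<open>Ck_bd n \<rho> w U f\<close>: the derivatives of order \<open>i \<le> n\<close> are bounded by \<open>w / \<rho> ^ i\<close> on \<open>U\<close>.\<close>

primrec Ck_bd :: "nat \<Rightarrow> real \<Rightarrow> real \<Rightarrow> 'a::euclidean_space set \<Rightarrow> ('a \<Rightarrow> 'b::real_normed_vector) \<Rightarrow> bool" where
  "Ck_bd 0 \<rho> w U f = (continuous_on U f \<and> (\<forall>z\<in>U. norm (f z) \<le> w))"
| "Ck_bd (Suc n) \<rho> w U f = (continuous_on U f \<and> (\<forall>z\<in>U. norm (f z) \<le> w) \<and>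
     (\<forall>b\<in>Basis. (\<forall>z\<in>U. (\<lambda>t. f (z + t *\<^sub>R b)) differentiable (at 0)) \<and> Ck_bd n \<rho> (w / \<rho>) U (pderiv_dir b f)))"

text \<open>The recursive form serves inductions, the explicit one serves applications. The
  derivative applied first is the last list entry, hence \<open>rev_exhaust\<close>.\<close>

lemma Ck_bd_iff:
  "Ck_bd n \<rho> w U f \<longleftrightarrow> Ck n U f \<and>
    (\<forall>bs. set bs \<subseteq> Basis \<and> length bs \<le> n \<longrightarrow> (\<forall>z\<in>U. norm (pderivs bs f z) \<le> w / \<rho> ^ length bs))"
proof (induction n arbitrary: w f)
  case (Suc n)
  show ?case (is "_ \<longleftrightarrow> _ \<and> ?R")
  proof (intro iffI)
    assume L: "Ck_bd (Suc n) \<rho> w U f"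
    have "norm (pderivs bs f z) \<le> w / \<rho> ^ length bs" if "set bs \<subseteq> Basis" "length bs \<le> Suc n" "z \<in> U" for bs z
      using that
    proof (cases bs rule: rev_exhaust)
      case (snoc cs b)
      then have "Ck_bd n \<rho> (w / \<rho>) U (pderiv_dir b f)" using L that by auto
      then have "norm (pderivs cs (pderiv_dir b f) z) \<le> w / \<rho> / \<rho> ^ length cs"
        using Suc.IH snoc that by auto
      then show ?thesis using snoc by (simp add: mult.commute)
    qed (use L in auto)
    then show "Ck (Suc n) U f \<and> ?R" using L Suc.IH by auto
  next
    assume R: "Ck (Suc n) U f \<and> ?R"
    have "norm (f z) \<le> w" if "z \<in> U" for z
      using R[THEN conjunct2, rule_format, of "[]"] that by auto
    moreover have "norm (pderivs bs (pderiv_dir b f) z) \<le> w / \<rho> / \<rho> ^ length bs"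
      if "b \<in> Basis" "set bs \<subseteq> Basis" "length bs \<le> n" "z \<in> U" for bs b z
      using R[THEN conjunct2, rule_format, of "bs @ [b]"] that by (auto simp: mult.commute)
    ultimately show "Ck_bd (Suc n) \<rho> w U f" using R Suc.IH by auto
  qed
qed (auto)

lemma Ck_bd_Ck: "Ck_bd n \<rho> w U f \<Longrightarrow> Ck n U f"
  by (simp add: Ck_bd_iff)

lemma Ck_bd_bound: "Ck_bd n \<rho> w U f \<Longrightarrow> z \<in> U \<Longrightarrow> norm (f z) \<le> w"
  by (cases n) auto

lemma Ck_bd_pderivs:
  "Ck_bd n \<rho> w U f \<Longrightarrow> set bs \<subseteq> Basis \<Longrightarrow> length bs \<le> n \<Longrightarrow> z \<in> U \<Longrightarrow>
    norm (pderivs bs f z) \<le> w / \<rho> ^ length bs"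
  by (simp add: Ck_bd_iff)

lemma Ck_bd_lower: "Ck_bd n \<rho> w U f \<Longrightarrow> k \<le> n \<Longrightarrow> Ck_bd k \<rho> w U f"
  unfolding Ck_bd_iff by (auto intro: Ck_lower)

lemma Ck_bd_mono: "Ck_bd n \<rho> w U f \<Longrightarrow> w \<le> w' \<Longrightarrow> 0 < \<rho> \<Longrightarrow> Ck_bd n \<rho> w' U f"
  unfolding Ck_bd_iff by (meson divide_right_mono order_trans zero_le_power less_imp_le)

text \<open>Each of at most \<open>n\<close> factors \<open>1 / r\<close> is at most
  \<open>\<kappa> / \<rho>\<close>. This lets bumps of different radii be compared at one common
  scale.\<close>

lemma Ck_bd_rescale:
  assumes "Ck_bd n r w U f" "\<rho> \<le> \<kappa> * r" "1 \<le> \<kappa>" "0 < r" "0 < \<rho>" "0 \<le> w"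
  shows "Ck_bd n \<rho> (\<kappa> ^ n * w) U f"
proof -
  have "w / r ^ k \<le> \<kappa> ^ n * w / \<rho> ^ k" if "k \<le> n" for k
  proof -
    have "\<rho> ^ k \<le> (\<kappa> * r) ^ k" using assms by (intro power_mono) auto
    also have "\<dots> \<le> \<kappa> ^ n * r ^ k"
      using assms that by (auto simp: power_mult_distrib intro!: mult_right_mono power_increasing)
    finally have "w * \<rho> ^ k \<le> w * (\<kappa> ^ n * r ^ k)" using assms by (intro mult_left_mono) auto
    then show ?thesis using assms by (simp add: field_simps)
  qed
  then show ?thesis using assms(1) unfolding Ck_bd_iff by (meson order_trans)
qed

lemma Ck_bd_cong:
  assumes "open U" "\<And>x. x \<in> U \<Longrightarrow> f x = g x"
  shows "Ck_bd n \<rho> w U f \<longleftrightarrow> Ck_bd n \<rho> w U g"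
  unfolding Ck_bd_iff using Ck_cong[OF assms] pderivs_cong[OF assms(1) _ assms(2)] by auto

lemma Ck_bdI:
  assumes "open U" "continuous_on U f" "\<And>z. z \<in> U \<Longrightarrow> norm (f z) \<le> w"
    and "\<And>b. b \<in> Basis \<Longrightarrow> \<exists>g. (\<forall>z\<in>U. has_dir_deriv b f z (g z)) \<and> Ck_bd n \<rho> (w / \<rho>) U g"
  shows "Ck_bd (Suc n) \<rho> w U f"
proof -
  have "(\<forall>z\<in>U. (\<lambda>t. f (z + t *\<^sub>R b)) differentiable (at 0)) \<and> Ck_bd n \<rho> (w / \<rho>) U (pderiv_dir b f)"
    if b: "b \<in> Basis" for b
  proof -
    obtain g where g: "\<And>z. z \<in> U \<Longrightarrow> has_dir_deriv b f z (g z)" "Ck_bd n \<rho> (w / \<rho>) U g"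
      using assms(4)[OF b] by blast
    have "pderiv_dir b f z = g z" if "z \<in> U" for z using g(1)[OF that] by (rule pderiv_dir_eqI)
    then show ?thesis
      using Ck_bd_cong[OF assms(1), of "pderiv_dir b f" g n] g(2) g(1)[THEN differentiableI_vector]
      by auto
  qed
  then show ?thesis using assms(2,3) by simp
qed

lemma Ck_bd_zero: "open U \<Longrightarrow> 0 \<le> w \<Longrightarrow> 0 < \<rho> \<Longrightarrow> Ck_bd n \<rho> w U (\<lambda>x. 0)"
  unfolding Ck_bd_iff by (auto simp: Ck_zero pderivs_zero)

lemma Ck_bd_add:
  assumes "open U" "Ck_bd n \<rho> v U f" "Ck_bd n \<rho> w U g" shows "Ck_bd n \<rho> (v + w) U (\<lambda>x. f x + g x)"
  unfolding Ck_bd_iff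
proof (intro conjI allI impI ballI)
  show "Ck n U (\<lambda>x. f x + g x)" using assms by (auto intro: Ck_add Ck_bd_Ck)
  fix bs :: "'a list" and z assume *: "set bs \<subseteq> Basis \<and> length bs \<le> n" "z \<in> U"
  then have "pderivs bs (\<lambda>x. f x + g x) z = pderivs bs f z + pderivs bs g z"
    using assms by (auto intro!: pderivs_add Ck_bd_Ck)
  also have "norm \<dots> \<le> v / \<rho> ^ length bs + w / \<rho> ^ length bs"
    using assms * by (intro norm_triangle_mono) (auto intro!: Ck_bd_pderivs)
  finally show "norm (pderivs bs (\<lambda>x. f x + g x) z) \<le> (v + w) / \<rho> ^ length bs"
    by (simp add: add_divide_distrib)
qed

lemma Ck_bd_uminus: "open U \<Longrightarrow> Ck_bd n \<rho> w U f \<Longrightarrow> Ck_bd n \<rho> w U (\<lambda>x. - f x)"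
  unfolding Ck_bd_iff using pderivs_linear[OF bounded_linear_minus[OF bounded_linear_ident], of U _ n f] Ck_uminus
  by fastforce

lemma Ck_bd_sum:
  assumes "open U" "0 < \<rho>" "\<And>i. i \<in> A \<Longrightarrow> Ck_bd n \<rho> (w i) U (f i)"
  shows "Ck_bd n \<rho> (\<Sum>i\<in>A. w i) U (\<lambda>x. \<Sum>i\<in>A. f i x)"
  using assms(3)
  by (induction A rule: infinite_finite_induct) (auto intro: Ck_bd_zero Ck_bd_add assms)

lemma Ck_bd_scaleR:
  "open U \<Longrightarrow> Ck_bd n \<rho> w U f \<Longrightarrow> Ck_bd n \<rho> (\<bar>c\<bar> * w) U (\<lambda>x. c *\<^sub>R f x)"
  unfolding Ck_bd_iff
proof (intro conjI allI impI ballI; elim conjE)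
  fix bs :: "'a list" and z
  assume *: "open U" "z \<in> U" "set bs \<subseteq> Basis" "length bs \<le> n" "Ck n U f"
    "\<forall>bs. set bs \<subseteq> Basis \<and> length bs \<le> n \<longrightarrow> (\<forall>z\<in>U. norm (pderivs bs f z) \<le> w / \<rho> ^ length bs)"
  then have "pderivs bs (\<lambda>x. c *\<^sub>R f x) z = c *\<^sub>R pderivs bs f z"
    by (intro pderivs_linear bounded_linear_scaleR_right)
  then have "norm (pderivs bs (\<lambda>x. c *\<^sub>R f x) z) = \<bar>c\<bar> * norm (pderivs bs f z)" by simp
  also have "\<dots> \<le> \<bar>c\<bar> * (w / \<rho> ^ length bs)" using * by (intro mult_left_mono) auto
  finally show "norm (pderivs bs (\<lambda>x. c *\<^sub>R f x) z) \<le> \<bar>c\<bar> * w / \<rho> ^ length bs" by simp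
qed (auto intro: Ck_linear bounded_linear_scaleR_right)

text \<open>\<open>2 ^ n\<close> bounds the number of terms after n applications of the product
  rule. The scale is unaffected, since a term with i derivatives on \<open>f\<close> and j on
  \<open>g\<close> is divided by \<open>\<rho> ^ (i + j)\<close>.\<close>

lemma Ck_bd_mult:
  fixes f g :: "'a::euclidean_space \<Rightarrow> real"
  assumes "open U" "0 < \<rho>" "0 \<le> v" "0 \<le> w"
  shows "Ck_bd n \<rho> v U f \<Longrightarrow> Ck_bd n \<rho> w U g \<Longrightarrow> Ck_bd n \<rho> (2 ^ n * (v * w)) U (\<lambda>x. f x * g x)"
  using assms(3,4)
proof (induction n arbitrary: f g v w)
  case 0
  then show ?case by (auto intro!: continuous_intros mult_mono simp: abs_mult)
next
  case (Suc n)
  have fg: "Ck_bd n \<rho> v U f" "Ck_bd n \<rho> w U g" using Suc.prems Ck_bd_lower le_SucI by blast+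
  have "\<bar>f z * g z\<bar> \<le> 2 ^ Suc n * (v * w)" if "z \<in> U" for z
  proof -
    have "\<bar>f z\<bar> * \<bar>g z\<bar> \<le> v * w" using Suc.prems that by (intro mult_mono) auto
    also have "\<dots> \<le> 2 ^ Suc n * (v * w)" using Suc.prems using mult_right_mono[of 1 "2 ^ Suc n" "v * w"] by (simp del: power_Suc)
    finally show ?thesis by (simp add: abs_mult)
  qed
  moreover have "Ck_bd n \<rho> (2 ^ Suc n * (v * w) / \<rho>) U (\<lambda>x. pderiv_dir b f x * g x + f x * pderiv_dir b g x)"
    if "b \<in> Basis" for b
  proof -
    have "Ck_bd n \<rho> (2 ^ n * (v / \<rho> * w)) U (\<lambda>x. pderiv_dir b f x * g x)"
      by (rule Suc.IH) (use Suc.prems fg that assms in auto)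
    moreover have "Ck_bd n \<rho> (2 ^ n * (v * (w / \<rho>))) U (\<lambda>x. f x * pderiv_dir b g x)"
      by (rule Suc.IH) (use Suc.prems fg that assms in auto)
    moreover have "2 ^ n * (v / \<rho> * w) + 2 ^ n * (v * (w / \<rho>)) = 2 ^ Suc n * (v * w) / \<rho>"
      by (simp add: field_simps)
    ultimately show ?thesis
      using Ck_bd_add[OF assms(1), of n \<rho> "2 ^ n * (v / \<rho> * w)" "\<lambda>x. pderiv_dir b f x * g x"
          "2 ^ n * (v * (w / \<rho>))" "\<lambda>x. f x * pderiv_dir b g x"] by (simp only:)
  qed
  ultimately show ?case
    using Suc.prems assms
    by (intro Ck_bdI) (auto intro!: continuous_intros has_dir_deriv_mult exI[of _ "\<lambda>x. pderiv_dir _ f x * g x + f x * pderiv_dir _ g x"]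
        has_dir_deriv_pderiv_dir)
qed

text \<open>The order of quantifiers matters: \<open>C'\<close> depends on \<open>n\<close> and
  \<open>C\<close> alone, so one constant serves all the neighbourhoods that shrink towards
  \<open>V\<close>, with their different scales.\<close>

lemma Ck_bd_inverse:
  fixes C :: real
  assumes "0 \<le> C"
  shows "\<exists>C'\<ge>0. \<forall>U \<rho> (f :: 'a::euclidean_space \<Rightarrow> real). open U \<longrightarrow> 0 < \<rho> \<longrightarrow> (\<forall>x\<in>U. 1 \<le> f x) \<longrightarrow>
           Ck_bd n \<rho> C U f \<longrightarrow> Ck_bd n \<rho> C' U (\<lambda>x. inverse (f x))"
proof (induction n)
  case 0
  have "\<bar>inverse (f x)\<bar> \<le> 1" if "1 \<le> f x" for f :: "'a \<Rightarrow> real" and x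
    using that by (simp add: inverse_le_1_iff)
  then show ?case by (intro exI[of _ 1]) (fastforce intro!: continuous_intros)
next
  case (Suc n)
  then obtain C1 where C1: "C1 \<ge> 0" and IH': "\<forall>U \<rho> (f :: 'a \<Rightarrow> real). open U \<longrightarrow> 0 < \<rho> \<longrightarrow> (\<forall>x\<in>U. 1 \<le> f x)
      \<longrightarrow> Ck_bd n \<rho> C U f \<longrightarrow> Ck_bd n \<rho> C1 U (\<lambda>x. inverse (f x))" by (elim exE conjE)
  note IH = IH'[rule_format]
  \<comment> \<open>The first entry bounds the reciprocal itself, the second its derivative
    \<open>- f' / f^2\<close>, by two applications of the product bound.\<close>
  define C2 where "C2 = max 1 (2 ^ n * (C * (2 ^ n * (C1 * C1))))"
  have "Ck_bd (Suc n) \<rho> C2 U (\<lambda>x. inverse (f x))"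
    if *: "open U" "0 < \<rho>" "\<And>x. x \<in> U \<Longrightarrow> 1 \<le> f x" "Ck_bd (Suc n) \<rho> C U f" for U \<rho> and f :: "'a \<Rightarrow> real"
  proof -
    have I: "Ck_bd n \<rho> C1 U (\<lambda>x. inverse (f x))"
      using * by (intro IH) (auto intro: Ck_bd_lower[OF *(4)])
    have "Ck_bd n \<rho> (C2 / \<rho>) U (\<lambda>x. - (pderiv_dir b f x * (inverse (f x) * inverse (f x))))" if "b \<in> Basis" for b
    proof -
      have "Ck_bd n \<rho> (2 ^ n * (C / \<rho> * (2 ^ n * (C1 * C1)))) U (\<lambda>x. pderiv_dir b f x * (inverse (f x) * inverse (f x)))"
        using * that I C1 assms by (intro Ck_bd_mult) auto
      then have "Ck_bd n \<rho> (C2 / \<rho>) U (\<lambda>x. pderiv_dir b f x * (inverse (f x) * inverse (f x)))"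
        by (rule Ck_bd_mono) (use * in \<open>auto simp: C2_def divide_right_mono\<close>)
      then show ?thesis using Ck_bd_uminus * by blast
    qed
    moreover have "\<bar>inverse (f x)\<bar> \<le> C2" if "x \<in> U" for x
      using *(3)[OF that] inverse_le_1_iff[of "f x"] by (auto simp: C2_def intro: le_max_iff_disj[THEN iffD2])
    moreover have "f x \<noteq> 0" if "x \<in> U" for x using *(3)[OF that] by auto
    ultimately show ?thesis using *
      by (intro Ck_bdI) (auto intro!: continuous_intros has_dir_deriv_inverse has_dir_deriv_pderiv_dir
          exI[of _ "\<lambda>x. - (pderiv_dir _ f x * (inverse (f x) * inverse (f x)))"])
  qed
  then show ?case by (intro exI[of _ C2]) (auto simp: C2_def)
qed

text \<open>Dilation by \<open>r\<close> multiplies the scale and leaves the weight alone; this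
  invariance is the purpose of normalising derivatives by powers of \<open>\<rho>\<close>.\<close>

lemma Ck_bd_affine:
  assumes "0 < r" "open U"
  shows "Ck_bd n \<rho> w UNIV f \<Longrightarrow> Ck_bd n (r * \<rho>) w U (\<lambda>x. f ((x - c) /\<^sub>R r))"
proof (induction n arbitrary: f w)
  case 0
  then show ?case using assms by (auto intro!: continuous_intros continuous_on_compose2[of UNIV f])
next
  case (Suc n)
  have d: "has_dir_deriv b (\<lambda>x. f ((x - c) /\<^sub>R r)) z (pderiv_dir b f ((z - c) /\<^sub>R r) /\<^sub>R r)" if "b \<in> Basis" for b z
  proof -
    have "has_dir_deriv b f ((z - c) /\<^sub>R r) (pderiv_dir b f ((z - c) /\<^sub>R r))"
      using Suc.prems that by (auto intro: has_dir_deriv_pderiv_dir)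
    then have 1: "((\<lambda>t. f ((z - c) /\<^sub>R r + t *\<^sub>R b)) has_vector_derivative (pderiv_dir b f ((z - c) /\<^sub>R r))) (at (0 / r))"
      by simp
    have 2: "((\<lambda>t. t / r) has_vector_derivative inverse r) (at 0)"
      using assms by (auto intro!: derivative_eq_intros simp: has_real_derivative_iff_has_vector_derivative[symmetric] divide_inverse)
    have "((\<lambda>t. f ((z - c) /\<^sub>R r + (t / r) *\<^sub>R b)) has_vector_derivative (inverse r *\<^sub>R pderiv_dir b f ((z - c) /\<^sub>R r))) (at 0)"
      using vector_diff_chain_at[OF 2 1] by (simp add: o_def)
    then show ?thesis by (simp add: algebra_simps divide_inverse)
  qed
  have "Ck_bd n (r * \<rho>) (w / (r * \<rho>)) U (\<lambda>x. pderiv_dir b f ((x - c) /\<^sub>R r) /\<^sub>R r)" if "b \<in> Basis" for b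
  proof -
    have "Ck_bd n (r * \<rho>) (w / \<rho>) U (\<lambda>x. pderiv_dir b f ((x - c) /\<^sub>R r))"
      by (rule Suc.IH) (use Suc.prems that in auto)
    from Ck_bd_scaleR[OF assms(2) this, of "inverse r"] show ?thesis
      using assms by (simp add: field_simps)
  qed
  with d show ?case
    using Suc.prems assms by (intro Ck_bdI)
      (auto intro!: continuous_intros continuous_on_compose2[of UNIV f] exI[of _ "\<lambda>x. pderiv_dir _ f ((x - c) /\<^sub>R r) /\<^sub>R r"])
qed

lemma Ck_bd_compact_support:
  fixes f :: "'a::euclidean_space \<Rightarrow> 'b::real_normed_vector"
  assumes "Ck n UNIV f" "compact K" "\<And>x. x \<notin> K \<Longrightarrow> f x = 0"
  shows "\<exists>C\<ge>0. Ck_bd n 1 C UNIV f"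
proof -
  let ?L = "{bs :: 'a list. set bs \<subseteq> Basis \<and> length bs \<le> n}"
  have ex: "\<exists>C. 0 \<le> C \<and> (\<forall>z. norm (pderivs bs f z) \<le> C)" if "bs \<in> ?L" for bs
  proof -
    have "continuous_on UNIV (pderivs bs f)"
      using Ck_continuous[OF Ck_pderivs[OF assms(1)]] that by auto
    then have "bounded (pderivs bs f ` K)"
      using assms(2) by (meson compact_continuous_image compact_imp_bounded continuous_on_subset subset_UNIV)
    then obtain C where "\<And>z. z \<in> K \<Longrightarrow> norm (pderivs bs f z) \<le> C"
      by (auto simp: bounded_iff)
    moreover have "pderivs bs f z = 0" if "z \<notin> K" for z
      by (rule pderivs_vanish[of "- K"]) (use assms that compact_imp_closed in auto)
    ultimately show ?thesis
      by (intro exI[of _ "max C 0"]) (metis max.cobounded1 max.cobounded2 norm_zero order_trans)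
  qed
  obtain C where "\<forall>bs\<in>?L. 0 \<le> C bs \<and> (\<forall>z. norm (pderivs bs f z) \<le> C bs)"
    using bchoice[of ?L "\<lambda>bs C. 0 \<le> C \<and> (\<forall>z. norm (pderivs bs f z) \<le> C)"] ex by blast
  then have C: "\<And>bs z. bs \<in> ?L \<Longrightarrow> norm (pderivs bs f z) \<le> C bs" "\<And>bs. bs \<in> ?L \<Longrightarrow> 0 \<le> C bs"
    by blast+
  have fin: "finite ?L" by (rule finite_lists_length_le) simp
  have "norm (pderivs bs f z) \<le> sum C ?L" if "bs \<in> ?L" for bs z
    using C(1)[OF that, of z] member_le_sum[OF that _ fin, of C] C(2) by fastforce
  then show ?thesis
    using assms(1) C(2) by (intro exI[of _ "sum C ?L"]) (auto simp: Ck_bd_iff intro!: sum_nonneg)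
qed

section \<open>A smooth bump function\<close>

text \<open>exp(-1/t) times powers of 1/t, extended by zero. The members of the family differentiate
  into combinations of each other, which turns smoothness into an induction over all
  \<open>p\<close> at once.\<close>

definition flat_exp :: "nat \<Rightarrow> real \<Rightarrow> real" where
  "flat_exp p t = (if 0 < t then exp (- inverse t) * inverse t ^ p else 0)"

lemma power_le_fact_exp: "0 \<le> s \<Longrightarrow> s ^ n \<le> fact n * exp (s::real)"
proof -
  assume "0 \<le> s"
  then have "(\<Sum>i\<in>{n}. s ^ i /\<^sub>R fact i) \<le> (\<Sum>i. s ^ i /\<^sub>R fact i)"
    by (intro sum_le_suminf summable_exp_generic) auto
  then show ?thesis by (simp add: exp_def field_simps)
qed

text \<open>From \<open>power_le_fact_exp\<close> at s = 1/t with exponent p + 1. A linear bound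
  suffices at 0, since the difference quotient there of the member \<open>p\<close> is the member
  \<open>p + 1\<close>.\<close>

lemma flat_exp_bound: "\<bar>flat_exp p t\<bar> \<le> fact (Suc p) * \<bar>t\<bar>"
proof (cases "0 < t")
  case True
  have "inverse t ^ Suc p \<le> fact (Suc p) * exp (inverse t)"
    using True by (intro power_le_fact_exp) simp
  then have "exp (- inverse t) * inverse t ^ Suc p * t \<le> exp (- inverse t) * (fact (Suc p) * exp (inverse t)) * t"
    using True by (intro mult_right_mono mult_left_mono) auto
  then show ?thesis using True by (simp add: flat_exp_def exp_minus field_simps)
next
  case False
  then have "flat_exp p t = 0" by (simp add: flat_exp_def)
  then show ?thesis by simp
qed

lemma DERIV_flat_exp: "(flat_exp p has_real_derivative flat_exp (p + 2) t - real p * flat_exp (p + 1) t) (at t)"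
proof -
  consider "t < 0" | "t = 0" | "t > 0" by linarith
  then show ?thesis
  proof cases
    case 1
    have "((\<lambda>t. 0) has_real_derivative 0) (at t)" by simp
    then have "(flat_exp p has_real_derivative 0) (at t)"
      by (rule has_field_derivative_transform_within_open[of _ _ _ "{..<0}"]) (use 1 in \<open>auto simp: flat_exp_def\<close>)
    then show ?thesis using 1 by (simp add: flat_exp_def)
  next
    case 2
    have "((\<lambda>h. flat_exp (Suc p) h) \<longlongrightarrow> 0) (at 0)"
    proof (rule Lim_null_comparison)
      show "\<forall>\<^sub>F h in at 0. norm (flat_exp (Suc p) h) \<le> fact (Suc (Suc p)) * \<bar>h\<bar>"
        by (intro always_eventually allI) (use flat_exp_bound[of "Suc p"] in simp)
      show "((\<lambda>h. fact (Suc (Suc p)) * \<bar>h\<bar>) \<longlongrightarrow> 0) (at (0::real))"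
        by (auto intro!: tendsto_eq_intros)
    qed
    moreover have "(flat_exp p (0 + h) - flat_exp p 0) / h = flat_exp (Suc p) h" for h
      by (simp add: flat_exp_def divide_inverse)
    ultimately show ?thesis using 2 by (simp add: DERIV_def) (simp add: flat_exp_def)
  next
    case 3
    have *: "exp (- inverse t) * inverse t ^ 2 * inverse t ^ p - p * (exp (- inverse t) * inverse t ^ (p + 1)) =
        exp (- inverse t) * (inverse t * inverse t) * inverse t ^ p + real p * (- (inverse t * inverse t) * inverse t ^ (p - Suc 0)) * exp (- inverse t)"
      using 3 by (cases p) (auto simp: field_simps power2_eq_square)
    have "((\<lambda>t. exp (- inverse t) * inverse t ^ p) has_real_derivative
       exp (- inverse t) * (inverse t * inverse t) * inverse t ^ p + real p * (- (inverse t * inverse t) * inverse t ^ (p - Suc 0)) * exp (- inverse t)) (at t)"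
      using 3 by (auto intro!: derivative_eq_intros simp: power2_eq_square)
    then have "(flat_exp p has_real_derivative exp (- inverse t) * (inverse t * inverse t) * inverse t ^ p + real p * (- (inverse t * inverse t) * inverse t ^ (p - Suc 0)) * exp (- inverse t)) (at t)"
      by (rule has_field_derivative_transform_within_open[of _ _ _ "{0<..}"]) (use 3 in \<open>auto simp: flat_exp_def\<close>)
    moreover have "flat_exp (p + 2) t - real p * flat_exp (p + 1) t = exp (- inverse t) * inverse t ^ 2 * inverse t ^ p - p * (exp (- inverse t) * inverse t ^ (p + 1))"
      using 3 by (simp add: flat_exp_def power_add mult_ac power2_eq_square)
    ultimately show ?thesis using * by simp
  qed
qed

lemma Ck_flat_exp: "open U \<Longrightarrow> Ck n U g \<Longrightarrow> Ck n U (\<lambda>x. flat_exp p (g x))"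
proof (induction n arbitrary: p)
  case 0
  have "continuous_on UNIV (flat_exp p)"
    by (meson DERIV_flat_exp DERIV_isCont continuous_at_imp_continuous_on)
  then show ?case using 0 by (auto intro: continuous_on_compose2[of UNIV "flat_exp p"])
next
  case (Suc n)
  have c: "continuous_on UNIV (flat_exp p)"
    by (meson DERIV_flat_exp DERIV_isCont continuous_at_imp_continuous_on)
  have C: "Ck n U g" using Suc.prems Ck_lower le_SucI by blast
  show ?case
  proof (rule CkI[OF Suc.prems(1)])
    show "continuous_on U (\<lambda>x. flat_exp p (g x))"
      by (rule continuous_on_compose2[OF c Ck_continuous[OF C]]) simp
    fix b :: 'a assume b: "b \<in> Basis"
    have "has_dir_deriv b (\<lambda>x. flat_exp p (g x)) z ((flat_exp (p + 2) (g z) - real p * flat_exp (p + 1) (g z)) * pderiv_dir b g z)"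
      if "z \<in> U" for z
    proof -
      have "((\<lambda>t. g (z + t *\<^sub>R b)) has_real_derivative pderiv_dir b g z) (at 0)"
        using Ck_has_dir_deriv[OF Suc.prems(2) _ b that] by (simp add: has_real_derivative_iff_has_vector_derivative)
      from DERIV_chain2[OF DERIV_flat_exp this] show ?thesis
        by (simp add: has_real_derivative_iff_has_vector_derivative)
    qed
    moreover have "Ck n U (\<lambda>z. (flat_exp (p + 2) (g z) - real p * flat_exp (p + 1) (g z)) * pderiv_dir b g z)"
      using Suc.prems b C by (intro Ck_mult Ck_diff Suc.IH Ck_const) auto
    ultimately show "\<exists>h. (\<forall>z\<in>U. has_dir_deriv b (\<lambda>x. flat_exp p (g x)) z (h z)) \<and> Ck n U h"
      by (intro exI[of _ "\<lambda>z. (flat_exp (p + 2) (g z) - real p * flat_exp (p + 1) (g z)) * pderiv_dir b g z"] conjI ballI)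
  qed
qed

lemma Ck_inner_self: "Ck n UNIV (\<lambda>x::'a::euclidean_space. x \<bullet> x)"
proof -
  have "Ck n UNIV (\<lambda>x::'a. \<Sum>b\<in>Basis. (x \<bullet> b) * (x \<bullet> b))"
    by (intro Ck_sum Ck_mult Ck_inner) auto
  then show ?thesis by (simp add: euclidean_inner[symmetric])
qed

text \<open>3/4 is 1 - (1/2)^2, so the quotient is at least 1 on the ball of radius 1/2.\<close>

definition bump :: "'a::euclidean_space \<Rightarrow> real" where
  "bump x = flat_exp 0 (1 - x \<bullet> x) / flat_exp 0 (3 / 4)"

lemma bump_nonneg: "0 \<le> bump x"
  by (simp add: bump_def flat_exp_def)

lemma bump_eq_0: "1 \<le> norm x \<Longrightarrow> bump x = 0"
proof -
  assume "1 \<le> norm x"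
  then have "1 \<le> (norm x)\<^sup>2" by simp
  then show ?thesis by (simp add: bump_def flat_exp_def power2_norm_eq_inner)
qed

lemma bump_ge_1: "norm x \<le> 1 / 2 \<Longrightarrow> 1 \<le> bump x"
proof -
  assume "norm x \<le> 1 / 2"
  then have "(norm x)\<^sup>2 \<le> (1 / 2)\<^sup>2" by (intro power_mono) auto
  then have *: "3 / 4 \<le> 1 - x \<bullet> x" by (simp add: power2_norm_eq_inner) (simp add: power2_eq_square)
  then have "inverse (1 - x \<bullet> x) \<le> inverse (3 / 4)" by (intro le_imp_inverse_le) auto
  with * show ?thesis by (simp add: bump_def flat_exp_def)
qed

lemma Ck_bump: "Ck n UNIV bump"
  unfolding bump_def by (intro Ck_divide Ck_flat_exp Ck_diff Ck_const Ck_inner_self) (auto simp: flat_exp_def)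

lemma Ck_bd_bump: "\<exists>C\<ge>0. Ck_bd n 1 C UNIV (bump :: 'a::euclidean_space \<Rightarrow> real)"
  by (rule Ck_bd_compact_support[of _ _ "cball 0 1"]) (auto simp: Ck_bump bump_eq_0)

section \<open>Taylor polynomials\<close>

text \<open>Divided powers: differentiation lowers the index without a numerical factor.\<close>

definition tmono :: "'a mindex \<Rightarrow> 'a::euclidean_space \<Rightarrow> real" where
  "tmono s u = mpower u s / mfact s"

lemma tmono_prod: "tmono s u = (\<Prod>c\<in>Basis. (u \<bullet> c) ^ s c / fact (s c))"
  by (simp add: tmono_def mpower_def mfact_def prod_dividef)

abbreviation mindices_le :: "nat \<Rightarrow> 'a::euclidean_space mindex set" where
  "mindices_le m \<equiv> {s \<in> mindices. mlength s \<le> m}"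

definition mcount :: "'a list \<Rightarrow> 'a mindex" where
  "mcount bs = (\<lambda>c. count_list bs c)"

text \<open>If \<open>f\<close> is the jet of a function, \<open>mshift k f\<close> is the jet of
  its \<open>k\<close>-th derivative.\<close>

definition mshift :: "'a mindex \<Rightarrow> ('a mindex \<Rightarrow> 'b) \<Rightarrow> 'a mindex \<Rightarrow> 'b" where
  "mshift k f = (\<lambda>s. f (\<lambda>c. k c + s c))"

definition taylor :: "nat \<Rightarrow> ('a mindex \<Rightarrow> 'a \<Rightarrow> real) \<Rightarrow> 'a \<Rightarrow> 'a::euclidean_space \<Rightarrow> real" where
  "taylor m f a x = (\<Sum>s\<in>mindices_le m. f s a *\<^sub>R tmono s (x - a))"

lemma taylor_rem_taylor: "taylor_rem m f k y z = f k y - taylor (m - mlength k) (mshift k f) z y"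
  by (simp add: taylor_rem_def taylor_def tmono_def mshift_def mult.commute)

lemma tmono_abs_le: "norm u \<le> \<sigma> \<Longrightarrow> \<bar>tmono s u\<bar> \<le> \<sigma> ^ mlength s"
proof -
  assume u: "norm u \<le> \<sigma>"
  have "\<bar>tmono s u\<bar> = (\<Prod>c\<in>Basis. \<bar>u \<bullet> c\<bar> ^ s c / fact (s c))"
    by (simp add: tmono_prod abs_prod power_abs)
  also have "\<dots> \<le> (\<Prod>c\<in>Basis. \<sigma> ^ s c)"
  proof (intro prod_mono conjI)
    fix c :: 'a assume "c \<in> Basis"
    then have "\<bar>u \<bullet> c\<bar> \<le> \<sigma>" using u Basis_le_norm order_trans by blast
    then have "\<bar>u \<bullet> c\<bar> ^ s c / fact (s c) \<le> \<sigma> ^ s c / 1"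
      by (intro frac_le power_mono) auto
    then show "\<bar>u \<bullet> c\<bar> ^ s c / fact (s c) \<le> \<sigma> ^ s c" by simp
  qed simp
  finally show ?thesis by (simp add: mlength_def power_sum)
qed

lemma has_dir_deriv_tmono:
  assumes b: "b \<in> Basis"
  shows "has_dir_deriv b (\<lambda>x. tmono s (x - a)) z (if s b = 0 then 0 else tmono (s(b := s b - 1)) (z - a))"
proof -
  \<comment> \<open>The factors belonging to the other coordinates are constant along
    \<open>b\<close>.\<close>
  let ?R = "\<Prod>c\<in>Basis - {b}. ((z - a) \<bullet> c) ^ s c / fact (s c)"
  have *: "tmono s (z + t *\<^sub>R b - a) = ((z - a) \<bullet> b + t) ^ s b / fact (s b) * ?R" for t
  proof -
    have "tmono s (z + t *\<^sub>R b - a) = ((z + t *\<^sub>R b - a) \<bullet> b) ^ s b / fact (s b) * (\<Prod>c\<in>Basis - {b}. ((z + t *\<^sub>R b - a) \<bullet> c) ^ s c / fact (s c))"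
      unfolding tmono_prod using b by (intro prod.remove) auto
    also have "(\<Prod>c\<in>Basis - {b}. ((z + t *\<^sub>R b - a) \<bullet> c) ^ s c / fact (s c)) = ?R"
      using b by (intro prod.cong) (auto simp: inner_diff_left inner_add_left inner_Basis)
    finally show ?thesis using b by (simp add: inner_diff_left inner_add_left algebra_simps)
  qed
  have m: "tmono (s(b := s b - 1)) (z - a) = ((z - a) \<bullet> b) ^ (s b - 1) / fact (s b - 1) * ?R"
  proof -
    have "tmono (s(b := s b - 1)) (z - a) = ((z - a) \<bullet> b) ^ (s b - 1) / fact (s b - 1) *
        (\<Prod>c\<in>Basis - {b}. ((z - a) \<bullet> c) ^ (s(b := s b - 1)) c / fact ((s(b := s b - 1)) c))"
      unfolding tmono_prod using b by (subst prod.remove[of _ b]) auto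
    also have "(\<Prod>c\<in>Basis - {b}. ((z - a) \<bullet> c) ^ (s(b := s b - 1)) c / fact ((s(b := s b - 1)) c)) = ?R"
      by (intro prod.cong) auto
    finally show ?thesis .
  qed
  have "((\<lambda>t. ((z - a) \<bullet> b + t) ^ s b / fact (s b) * ?R) has_real_derivative
      (real (s b) * ((z - a) \<bullet> b) ^ (s b - 1)) / fact (s b) * ?R) (at 0)"
    by (auto intro!: derivative_eq_intros)
  also have "(real (s b) * ((z - a) \<bullet> b) ^ (s b - 1)) / fact (s b) = (if s b = 0 then 0 else ((z - a) \<bullet> b) ^ (s b - 1) / fact (s b - 1))"
    by (cases "s b") (simp_all del: of_nat_Suc)
  also have "\<dots> * ?R = (if s b = 0 then 0 else tmono (s(b := s b - 1)) (z - a))"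
    unfolding m by simp
  finally show ?thesis unfolding * by (simp add: has_real_derivative_iff_has_vector_derivative)
qed

lemma mlength_upd: "b \<in> Basis \<Longrightarrow> mlength (s(b := n)) + s b = mlength s + n"
  unfolding mlength_def by (simp add: sum.remove[of Basis b])

text \<open>Each derivative lowers the degree by one, which amounts to dividing the bound by
  \<open>\<sigma>\<close>.\<close>

lemma Ck_bd_tmono:
  assumes "open U" "0 < \<sigma>" "\<And>x. x \<in> U \<Longrightarrow> norm (x - a) \<le> \<sigma>"
  shows "Ck_bd n \<sigma> (\<sigma> ^ mlength s) U (\<lambda>x. tmono s (x - a))"
proof (induction n arbitrary: s)
  have c: "continuous_on U (\<lambda>x. tmono s (x - a))" for s
    unfolding tmono_prod by (intro continuous_intros) auto
  case 0
  then show ?case using c tmono_abs_le[OF assms(3)] by auto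
next
  have c: "continuous_on U (\<lambda>x. tmono s (x - a))" for s
    unfolding tmono_prod by (intro continuous_intros) auto
  case (Suc n)
  show ?case
  proof (rule Ck_bdI[OF assms(1) c])
    fix b :: 'a assume b: "b \<in> Basis"
    have "Ck_bd n \<sigma> (\<sigma> ^ mlength s / \<sigma>) U (\<lambda>z. if s b = 0 then 0 else tmono (s(b := s b - 1)) (z - a))"
    proof (cases "s b = 0")
      case False
      then have "mlength s = Suc (mlength (s(b := s b - 1)))" using mlength_upd[OF b, of s "s b - 1"] by simp
      then have "\<sigma> ^ mlength s / \<sigma> = \<sigma> ^ mlength (s(b := s b - 1))" using assms by simp
      moreover have "Ck_bd n \<sigma> (\<sigma> ^ mlength (s(b := s b - 1))) U (\<lambda>x. tmono (s(b := s b - 1)) (x - a))"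
        by (rule Suc)
      ultimately show ?thesis using False by (simp only: if_False)
    qed (use assms Ck_bd_zero[OF assms(1), of "\<sigma> ^ mlength s / \<sigma>" \<sigma> n] in simp)
    then show "\<exists>g. (\<forall>z\<in>U. has_dir_deriv b (\<lambda>x. tmono s (x - a)) z (g z)) \<and> Ck_bd n \<sigma> (\<sigma> ^ mlength s / \<sigma>) U g"
      using has_dir_deriv_tmono[OF b]
      by (intro exI[of _ "\<lambda>z. if s b = 0 then 0 else tmono (s(b := s b - 1)) (z - a)"] conjI ballI) simp_all
  next
    fix z assume "z \<in> U"
    then show "norm (tmono s (z - a)) \<le> \<sigma> ^ mlength s" using tmono_abs_le[OF assms(3)] by simp
  qed
qed

lemma Ck_tmono: "Ck n UNIV (\<lambda>x. tmono s (x - a))"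
proof (rule Ck_local)
  fix z :: 'a
  have "Ck_bd n (norm (z - a) + 1) ((norm (z - a) + 1) ^ mlength s) (ball z 1) (\<lambda>x. tmono s (x - a))"
  proof (rule Ck_bd_tmono)
    fix x assume "x \<in> ball z 1"
    then show "norm (x - a) \<le> norm (z - a) + 1"
      using norm_triangle_ineq[of "x - z" "z - a"] by (simp add: dist_norm norm_minus_commute)
  qed (auto simp: add_nonneg_pos)
  then show "\<exists>W. open W \<and> z \<in> W \<and> Ck n W (\<lambda>x. tmono s (x - a))"
    using Ck_bd_Ck by (intro exI[of _ "ball z 1"]) auto
qed

lemma Ck_taylor: "Ck n UNIV (taylor m f a)"
  unfolding taylor_def by (intro Ck_sum Ck_linear[OF bounded_linear_scaleR_right] Ck_tmono) auto

lemma Ck_bd_taylor: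
  assumes "open U" "0 < \<sigma>" "\<And>x. x \<in> U \<Longrightarrow> norm (x - a) \<le> \<sigma>"
  shows "Ck_bd n \<sigma> (\<Sum>s\<in>mindices_le m. \<bar>f s a\<bar> * \<sigma> ^ mlength s) U (taylor m f a)"
  unfolding taylor_def by (intro Ck_bd_sum Ck_bd_scaleR Ck_bd_tmono assms)

lemma has_dir_deriv_sum:
  "(\<And>i. i \<in> A \<Longrightarrow> has_dir_deriv b (f i) z (d i)) \<Longrightarrow> has_dir_deriv b (\<lambda>x. \<Sum>i\<in>A. f i x) z (\<Sum>i\<in>A. d i)"
  by (rule has_vector_derivative_sum)

text \<open>Terms with \<open>s b = 0\<close> die, the others lose one from \<open>s b\<close>;
  reindexing by \<open>?inc\<close> turns what remains into the Taylor polynomial of the shifted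
  jet, one degree lower.\<close>

lemma has_dir_deriv_taylor:
  assumes b: "b \<in> Basis"
  shows "has_dir_deriv b (taylor (Suc m) f a) z (taylor m (mshift (mcount [b]) f) a z)"
proof -
  let ?h = "\<lambda>s. f s a *\<^sub>R (if s b = 0 then 0 else tmono (s(b := s b - 1)) (z - a))"
  let ?inc = "\<lambda>s. s(b := Suc (s b)) :: 'a mindex"
  have "has_dir_deriv b (taylor (Suc m) f a) z (\<Sum>s\<in>mindices_le (Suc m). ?h s)"
    unfolding taylor_def
    by (intro has_dir_deriv_sum bounded_linear.has_vector_derivative[OF bounded_linear_scaleR_right] has_dir_deriv_tmono b)
  also have "(\<Sum>s\<in>mindices_le (Suc m). ?h s) = (\<Sum>s\<in>?inc ` mindices_le m. ?h s)"
  proof (rule sum.mono_neutral_right)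
    show "?inc ` mindices_le m \<subseteq> mindices_le (Suc m)"
    proof
      fix t assume "t \<in> ?inc ` mindices_le m"
      then obtain s where s: "s \<in> mindices" "mlength s \<le> m" "t = ?inc s" by auto
      then show "t \<in> mindices_le (Suc m)" using mlength_upd[OF b, of s "Suc (s b)"] b by (auto simp: mindices_def)
    qed
    show "\<forall>s\<in>mindices_le (Suc m) - ?inc ` mindices_le m. ?h s = 0"
    proof (intro ballI)
      fix s assume s: "s \<in> mindices_le (Suc m) - ?inc ` mindices_le m"
      have "s b = 0"
      proof (rule ccontr)
        assume "s b \<noteq> 0"
        then have "s = ?inc (s(b := s b - 1))" "s(b := s b - 1) \<in> mindices_le m"
          using mlength_upd[OF b, of s "s b - 1"] s by (auto simp: mindices_def)
        then show False using s by blast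
      qed
      then show "?h s = 0" by simp
    qed
  qed (rule finite_mindices)
  also have "\<dots> = (\<Sum>s\<in>mindices_le m. ?h (?inc s))"
  proof (rule sum.reindex_cong[of ?inc])
    show "inj_on ?inc (mindices_le m)"
      by (rule inj_on_inverseI[of _ "\<lambda>s. s(b := s b - 1)"]) simp
  qed auto
  also have "\<dots> = taylor m (mshift (mcount [b]) f) a z"
    unfolding taylor_def mshift_def mcount_def
  proof (intro sum.cong refl)
    fix s :: "'a mindex"
    have "(\<lambda>c. count_list [b] c + s c) = ?inc s" by (auto simp: fun_eq_iff)
    then show "?h (?inc s) = f (\<lambda>c. count_list [b] c + s c) a *\<^sub>R tmono s (z - a)" by simp
  qed
  finally show ?thesis .
qed

lemma mshift_Cons: "mshift (mcount [b]) (mshift (mcount bs) f) = mshift (mcount (b # bs)) f"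
  by (auto simp: mshift_def mcount_def fun_eq_iff add_ac intro!: arg_cong[where f=f])

lemma pderivs_taylor:
  "set bs \<subseteq> Basis \<Longrightarrow> length bs \<le> m \<Longrightarrow> pderivs bs (taylor m f a) = taylor (m - length bs) (mshift (mcount bs) f) a"
proof (induction bs)
  case Nil
  then show ?case by (simp add: mshift_def mcount_def)
next
  case (Cons b bs)
  have "pderiv_dir b (taylor (Suc (m - Suc (length bs))) (mshift (mcount bs) f) a) z =
      taylor (m - Suc (length bs)) (mshift (mcount (b # bs)) f) a z" for z
    using Cons.prems pderiv_dir_eqI[OF has_dir_deriv_taylor[of b "m - Suc (length bs)" "mshift (mcount bs) f" a z]]
    by (simp add: mshift_Cons)
  then have "pderiv_dir b (taylor (m - length bs) (mshift (mcount bs) f) a) = taylor (m - length (b # bs)) (mshift (mcount (b # bs)) f) a"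
    using Cons.prems by (intro ext) (simp add: Suc_diff_Suc)
  then show ?case using Cons by simp
qed

text \<open>Moves from \<open>y\<close> to \<open>x\<close> one coordinate at a time.\<close>

lemma dir_derivs_zero_imp_const:
  fixes h :: "'a::euclidean_space \<Rightarrow> real"
  assumes "\<And>b z. b \<in> Basis \<Longrightarrow> has_dir_deriv b h z 0"
  shows "h x = h y"
proof -
  have line: "h (z + t *\<^sub>R b) = h z" if "b \<in> Basis" for z t b
  proof -
    have "\<forall>s. ((\<lambda>t. h (z + t *\<^sub>R b)) has_real_derivative 0) (at s)"
      unfolding has_real_derivative_iff_has_vector_derivative
      using has_dir_deriv_along[of h z _ b 0] assms[OF that] by simp
    from DERIV_isconst_all[OF this, of t 0] show ?thesis by simp
  qed
  have "h (y + (\<Sum>b\<in>A. ((x - y) \<bullet> b) *\<^sub>R b)) = h y" if "A \<subseteq> Basis" for A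
    using finite_subset[OF that finite_Basis] that
  proof (induction A rule: finite_induct)
    case (insert b A)
    then show ?case using line[of b "y + (\<Sum>b\<in>A. ((x - y) \<bullet> b) *\<^sub>R b)" "(x - y) \<bullet> b"]
      by (simp add: add_ac)
  qed simp
  from this[of Basis] show ?thesis by (simp add: euclidean_representation)
qed

lemma taylor_self:
  fixes a :: "'a::euclidean_space"
  shows "taylor m f a a = f (\<lambda>_. 0) a"
proof -
  have z: "tmono s (0::'a) = (if s = (\<lambda>_. 0) then 1 else 0)" if "s \<in> mindices" for s
  proof (cases "s = (\<lambda>_. 0)")
    case False
    then obtain c where "c \<in> Basis" "s c \<noteq> 0" using \<open>s \<in> mindices\<close> by (auto simp: mindices_def)
    then show ?thesis unfolding tmono_prod using False by (auto intro!: prod_zero bexI[of _ c])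
  qed (simp add: tmono_prod)
  have "taylor m f a a = (\<Sum>s\<in>(mindices_le m :: 'a mindex set). if s = (\<lambda>_. 0) then f (\<lambda>_. 0) a else 0)"
    unfolding taylor_def by (rule sum.cong) (auto simp: z)
  also have "\<dots> = f (\<lambda>_. 0) a"
    using finite_mindices by (subst sum.delta) (auto simp: mindices_def mlength_def)
  finally show ?thesis .
qed

lemma taylor_0:
  fixes a :: "'a::euclidean_space"
  shows "taylor 0 f a x = f (\<lambda>_. 0) a"
proof -
  have "(mindices_le 0 :: 'a mindex set) = {\<lambda>_. 0}"
    by (auto simp: mindices_def mlength_def)
  then show ?thesis by (simp only: taylor_def) (simp add: tmono_prod)
qed

lemma mlength_add: "mlength (\<lambda>c. k c + s c) = mlength k + mlength s"
  by (simp add: mlength_def sum.distrib)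

lemma mlength_mi: "set bs \<subseteq> Basis \<Longrightarrow> mlength (mcount bs) = length bs"
  unfolding mlength_def mcount_def using sum_count_set[of bs Basis] by simp

text \<open>By induction on \<open>m\<close>, both sides have the same derivatives; and they agree at \<open>p\<close>.\<close>

lemma taylor_recenter:
  fixes p :: "'a::euclidean_space"
  shows "taylor m f q x = taylor m (\<lambda>s _. taylor (m - mlength s) (mshift s f) q p) p x"
proof (induction m arbitrary: f x)
  case 0
  then show ?case by (simp add: taylor_0 mshift_def)
next
  case (Suc m)
  let ?g = "\<lambda>s (_::'a). taylor (Suc m - mlength s) (mshift s f) q p"
  let ?h = "\<lambda>x. taylor (Suc m) f q x - taylor (Suc m) ?g p x"
  have "has_dir_deriv b ?h z 0" if b: "b \<in> Basis" for b z
  proof -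
    have "has_dir_deriv b ?h z (taylor m (mshift (mcount [b]) f) q z - taylor m (mshift (mcount [b]) ?g) p z)"
      by (intro has_vector_derivative_diff has_dir_deriv_taylor b)
    moreover have "mshift (mcount [b]) ?g = (\<lambda>s (_::'a). taylor (m - mlength s) (mshift s (mshift (mcount [b]) f)) q p)"
      using mlength_mi[of "[b]"] b by (simp add: mshift_def mlength_add fun_eq_iff add_ac)
    moreover have "taylor m (mshift (mcount [b]) f) q z = taylor m (\<lambda>s _. taylor (m - mlength s) (mshift s (mshift (mcount [b]) f)) q p) p z"
      by (rule Suc)
    ultimately show ?thesis by (simp only: diff_self)
  qed
  then have "?h x = ?h p" by (rule dir_derivs_zero_imp_const)
  also have "\<dots> = 0" by (simp add: taylor_self) (simp add: mshift_def mlength_def)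
  finally show ?case by simp
qed

text \<open>The point where the hypothesis enters: recentred at \<open>p\<close>, the difference of
  the two Taylor polynomials has exactly Whitney's remainders as coefficients.\<close>

lemma taylor_diff:
  "taylor m f p x - taylor m f q x = taylor m (\<lambda>s _. taylor_rem m f s p q) p x"
  by (subst taylor_recenter[of m f q x p]) (simp add: taylor_def taylor_rem_taylor sum_subtractf[symmetric] algebra_simps)

text \<open>A remainder of size \<open>\<epsilon> * \<sigma> ^ (m - mlength s)\<close> meets a
  monomial of size \<open>\<sigma> ^ mlength s\<close>, so all terms have the same weight
  \<open>\<epsilon> * \<sigma> ^ m\<close>. A derivative of order i is then bounded by a multiple of
  \<open>\<epsilon> * \<sigma> ^ (m - i)\<close>.\<close>

lemma Ck_bd_taylor_diff:
  fixes p :: "'a::euclidean_space" and \<sigma> :: real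
  assumes "open U" "0 < \<sigma>" "\<And>x. x \<in> U \<Longrightarrow> norm (x - p) \<le> \<sigma>"
    and "\<And>s. s \<in> mindices_le m \<Longrightarrow> \<bar>taylor_rem m f s p q\<bar> \<le> \<epsilon> * \<sigma> ^ (m - mlength s)"
  shows "Ck_bd n \<sigma> (card (mindices_le m :: 'a mindex set) * (\<epsilon> * \<sigma> ^ m)) U (\<lambda>x. taylor m f p x - taylor m f q x)"
proof -
  have "Ck_bd n \<sigma> (\<Sum>s\<in>mindices_le m. \<bar>taylor_rem m f s p q\<bar> * \<sigma> ^ mlength s) U (taylor m (\<lambda>s _. taylor_rem m f s p q) p)"
    by (rule Ck_bd_taylor) (use assms in auto)
  moreover have "(\<Sum>s\<in>mindices_le m. \<bar>taylor_rem m f s p q\<bar> * \<sigma> ^ mlength s) \<le> (\<Sum>s\<in>(mindices_le m :: 'a mindex set). \<epsilon> * \<sigma> ^ m)"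
  proof (rule sum_mono)
    fix s :: "'a mindex" assume s: "s \<in> mindices_le m"
    have "\<bar>taylor_rem m f s p q\<bar> * \<sigma> ^ mlength s \<le> \<epsilon> * \<sigma> ^ (m - mlength s) * \<sigma> ^ mlength s"
      using assms(4)[OF s] assms(2) by (intro mult_right_mono) auto
    then show "\<bar>taylor_rem m f s p q\<bar> * \<sigma> ^ mlength s \<le> \<epsilon> * \<sigma> ^ m"
      using s by (simp add: power_add[symmetric] mult.assoc)
  qed
  ultimately show ?thesis unfolding taylor_diff using Ck_bd_mono assms(2) by fastforce
qed

section \<open>A Whitney family of bump functions\<close>

locale whitney =
  fixes V :: "'a::euclidean_space set"
  assumes closed_V: "closed V" and V_nonempty: "V \<noteq> {}"
begin

abbreviation d :: "'a \<Rightarrow> real" where "d x \<equiv> infdist x V"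

lemma d_pos: "x \<notin> V \<Longrightarrow> 0 < d x"
  using closed_V V_nonempty by (meson infdist_pos_not_in_closed)

lemma d_le: "z \<in> V \<Longrightarrow> d x \<le> norm (x - z)"
  using infdist_le[of z V x] by (simp add: dist_norm)

lemma d_lip: "\<bar>d x - d y\<bar> \<le> norm (x - y)"
  using infdist_triangle_abs[of x V y] by (simp add: dist_norm)

text \<open>An index \<open>(j, q)\<close> encodes a ball of dyadic radius 2^j centred at the point
  with integer coordinates \<open>q\<close> of a lattice whose spacing is proportional to that
  radius.\<close>

definition rad :: "int \<times> ('a \<Rightarrow> int) \<Rightarrow> real" where
  "rad i = 2 powr of_int (fst i)"

definition ctr :: "int \<times> ('a \<Rightarrow> int) \<Rightarrow> 'a" where
  "ctr i = (\<Sum>b\<in>Basis. (rad i * of_int (snd i b) / DIM('a)) *\<^sub>R b)"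

text \<open>Radii are dyadic. The lattice spacing \<open>rad i / DIM('a)\<close> puts a centre within \<open>rad i / 2\<close> of every
  point; 5 and 13 leave room for that when the radius is chosen with \<open>6 * rad i \<le> d x < 12 * rad i\<close>.\<close>

definition Idx :: "(int \<times> ('a \<Rightarrow> int)) set" where
  "Idx = {i. snd i \<in> Basis \<rightarrow>\<^sub>E UNIV \<and> 5 * rad i \<le> d (ctr i) \<and> d (ctr i) \<le> 13 * rad i}"

definition bump_at :: "int \<times> ('a \<Rightarrow> int) \<Rightarrow> 'a \<Rightarrow> real" where
  "bump_at i x = bump ((x - ctr i) /\<^sub>R rad i)"

lemma rad_pos: "0 < rad i"
  by (simp add: rad_def)

lemma inner_ctr: "b \<in> Basis \<Longrightarrow> ctr i \<bullet> b = rad i * of_int (snd i b) / DIM('a)"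
  by (simp add: ctr_def inner_sum_left inner_Basis if_distrib cong: if_cong)

lemma bump_at_nonneg: "0 \<le> bump_at i x"
  by (simp add: bump_at_def bump_nonneg)

lemma bump_at_support: "bump_at i x \<noteq> 0 \<Longrightarrow> norm (x - ctr i) < rad i"
proof (rule ccontr)
  assume *: "bump_at i x \<noteq> 0" "\<not> norm (x - ctr i) < rad i"
  then have "1 \<le> norm ((x - ctr i) /\<^sub>R rad i)"
    using rad_pos[of i] by (simp only: norm_scaleR) (simp add: field_simps)
  from bump_eq_0[OF this] show False using * by (simp add: bump_at_def)
qed

lemma bump_at_support_d:
  assumes "bump_at i x \<noteq> 0" "i \<in> Idx"
  shows "4 * rad i < d x" "d x < 14 * rad i"
  using bump_at_support[OF assms(1)] assms(2) d_lip[of x "ctr i"] by (auto simp: Idx_def)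

lemma bump_at_ge_1:
  assumes "x \<notin> V" shows "\<exists>i\<in>Idx. 1 \<le> bump_at i x"
proof -
  define n where "n = real DIM('a)"
  define j where "j = \<lfloor>log 2 (d x / 6)\<rfloor>"
  define r where "r = (2::real) powr of_int j"
  \<comment> \<open>Rounding errs by at most \<open>r / (2 * n)\<close> in each of the n
    coordinates, hence by \<open>r / 2\<close> in the l1 norm, which dominates the Euclidean
    one.\<close>
  define q where "q = (\<lambda>b\<in>Basis. round (n * (x \<bullet> b) / r))"
  define i where "i = (j, q)"
  have n: "0 < n" by (simp add: n_def)
  have r: "rad i = r" "0 < r" by (simp_all add: i_def r_def rad_def)
  have "r \<le> 2 powr log 2 (d x / 6)" unfolding r_def j_def by (intro powr_mono) auto
  then have r1: "6 * r \<le> d x" using d_pos[OF assms] by simp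
  have "2 powr log 2 (d x / 6) < 2 powr (of_int j + 1)" unfolding j_def by (intro powr_less_mono) auto
  then have r2: "d x < 12 * r" using d_pos[OF assms] by (simp add: r_def powr_add)
  have "norm (x - ctr i) \<le> (\<Sum>b\<in>Basis. \<bar>(x - ctr i) \<bullet> b\<bar>)" by (rule norm_le_l1)
  also have "\<dots> \<le> (\<Sum>b\<in>(Basis::'a set). r / (2 * n))"
  proof (rule sum_mono)
    fix b :: 'a assume b: "b \<in> Basis"
    have "(x - ctr i) \<bullet> b = x \<bullet> b - r * of_int (round (n * (x \<bullet> b) / r)) / n"
      using b r by (simp add: inner_diff_left inner_ctr q_def i_def n_def)
    also have "\<dots> = (r / n) * (n * (x \<bullet> b) / r - of_int (round (n * (x \<bullet> b) / r)))"
      using r n by (simp add: field_simps)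
    finally have "\<bar>(x - ctr i) \<bullet> b\<bar> = (r / n) * \<bar>of_int (round (n * (x \<bullet> b) / r)) - n * (x \<bullet> b) / r\<bar>"
      using r n by (simp add: abs_mult abs_minus_commute)
    also have "\<dots> \<le> (r / n) * (1 / 2)"
      using r n by (intro mult_left_mono of_int_round_abs_le) auto
    finally show "\<bar>(x - ctr i) \<bullet> b\<bar> \<le> r / (2 * n)" by simp
  qed
  also have "\<dots> = r / 2" using n by (simp add: n_def)
  finally have c: "norm (x - ctr i) \<le> r / 2" .
  have "i \<in> Idx"
    using d_lip[of x "ctr i"] c r r1 r2 by (auto simp: Idx_def i_def q_def)
  moreover have "1 \<le> bump_at i x"
    unfolding bump_at_def using c r by (intro bump_ge_1) (simp only: norm_scaleR, simp add: field_simps)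
  ultimately show ?thesis by blast
qed

section \<open>Local finiteness and weighted averages\<close>

abbreviation nb :: "'a \<Rightarrow> 'a set" where "nb x \<equiv> ball x (d x / 8)"

text \<open>Bumps meeting the ball \<open>nb x\<close>, not merely those nonzero at
  \<open>x\<close>: one finite sum then represents \<open>wsum\<close> on a whole neighbourhood and
  can be differentiated term by term.\<close>

definition active :: "'a \<Rightarrow> (int \<times> ('a \<Rightarrow> int)) set" where
  "active x = {i \<in> Idx. \<exists>y\<in>nb x. bump_at i y \<noteq> 0}"

lemma nb_subset: "x \<notin> V \<Longrightarrow> nb x \<subseteq> - V"
  using d_le[of _ x] d_pos[of x] by (force simp: dist_norm)

text \<open>A point \<open>y\<close> of \<open>nb x\<close> in the support satisfies
  \<open>7/8 * d x < d y < 14 * rad i\<close> and \<open>4 * rad i < d y < 9/8 * d x\<close>, which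
  gives the first two bounds. The third adds \<open>d x / 8 < 2 * rad i\<close> to the
  radius.\<close>

lemma active_bounds:
  assumes "i \<in> active x" "x \<notin> V"
  shows "d x < 16 * rad i" "rad i < 9 / 32 * d x" "norm (x - ctr i) \<le> 3 * rad i"
proof -
  obtain y where y: "i \<in> Idx" "norm (x - y) < d x / 8" "bump_at i y \<noteq> 0"
    using assms by (auto simp: active_def dist_norm)
  note * = bump_at_support[OF y(3)] bump_at_support_d[OF y(3,1)] d_lip[of x y]
  show 1: "d x < 16 * rad i" using * y by linarith
  show "rad i < 9 / 32 * d x" using * y by linarith
  have "norm (x - ctr i) \<le> norm (x - y) + norm (y - ctr i)"
    using norm_triangle_ineq[of "x - y" "y - ctr i"] by simp
  then show "norm (x - ctr i) \<le> 3 * rad i" using * y 1 by linarith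
qed

text \<open>The point is a bound independent of \<open>x\<close>. The radius lies between
  \<open>d x / 16\<close> and \<open>d x\<close>, which leaves five dyadic levels, and at each level
  a coordinate of the lattice point is confined to an interval with \<open>6 * DIM('a) + 2\<close>
  integers.\<close>

lemma active_finite_card:
  assumes x: "x \<notin> V"
  shows "finite (active x) \<and> card (active x) \<le> 5 * (6 * DIM('a) + 2) ^ DIM('a)"
proof -
  define n where "n = int DIM('a)"
  define j0 where "j0 = \<lfloor>log 2 (d x)\<rfloor>"
  define k where "k = (\<lambda>(j::int) b. \<lfloor>n * (x \<bullet> b) / 2 powr of_int j\<rfloor>)"
  define B where "B = Sigma {j0 - 4..j0} (\<lambda>j. PiE Basis (\<lambda>b. {k j b - 3 * n..k j b + 3 * n + 1}))"
  have n: "1 \<le> n" using DIM_positive[where 'a='a] unfolding n_def by linarith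
  have "active x \<subseteq> B"
  proof
    fix i assume i: "i \<in> active x"
    note b = active_bounds[OF i x]
    have d: "0 < d x" using d_pos x by auto
    have "2 powr of_int (fst i) < d x" using b d by (simp add: rad_def)
    then have "of_int (fst i) < log 2 (d x)" using d by (simp add: less_log_iff)
    then have 1: "fst i \<le> j0" unfolding j0_def by linarith
    have "d x < 2 powr (of_int (fst i) + 4)" using b by (simp add: rad_def powr_add)
    then have "log 2 (d x) < of_int (fst i) + 4" using d by (simp add: log_less_iff)
    then have 2: "j0 - 4 \<le> fst i" unfolding j0_def by linarith
    have "snd i c \<in> {k (fst i) c - 3 * n..k (fst i) c + 3 * n + 1}" if c: "c \<in> Basis" for c
    proof -
      have "\<bar>(x - ctr i) \<bullet> c\<bar> \<le> 3 * rad i" using b(3) Basis_le_norm[OF c, of "x - ctr i"] by linarith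
      then have "\<bar>x \<bullet> c - rad i * of_int (snd i c) / n\<bar> \<le> 3 * rad i"
        using c by (simp add: inner_diff_left inner_ctr n_def)
      then have "(n / rad i) * \<bar>x \<bullet> c - rad i * of_int (snd i c) / n\<bar> \<le> (n / rad i) * (3 * rad i)"
        using n rad_pos[of i] by (intro mult_left_mono) auto
      then have "\<bar>(n / rad i) * (x \<bullet> c - rad i * of_int (snd i c) / n)\<bar> \<le> 3 * n"
        using n rad_pos[of i] by (simp add: abs_mult)
      moreover have "(n / rad i) * (x \<bullet> c - rad i * of_int (snd i c) / n) = n * (x \<bullet> c) / rad i - of_int (snd i c)"
        using n rad_pos[of i] by (simp add: field_simps)
      ultimately have "\<bar>n * (x \<bullet> c) / rad i - of_int (snd i c)\<bar> \<le> 3 * n" by (simp only:)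
      then have "n * (x \<bullet> c) / rad i - 3 * n \<le> of_int (snd i c)" "of_int (snd i c) \<le> n * (x \<bullet> c) / rad i + 3 * n"
        by (simp_all add: abs_le_iff)
      moreover have "n * (x \<bullet> c) / rad i < of_int (k (fst i) c) + 1" "of_int (k (fst i) c) \<le> n * (x \<bullet> c) / rad i"
        unfolding k_def rad_def[symmetric] by linarith+
      ultimately have "k (fst i) c - 3 * n \<le> snd i c" "snd i c \<le> k (fst i) c + 3 * n + 1"
        by linarith+
      then show ?thesis by simp
    qed
    moreover have "snd i \<in> Basis \<rightarrow>\<^sub>E UNIV" using i by (simp add: active_def Idx_def)
    ultimately have "snd i \<in> PiE Basis (\<lambda>b. {k (fst i) b - 3 * n..k (fst i) b + 3 * n + 1})"
      by (auto simp: PiE_iff)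
    then show "i \<in> B" using 1 2 unfolding B_def by (cases i) auto
  qed
  moreover have "finite B" unfolding B_def by (intro finite_SigmaI finite_PiE) auto
  moreover have "card B = 5 * (6 * DIM('a) + 2) ^ DIM('a)"
  proof -
    have "card (PiE Basis (\<lambda>b. {k j b - 3 * n..k j b + 3 * n + 1})) = (6 * DIM('a) + 2) ^ DIM('a)" for j
      by (subst card_PiE) (auto simp: n_def nat_add_distrib nat_mult_distrib)
    then show ?thesis unfolding B_def by (subst card_SigmaI) (auto intro!: finite_PiE)
  qed
  ultimately show ?thesis using finite_subset card_mono by metis
qed

lemma countable_Idx: "countable Idx"
proof -
  have "countable (UNIV \<times> (Basis \<rightarrow>\<^sub>E UNIV) :: (int \<times> ('a \<Rightarrow> int)) set)"
    by (intro countable_SIGMA countable_PiE) auto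
  then show ?thesis by (rule countable_subset[rotated]) (auto simp: Idx_def)
qed

text \<open>Restricting to bumps nonzero at \<open>y\<close> makes the index set finite; over an
  infinite set \<open>sum\<close> would return 0.\<close>

definition wsum :: "(int \<times> ('a \<Rightarrow> int) \<Rightarrow> 'a \<Rightarrow> real) \<Rightarrow> 'a \<Rightarrow> real" where
  "wsum g y = (\<Sum>i\<in>{i \<in> Idx. bump_at i y \<noteq> 0}. bump_at i y * g i y)"

lemma wsum_nb:
  assumes "x \<notin> V" "y \<in> nb x" shows "wsum g y = (\<Sum>i\<in>active x. bump_at i y * g i y)"
  unfolding wsum_def using assms active_finite_card[OF assms(1)]
  by (intro sum.mono_neutral_left) (auto simp: active_def)

lemma wsum_1_ge:
  assumes "x \<notin> V" shows "1 \<le> wsum (\<lambda>_ _. 1) x"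
proof -
  obtain i where i: "i \<in> Idx" "1 \<le> bump_at i x" using bump_at_ge_1 assms by blast
  have x: "x \<in> nb x" using d_pos assms by auto
  then have "i \<in> active x" using i by (auto simp: active_def intro!: bexI[of _ x])
  then have "bump_at i x * 1 \<le> wsum (\<lambda>_ _. 1) x"
    unfolding wsum_nb[OF assms x] using active_finite_card[OF assms] bump_at_nonneg
    by (intro member_le_sum) auto
  then show ?thesis using i by simp
qed

lemma Ck_bump_at: "Ck n UNIV (bump_at i)"
proof -
  obtain C where "Ck_bd n 1 C UNIV (bump :: 'a \<Rightarrow> real)" using Ck_bd_bump by blast
  then have "Ck_bd n (rad i * 1) C UNIV (bump_at i)"
    unfolding bump_at_def[abs_def] using rad_pos by (intro Ck_bd_affine) auto
  then show ?thesis by (rule Ck_bd_Ck)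
qed

lemma Ck_wsum:
  assumes "\<And>i. Ck n (- V) (g i)"
  shows "Ck n (- V) (wsum g)"
proof (rule Ck_local)
  fix x assume x: "x \<in> - V"
  have "Ck n (nb x) (\<lambda>y. \<Sum>i\<in>active x. bump_at i y * g i y)"
    using nb_subset[of x] x by (intro Ck_sum Ck_mult Ck_subset[OF Ck_bump_at] Ck_subset[OF assms]) auto
  then have "Ck n (nb x) (wsum g)"
    using Ck_cong[of "nb x" "wsum g"] wsum_nb[of x] x by force
  then show "\<exists>W. open W \<and> x \<in> W \<and> Ck n W (wsum g)"
    using d_pos x by (intro exI[of _ "nb x"]) auto
qed

definition wavg :: "(int \<times> ('a \<Rightarrow> int) \<Rightarrow> 'a \<Rightarrow> real) \<Rightarrow> 'a \<Rightarrow> real" where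
  "wavg g y = wsum g y / wsum (\<lambda>_ _. 1) y"

lemma Ck_wavg: "(\<And>i. Ck n (- V) (g i)) \<Longrightarrow> Ck n (- V) (wavg g)"
proof -
  assume g: "\<And>i. Ck n (- V) (g i)"
  have "wsum (\<lambda>_ _. 1) x \<noteq> 0" if "x \<in> - V" for x using wsum_1_ge that by force
  then show ?thesis
    unfolding wavg_def[abs_def] using closed_V by (intro Ck_divide Ck_wsum g Ck_const) auto
qed

text \<open>Subtracting \<open>T\<close> from every summand is free because the weights are
  normalised. Hence derivatives of the weights, of size \<open>1 / d x\<close>, only ever multiply
  differences \<open>g i - T\<close>. The constant is the same for all \<open>x\<close> by the
  uniform count of active indices and by scaling.\<close>

lemma Ck_bd_wavg:
  "\<exists>C\<ge>0. \<forall>x g T w. x \<notin> V \<longrightarrow> 0 \<le> w \<longrightarrow>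
     (\<forall>i\<in>active x. Ck_bd N (10 * d x) w (nb x) (\<lambda>y. g i y - T y)) \<longrightarrow>
     Ck_bd N (10 * d x) (C * w) (nb x) (\<lambda>y. wavg g y - T y)"
proof -
  define K where "K = 5 * (6 * real DIM('a) + 2) ^ DIM('a)"
  have K: "0 \<le> K" by (simp add: K_def)
  obtain C0 where C0: "0 \<le> C0" "Ck_bd N 1 C0 UNIV (bump :: 'a \<Rightarrow> real)" using Ck_bd_bump by blast
  \<comment> \<open>Active radii satisfy \<open>10 * d x < 160 * rad i\<close>.\<close>
  define C1 where "C1 = 160 ^ N * C0"
  have C1: "0 \<le> C1" using C0 by (simp add: C1_def)
  from Ck_bd_inverse[of "K * C1" N] K C1 obtain C2 where C2: "0 \<le> C2" and
    "\<forall>U \<rho> (f :: 'a \<Rightarrow> real). open U \<longrightarrow> 0 < \<rho> \<longrightarrow> (\<forall>x\<in>U. 1 \<le> f x) \<longrightarrow>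
           Ck_bd N \<rho> (K * C1) U f \<longrightarrow> Ck_bd N \<rho> C2 U (\<lambda>x. inverse (f x))" by auto
  note inv = this(2)[rule_format]
  define C where "C = 2 ^ N * (K * (2 ^ N * C1) * C2)"
  have "Ck_bd N (10 * d x) (C * w) (nb x) (\<lambda>y. wavg g y - T y)"
    if x: "x \<notin> V" and w: "0 \<le> w" and g: "\<And>i. i \<in> active x \<Longrightarrow> Ck_bd N (10 * d x) w (nb x) (\<lambda>y. g i y - T y)" for x g T w
  proof -
    let ?\<sigma> = "10 * d x" and ?S = "\<lambda>y. \<Sum>i\<in>active x. bump_at i y" and ?G = "\<lambda>y. \<Sum>i\<in>active x. bump_at i y * (g i y - T y)"
    have \<sigma>: "0 < ?\<sigma>" using d_pos x by simp
    have card: "real (card (active x)) \<le> K"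
    proof -
      have "real (card (active x)) \<le> real (5 * (6 * DIM('a) + 2) ^ DIM('a))"
        using active_finite_card[OF x] by (intro of_nat_mono) auto
      then show ?thesis by (simp add: K_def add.commute)
    qed
    have bump_at: "Ck_bd N ?\<sigma> C1 (nb x) (bump_at i)" if i: "i \<in> active x" for i
    proof -
      have "Ck_bd N (rad i * 1) C0 (nb x) (bump_at i)"
        unfolding bump_at_def[abs_def] using rad_pos C0 by (intro Ck_bd_affine) auto
      then show ?thesis unfolding C1_def
        using active_bounds[OF i x] rad_pos[of i] C0 \<sigma> by (intro Ck_bd_rescale) auto
    qed
    have "Ck_bd N ?\<sigma> (\<Sum>i\<in>active x. C1) (nb x) ?S"
      using \<sigma> by (intro Ck_bd_sum bump_at) auto
    then have "Ck_bd N ?\<sigma> (K * C1) (nb x) ?S"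
      by (rule Ck_bd_mono) (use card C1 \<sigma> in \<open>auto intro: mult_right_mono\<close>)
    moreover have S: "?S y = wsum (\<lambda>_ _. 1) y" if "y \<in> nb x" for y
      using wsum_nb[OF x that, of "\<lambda>_ _. 1"] by simp
    moreover have S1: "1 \<le> ?S y" if "y \<in> nb x" for y
      unfolding S[OF that] using wsum_1_ge nb_subset[OF x] that by auto
    ultimately have I: "Ck_bd N ?\<sigma> C2 (nb x) (\<lambda>y. inverse (?S y))"
      using \<sigma> by (intro inv) auto
    have "Ck_bd N ?\<sigma> (\<Sum>i\<in>active x. 2 ^ N * (C1 * w)) (nb x) ?G"
      using \<sigma> C1 w by (intro Ck_bd_sum Ck_bd_mult bump_at g) auto
    then have "Ck_bd N ?\<sigma> (K * (2 ^ N * (C1 * w))) (nb x) ?G"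
      by (rule Ck_bd_mono) (use card C1 w \<sigma> in \<open>auto intro: mult_right_mono\<close>)
    then have "Ck_bd N ?\<sigma> (2 ^ N * (K * (2 ^ N * (C1 * w)) * C2)) (nb x) (\<lambda>y. ?G y * inverse (?S y))"
      using I \<sigma> K C1 C2 w by (intro Ck_bd_mult) auto
    moreover have "?G y * inverse (?S y) = wavg g y - T y" if y: "y \<in> nb x" for y
    proof -
      have "?G y = wsum g y - T y * ?S y"
        unfolding wsum_nb[OF x y] by (simp add: algebra_simps sum_subtractf sum_distrib_left)
      then show ?thesis using S1[OF y] S[OF y] by (simp add: wavg_def field_simps)
    qed
    ultimately have "Ck_bd N ?\<sigma> (2 ^ N * (K * (2 ^ N * (C1 * w)) * C2)) (nb x) (\<lambda>y. wavg g y - T y)"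
      using Ck_bd_cong[of "nb x" "\<lambda>y. ?G y * inverse (?S y)" "\<lambda>y. wavg g y - T y"] by simp
    then show ?thesis by (simp add: C_def mult_ac)
  qed
  moreover have "0 \<le> C" using K C1 C2 by (simp add: C_def)
  ultimately show ?thesis by (intro exI[of _ C]) auto
qed

definition anchor :: "int \<times> ('a \<Rightarrow> int) \<Rightarrow> 'a" where
  "anchor i = (SOME a. a \<in> V \<and> norm (ctr i - a) = d (ctr i))"

lemma nearest: "\<exists>a. a \<in> V \<and> norm (x - a) = d x"
  using infdist_attains_inf[OF closed_V V_nonempty, of x] by (metis dist_norm)

lemma anchor: "anchor i \<in> V" "norm (ctr i - anchor i) = d (ctr i)"
  using someI_ex[OF nearest[of "ctr i"]] by (auto simp: anchor_def)

text \<open>Between \<open>y\<close> and the anchor lie two steps of at most \<open>d x / 8\<close>,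
  one radius, and at most 13 radii from centre to anchor; \<open>14 * rad i\<close> is below
  \<open>14 * 9 / 32 * d x\<close>, in total less than \<open>4.2 * d x\<close>.\<close>

lemma anchor_close:
  assumes "i \<in> active x" "x \<notin> V" "y \<in> nb x"
  shows "norm (y - anchor i) \<le> 5 * d x"
proof -
  obtain y' where y': "i \<in> Idx" "norm (x - y') < d x / 8" "bump_at i y' \<noteq> 0"
    using assms by (auto simp: active_def dist_norm)
  have "norm (y - anchor i) = norm ((y - x) + (x - y') + (y' - ctr i) + (ctr i - anchor i))" by simp
  also have "\<dots> \<le> norm (y - x) + norm (x - y') + norm (y' - ctr i) + norm (ctr i - anchor i)"
    by (meson norm_triangle_mono norm_triangle_ineq order_refl order_trans add_mono)
  also have "\<dots> \<le> d x / 8 + d x / 8 + rad i + 13 * rad i"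
    using assms(3) y' bump_at_support[OF y'(3)] anchor(2)[of i]
    by (intro add_mono) (auto simp: dist_norm norm_minus_commute Idx_def)
  also have "\<dots> \<le> 5 * d x" using active_bounds[OF assms(1,2)] d_pos[OF assms(2)] by linarith
  finally show ?thesis .
qed

end

lemma has_vector_derivative_zeroI:
  fixes E :: "real \<Rightarrow> real"
  assumes "E 0 = 0" "\<And>\<epsilon>. 0 < \<epsilon> \<Longrightarrow> \<exists>\<delta>>0. \<forall>t. \<bar>t\<bar> < \<delta> \<longrightarrow> \<bar>E t\<bar> \<le> \<epsilon> * \<bar>t\<bar>"
  shows "(E has_vector_derivative 0) (at 0)"
  unfolding has_vector_derivative_def has_derivative_at_alt using assms by (auto simp: bounded_linear_zero)

section \<open>Whitney's extension, smooth off the closed set\<close>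

text \<open>\<open>M i\<close> is the degree of the Taylor polynomial attached to the bump
  \<open>i\<close>; it may vary with \<open>i\<close> so that infinite m is covered.\<close>

locale whitney_jet = whitney V for V :: "'a::euclidean_space set" +
  fixes f :: "'a mindex \<Rightarrow> 'a \<Rightarrow> real" and M :: "int \<times> ('a \<Rightarrow> int) \<Rightarrow> nat"
begin

definition F0 :: "'a \<Rightarrow> real" where
  "F0 x = (if x \<in> V then f (\<lambda>_. 0) x else wavg (\<lambda>i. taylor (M i) f (anchor i)) x)"

lemma Ck_F0: "Ck n (- V) F0"
proof -
  have "Ck n (- V) (wavg (\<lambda>i. taylor (M i) f (anchor i)))"
    by (rule Ck_wavg) (rule Ck_subset[OF Ck_taylor], simp)
  then show ?thesis
    using Ck_cong[of "- V" F0 "wavg (\<lambda>i. taylor (M i) f (anchor i))" n] open_Compl[OF closed_V]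
    by (simp add: F0_def)
qed

text \<open>Near \<open>V\<close> the degrees must reach \<open>N\<close>, and the terms of degree
  above \<open>N\<close> must be harmless. Such terms carry one more power of the radius than the
  estimate of order \<open>N\<close> demands, and that spare \<open>rad i\<close> has to beat their
  coefficients. A constant degree \<open>N\<close> qualifies trivially.\<close>

definition admissible :: "nat \<Rightarrow> bool" where
  "admissible N \<longleftrightarrow> (\<forall>z\<in>V. \<forall>\<epsilon>>0. \<exists>\<delta>>0. \<forall>i\<in>Idx. norm (anchor i - z) < \<delta> \<and> rad i < \<delta> \<longrightarrow>
     N \<le> M i \<and> rad i * (\<Sum>s\<in>mindices_le (M i) - mindices_le N. \<bar>f s (anchor i)\<bar>) \<le> \<epsilon>)"

lemma taylor_split: "N \<le> m \<Longrightarrow> taylor m f a x = taylor N f a x + (\<Sum>s\<in>mindices_le m - mindices_le N. f s a *\<^sub>R tmono s (x - a))"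
  unfolding taylor_def by (subst sum.subset_diff[of "mindices_le N" "mindices_le m"]) (auto intro: finite_mindices)

text \<open>The anchors of all bumps near \<open>x\<close>, and \<open>p\<close> too, are close to
  \<open>z\<close>, so their Taylor polynomials nearly agree at scale \<open>10 * d x\<close>, and
  the average inherits this. The scale is comparable to the radii of the bumps, so differentiating
  the weights costs only a constant.\<close>

lemma F0_estimate:
  assumes C: "class_C_fin N V f" and adm: "admissible N" and z: "z \<in> V" and \<epsilon>: "0 < \<epsilon>"
  shows "\<exists>\<delta>>0. \<forall>x p. x \<notin> V \<longrightarrow> norm (x - z) < \<delta> \<longrightarrow> p \<in> V \<longrightarrow> norm (x - p) = d x \<longrightarrow>
    Ck_bd N (10 * d x) (\<epsilon> * (10 * d x) ^ N) (nb x) (\<lambda>y. F0 y - taylor N f p y)"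
proof -
  define A where "A = real (card (mindices_le N :: 'a mindex set))"
  from Ck_bd_wavg[of N] obtain C1 where C1: "0 \<le> C1" and "\<forall>x g T w. x \<notin> V \<longrightarrow> 0 \<le> w \<longrightarrow>
     (\<forall>i\<in>active x. Ck_bd N (10 * d x) w (nb x) (\<lambda>y. g i y - T y)) \<longrightarrow>
     Ck_bd N (10 * d x) (C1 * w) (nb x) (\<lambda>y. wavg g y - T y)" by auto
  note avg = this(2)[rule_format]
  \<comment> \<open>\<open>A\<close> accounts for the difference of two Taylor polynomials, 160 for
    the terms of degree above \<open>N\<close>; adding 1 to \<open>C1\<close> avoids division by
    zero.\<close>
  define e where "e = \<epsilon> / ((C1 + 1) * (A + 160))"
  have A: "0 \<le> A" by (simp add: A_def)
  have e: "0 < e" using \<epsilon> C1 A by (simp add: e_def)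
  obtain \<delta>1 where \<delta>1: "0 < \<delta>1" "\<And>x y k. \<lbrakk>x\<in>V; y\<in>V; norm (x - z) < \<delta>1; norm (y - z) < \<delta>1; k \<in> mindices; mlength k \<le> N\<rbrakk>
      \<Longrightarrow> \<bar>taylor_rem N f k x y\<bar> \<le> norm (x - y) ^ (N - mlength k) * e"
    using C[unfolded class_C_fin_def, rule_format, OF z e] by (metis real_norm_def)
  obtain \<delta>2 where \<delta>2: "0 < \<delta>2" "\<And>i. \<lbrakk>i\<in>Idx; norm (anchor i - z) < \<delta>2; rad i < \<delta>2\<rbrakk> \<Longrightarrow>
     N \<le> M i \<and> rad i * (\<Sum>s\<in>mindices_le (M i) - mindices_le N. \<bar>f s (anchor i)\<bar>) \<le> e"
    using adm[unfolded admissible_def, rule_format, OF z e] by blast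
  \<comment> \<open>1/10 makes the scale \<open>10 * d x\<close> at most 1; the factor 6 covers the
    \<open>5 * d x\<close> from \<open>x\<close> to an anchor plus the distance from
    \<open>x\<close> to \<open>z\<close>.\<close>
  define \<delta> where "\<delta> = min (1 / 10) (min (\<delta>1 / 6) (\<delta>2 / 6))"
  have \<delta>: "0 < \<delta>" using \<delta>1 \<delta>2 by (simp add: \<delta>_def)
  have "Ck_bd N (10 * d x) (\<epsilon> * (10 * d x) ^ N) (nb x) (\<lambda>y. F0 y - taylor N f p y)"
    if x: "x \<notin> V" "norm (x - z) < \<delta>" and p: "p \<in> V" "norm (x - p) = d x" for x p
  proof -
    let ?\<sigma> = "10 * d x"
    have d: "0 < d x" "d x < \<delta>" using d_pos[OF x(1)] d_le[OF z, of x] x(2) by auto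
    have \<sigma>: "0 < ?\<sigma>" "?\<sigma> \<le> 1" using d by (auto simp: \<delta>_def)
    have "Ck_bd N ?\<sigma> ((A + 160) * e * ?\<sigma> ^ N) (nb x) (\<lambda>y. taylor (M i) f (anchor i) y - taylor N f p y)"
      if i: "i \<in> active x" for i
    proof -
      have iI: "i \<in> Idx" using i by (simp add: active_def)
      note b = active_bounds[OF i x(1)]
      have a: "norm (x - anchor i) \<le> 5 * d x" using anchor_close[OF i x(1), of x] d by simp
      have az: "norm (anchor i - z) < 6 * \<delta>"
        using norm_triangle_ineq[of "anchor i - x" "x - z"] a x(2) d by (simp add: norm_minus_commute)
      have pz: "norm (p - z) < 6 * \<delta>"
        using norm_triangle_ineq[of "p - x" "x - z"] p x(2) d by (simp add: norm_minus_commute)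
      have ap: "norm (anchor i - p) \<le> ?\<sigma>"
        using norm_triangle_ineq[of "anchor i - x" "x - p"] a p d by (simp add: norm_minus_commute)
      have nb\<sigma>: "norm (y - anchor i) \<le> ?\<sigma>" if "y \<in> nb x" for y
        using anchor_close[OF i x(1) that] d by simp
      have "norm (anchor i - z) < \<delta>2" "rad i < \<delta>2" using az b d by (auto simp: \<delta>_def)
      note M = \<delta>2(2)[OF iI this]
      have "Ck_bd N ?\<sigma> (A * (e * ?\<sigma> ^ N)) (nb x) (\<lambda>y. taylor N f (anchor i) y - taylor N f p y)"
        unfolding A_def
      proof (rule Ck_bd_taylor_diff)
        fix s :: "'a mindex" assume s: "s \<in> mindices_le N"
        have "\<bar>taylor_rem N f s (anchor i) p\<bar> \<le> norm (anchor i - p) ^ (N - mlength s) * e"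
          using s az pz anchor p by (intro \<delta>1(2)) (auto simp: \<delta>_def)
        also have "\<dots> \<le> ?\<sigma> ^ (N - mlength s) * e"
          using ap e by (intro mult_right_mono power_mono) auto
        finally show "\<bar>taylor_rem N f s (anchor i) p\<bar> \<le> e * ?\<sigma> ^ (N - mlength s)" by (simp add: mult.commute)
      qed (use \<sigma> nb\<sigma> in auto)
      moreover have "Ck_bd N ?\<sigma> (160 * e * ?\<sigma> ^ N) (nb x) (\<lambda>y. \<Sum>s\<in>mindices_le (M i) - mindices_le N. f s (anchor i) *\<^sub>R tmono s (y - anchor i))"
      proof (rule Ck_bd_mono)
        show "Ck_bd N ?\<sigma> (\<Sum>s\<in>mindices_le (M i) - mindices_le N. \<bar>f s (anchor i)\<bar> * ?\<sigma> ^ mlength s) (nb x)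
            (\<lambda>y. \<Sum>s\<in>mindices_le (M i) - mindices_le N. f s (anchor i) *\<^sub>R tmono s (y - anchor i))"
          by (intro Ck_bd_sum Ck_bd_scaleR Ck_bd_tmono) (use \<sigma> nb\<sigma> in auto)
        \<comment> \<open>As the scale is at most 1, degrees above \<open>N\<close> may all be
          counted as \<open>N + 1\<close>; the extra factor is converted by
          \<open>?\<sigma> \<le> 160 * rad i\<close> into the radius that admissibility plays
          against the coefficients.\<close>
        have "(\<Sum>s\<in>mindices_le (M i) - mindices_le N. \<bar>f s (anchor i)\<bar> * ?\<sigma> ^ mlength s)
            \<le> (\<Sum>s\<in>mindices_le (M i) - mindices_le N. \<bar>f s (anchor i)\<bar> * ?\<sigma> ^ Suc N)"
          using \<sigma> by (intro sum_mono mult_left_mono power_decreasing) auto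
        also have "\<dots> = ?\<sigma> * (\<Sum>s\<in>mindices_le (M i) - mindices_le N. \<bar>f s (anchor i)\<bar>) * ?\<sigma> ^ N"
          by (simp add: sum_distrib_left sum_distrib_right mult_ac)
        also have "\<dots> \<le> 160 * rad i * (\<Sum>s\<in>mindices_le (M i) - mindices_le N. \<bar>f s (anchor i)\<bar>) * ?\<sigma> ^ N"
          using b d by (intro mult_right_mono sum_nonneg) auto
        also have "\<dots> \<le> 160 * e * ?\<sigma> ^ N"
          using M d by (intro mult_right_mono) (auto simp: mult.assoc)
        finally show "(\<Sum>s\<in>mindices_le (M i) - mindices_le N. \<bar>f s (anchor i)\<bar> * ?\<sigma> ^ mlength s) \<le> 160 * e * ?\<sigma> ^ N" .
      qed (use \<sigma> in auto)
      ultimately have "Ck_bd N ?\<sigma> (A * (e * ?\<sigma> ^ N) + 160 * e * ?\<sigma> ^ N) (nb x)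
          (\<lambda>y. (taylor N f (anchor i) y - taylor N f p y) + (\<Sum>s\<in>mindices_le (M i) - mindices_le N. f s (anchor i) *\<^sub>R tmono s (y - anchor i)))"
        by (intro Ck_bd_add) auto
      moreover have "A * (e * ?\<sigma> ^ N) + 160 * e * ?\<sigma> ^ N = (A + 160) * e * ?\<sigma> ^ N" by (simp add: algebra_simps)
      moreover have "(taylor N f (anchor i) y - taylor N f p y) + (\<Sum>s\<in>mindices_le (M i) - mindices_le N. f s (anchor i) *\<^sub>R tmono s (y - anchor i))
          = taylor (M i) f (anchor i) y - taylor N f p y" for y
        using taylor_split[of N "M i" "anchor i" y] M by simp
      ultimately show ?thesis by (simp only:)
    qed
    then have "Ck_bd N ?\<sigma> (C1 * ((A + 160) * e * ?\<sigma> ^ N)) (nb x) (\<lambda>y. wavg (\<lambda>i. taylor (M i) f (anchor i)) y - taylor N f p y)"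
      using x A e d by (intro avg) auto
    then have "Ck_bd N ?\<sigma> (\<epsilon> * ?\<sigma> ^ N) (nb x) (\<lambda>y. wavg (\<lambda>i. taylor (M i) f (anchor i)) y - taylor N f p y)"
    proof (rule Ck_bd_mono)
      have "C1 * ((A + 160) * e * ?\<sigma> ^ N) \<le> (C1 + 1) * ((A + 160) * e * ?\<sigma> ^ N)"
        using A e d by (intro mult_right_mono) auto
      also have "\<dots> = \<epsilon> * ?\<sigma> ^ N" using A C1 by (simp add: e_def)
      finally show "C1 * ((A + 160) * e * ?\<sigma> ^ N) \<le> \<epsilon> * ?\<sigma> ^ N" .
    qed (use \<sigma> in auto)
    moreover have "F0 y = wavg (\<lambda>i. taylor (M i) f (anchor i)) y" if "y \<in> nb x" for y
      using nb_subset[OF x(1)] that by (auto simp: F0_def)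
    ultimately show ?thesis
      using Ck_bd_cong[of "nb x" "\<lambda>y. F0 y - taylor N f p y" "\<lambda>y. wavg (\<lambda>i. taylor (M i) f (anchor i)) y - taylor N f p y"] by simp
  qed
  then show ?thesis using \<delta> by blast
qed

text \<open>The family of would-be derivatives to be fed into \<open>Ck_family\<close>: prescribed
  on \<open>V\<close>, actual derivatives elsewhere.\<close>

definition jet :: "'a list \<Rightarrow> 'a \<Rightarrow> real" where
  "jet bs x = (if x \<in> V then f (mcount bs) x else pderivs bs F0 x)"

lemma mcount_mindices: "set bs \<subseteq> Basis \<Longrightarrow> mcount bs \<in> mindices"
  by (auto simp: mcount_def mindices_def count_list_0_iff)

text \<open>On \<open>V\<close> this is the hypothesis. Off \<open>V\<close> the comparison passes
  through the nearest point \<open>p\<close>, because two scales are involved: the bumps vary at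
  scale \<open>d x\<close>, which may be far smaller than \<open>norm (x - z)\<close>, whereas the
  polynomials at \<open>p\<close> and \<open>z\<close> are compared at a scale proportional to
  \<open>norm (x - z)\<close>.\<close>

lemma jet_estimate:
  assumes C: "class_C_fin N V f" and adm: "admissible N" and z: "z \<in> V" and \<epsilon>: "0 < \<epsilon>"
  shows "\<exists>\<delta>>0. \<forall>x bs. norm (x - z) < \<delta> \<longrightarrow> set bs \<subseteq> Basis \<longrightarrow> length bs \<le> N \<longrightarrow>
    \<bar>jet bs x - taylor (N - length bs) (mshift (mcount bs) f) z x\<bar> \<le> \<epsilon> * norm (x - z) ^ (N - length bs)"
proof -
  define A where "A = real (card (mindices_le N :: 'a mindex set))"
  \<comment> \<open>The two comparisons off \<open>V\<close> contribute \<open>10 ^ N\<close> and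
    \<open>A * 2 ^ N\<close>.\<close>
  define e where "e = \<epsilon> / (10 ^ N + A * 2 ^ N)"
  have A: "0 \<le> A" by (simp add: A_def)
  have e10: "0 < 10 ^ N + A * 2 ^ N" using A by (intro add_pos_nonneg) auto
  have e: "0 < e" using \<epsilon> e10 by (simp add: e_def)
  have e\<epsilon>: "e * (10 ^ N + A * 2 ^ N) = \<epsilon>" using e10 by (simp add: e_def)
  obtain \<delta>1 where \<delta>1: "0 < \<delta>1" "\<And>x y k. \<lbrakk>x\<in>V; y\<in>V; norm (x - z) < \<delta>1; norm (y - z) < \<delta>1; k \<in> mindices; mlength k \<le> N\<rbrakk>
      \<Longrightarrow> \<bar>taylor_rem N f k x y\<bar> \<le> norm (x - y) ^ (N - mlength k) * e"
    using C[unfolded class_C_fin_def, rule_format, OF z e] by (metis real_norm_def)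
  obtain \<delta>2 where \<delta>2: "0 < \<delta>2" "\<And>x p. \<lbrakk>x \<notin> V; norm (x - z) < \<delta>2; p \<in> V; norm (x - p) = d x\<rbrakk> \<Longrightarrow>
     Ck_bd N (10 * d x) (e * (10 * d x) ^ N) (nb x) (\<lambda>y. F0 y - taylor N f p y)"
    using F0_estimate[OF C adm z e] by blast
  have "\<bar>jet bs x - taylor (N - length bs) (mshift (mcount bs) f) z x\<bar> \<le> \<epsilon> * norm (x - z) ^ (N - length bs)"
    if x: "norm (x - z) < min (\<delta>1 / 2) \<delta>2" and bs: "set bs \<subseteq> Basis" "length bs \<le> N" for x bs
  proof (cases "x \<in> V")
    case True
    have "\<bar>taylor_rem N f (mcount bs) x z\<bar> \<le> norm (x - z) ^ (N - mlength (mcount bs)) * e"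
      using x z True bs \<delta>1(1) by (intro \<delta>1(2)) (auto simp: mlength_mi mcount_mindices)
    also have "\<dots> \<le> \<epsilon> * norm (x - z) ^ (N - length bs)"
    proof -
      have "e * 1 \<le> e * (10 ^ N + A * 2 ^ N)"
        using e A one_le_power[of "10::real" N] by (intro mult_left_mono add_increasing2) auto
      then have "e \<le> \<epsilon>" using e\<epsilon> by simp
      then show ?thesis using bs by (auto simp: mlength_mi mult.commute[of _ e] intro!: mult_right_mono)
    qed
    finally show ?thesis using True bs by (simp add: jet_def taylor_rem_taylor mlength_mi)
  next
    case False
    obtain p where p: "p \<in> V" "norm (x - p) = d x" using nearest by blast
    define \<tau> where "\<tau> = norm (x - z)"
    have d: "0 < d x" "d x \<le> \<tau>" using d_pos[OF False] d_le[OF z, of x] by (auto simp: \<tau>_def)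
    let ?k = "N - length bs"
    have xn: "x \<in> nb x" using d by simp
    have s1: "Ck_bd N (10 * d x) (e * (10 * d x) ^ N) (nb x) (\<lambda>y. F0 y - taylor N f p y)"
      using False x p by (intro \<delta>2) auto
    have pz: "norm (p - z) \<le> 2 * \<tau>"
      using norm_triangle_ineq[of "p - x" "x - z"] p d by (simp add: norm_minus_commute \<tau>_def)
    \<comment> \<open>The closed ball of radius \<open>2 * \<tau>\<close> around \<open>p\<close>
      contains \<open>z\<close> and all of \<open>nb x\<close>.\<close>
    have s2: "Ck_bd N (2 * \<tau>) (A * (e * (2 * \<tau>) ^ N)) (nb x) (\<lambda>y. taylor N f p y - taylor N f z y)"
      unfolding A_def
    proof (rule Ck_bd_taylor_diff)
      fix y assume "y \<in> nb x"
      then show "norm (y - p) \<le> 2 * \<tau>"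
        using norm_triangle_ineq[of "y - x" "x - p"] p d by (simp add: norm_minus_commute dist_norm)
    next
      fix s :: "'a mindex" assume s: "s \<in> mindices_le N"
      have "\<bar>taylor_rem N f s p z\<bar> \<le> norm (p - z) ^ (N - mlength s) * e"
        using s z pz x p \<delta>1(1) by (intro \<delta>1(2)) (auto simp: \<tau>_def)
      also have "\<dots> \<le> (2 * \<tau>) ^ (N - mlength s) * e"
        using pz e by (intro mult_right_mono power_mono) auto
      finally show "\<bar>taylor_rem N f s p z\<bar> \<le> e * (2 * \<tau>) ^ (N - mlength s)" by (simp add: mult.commute)
    qed (use d in auto)
    have CF: "Ck N (nb x) F0" using Ck_subset[OF Ck_F0 nb_subset[OF False]] .
    have CT: "Ck N (nb x) (taylor N f q)" for q by (rule Ck_subset[OF Ck_taylor]) simp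
    have 1: "\<bar>pderivs bs F0 x - pderivs bs (taylor N f p) x\<bar> \<le> e * (10 ^ N * \<tau> ^ ?k)"
    proof -
      have "\<bar>pderivs bs (\<lambda>y. F0 y - taylor N f p y) x\<bar> \<le> e * (10 * d x) ^ N / (10 * d x) ^ length bs"
        using Ck_bd_pderivs[OF s1 bs xn] by simp
      also have "\<dots> = e * (10 * d x) ^ ?k" using d bs by (simp add: power_diff)
      also have "(10 * d x) ^ ?k \<le> 10 ^ N * \<tau> ^ ?k"
        unfolding power_mult_distrib using d by (intro mult_mono power_mono power_increasing) auto
      finally show ?thesis using pderivs_diff[OF open_ball xn CF CT bs] e by simp
    qed
    have 2: "\<bar>pderivs bs (taylor N f p) x - pderivs bs (taylor N f z) x\<bar> \<le> e * (A * 2 ^ N * \<tau> ^ ?k)"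
    proof -
      have "\<bar>pderivs bs (\<lambda>y. taylor N f p y - taylor N f z y) x\<bar> \<le> A * (e * (2 * \<tau>) ^ N) / (2 * \<tau>) ^ length bs"
        using Ck_bd_pderivs[OF s2 bs xn] by simp
      also have "\<dots> = (e * A) * (2 * \<tau>) ^ ?k" using d bs by (simp add: power_diff)
      also have "\<dots> \<le> (e * A) * (2 ^ N * \<tau> ^ ?k)"
        unfolding power_mult_distrib using d e A by (intro mult_left_mono mult_mono power_mono power_increasing) auto
      finally show ?thesis using pderivs_diff[OF open_ball xn CT CT bs] by (simp add: mult_ac)
    qed
    have "\<bar>pderivs bs F0 x - pderivs bs (taylor N f z) x\<bar> \<le> e * (10 ^ N * \<tau> ^ ?k) + e * (A * 2 ^ N * \<tau> ^ ?k)"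
      using 1 2 by linarith
    also have "\<dots> = (e * (10 ^ N + A * 2 ^ N)) * \<tau> ^ ?k" by (simp add: algebra_simps)
    finally show ?thesis using False pderivs_taylor[OF bs, of f z] by (simp add: jet_def e\<epsilon> \<tau>_def)
  qed
  then show ?thesis using \<delta>1(1) \<delta>2(1) by (intro exI[of _ "min (\<delta>1 / 2) \<delta>2"]) auto
qed

text \<open>At a point of \<open>V\<close>, \<open>jet_estimate\<close> makes \<open>jet bs\<close>
  differ from its Taylor polynomial by o(|t|), since the exponent is at least 1. The polynomial then
  supplies the derivative, whose value at the centre is the next prescribed entry.\<close>

lemma has_dir_deriv_jet:
  assumes C: "class_C_fin N V f" and adm: "admissible N"
    and bs: "set bs \<subseteq> Basis" "length bs < N" and b: "b \<in> Basis"
  shows "has_dir_deriv b (jet bs) z (jet (b # bs) z)"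
proof (cases "z \<in> V")
  case False
  have "has_dir_deriv b (pderivs bs F0) z (pderiv_dir b (pderivs bs F0) z)"
    by (rule Ck_has_dir_deriv[OF Ck_pderivs[OF Ck_F0[of N]]]) (use bs b False in auto)
  then have "has_dir_deriv b (jet bs) z (pderiv_dir b (pderivs bs F0) z)"
    using has_dir_deriv_cong[of "- V" z "pderivs bs F0" "jet bs" b] False closed_V by (auto simp: jet_def)
  then show ?thesis using False by (simp add: jet_def)
next
  case z: True
  let ?T = "taylor (Suc (N - Suc (length bs))) (mshift (mcount bs) f) z"
  have N: "Suc (N - Suc (length bs)) = N - length bs" using bs by simp
  let ?E = "\<lambda>t. jet bs (z + t *\<^sub>R b) - ?T (z + t *\<^sub>R b)"
  have "(?E has_vector_derivative 0) (at 0)"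
  proof (rule has_vector_derivative_zeroI)
    show "jet bs (z + 0 *\<^sub>R b) - ?T (z + 0 *\<^sub>R b) = 0"
      using z by (simp add: taylor_self jet_def) (simp add: mshift_def)
    fix \<epsilon> :: real assume \<epsilon>: "0 < \<epsilon>"
    obtain \<delta> where \<delta>: "0 < \<delta>" "\<And>x. norm (x - z) < \<delta> \<Longrightarrow> \<bar>jet bs x - ?T x\<bar> \<le> \<epsilon> * norm (x - z) ^ (N - length bs)"
      using jet_estimate[OF C adm z \<epsilon>] bs N by (metis less_imp_le)
    have "\<bar>?E t\<bar> \<le> \<epsilon> * \<bar>t\<bar>" if "\<bar>t\<bar> < min \<delta> 1" for t
    proof -
      have "\<bar>?E t\<bar> \<le> \<epsilon> * norm ((z + t *\<^sub>R b) - z) ^ (N - length bs)"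
        using that b by (intro \<delta>) simp
      also have "\<dots> = \<epsilon> * \<bar>t\<bar> ^ (N - length bs)" using b by simp
      also have "\<dots> \<le> \<epsilon> * \<bar>t\<bar> ^ 1" using that \<epsilon> bs by (intro mult_left_mono power_decreasing) auto
      finally show ?thesis by simp
    qed
    then show "\<exists>\<delta>>0. \<forall>t. \<bar>t\<bar> < \<delta> \<longrightarrow> \<bar>?E t\<bar> \<le> \<epsilon> * \<bar>t\<bar>"
      using \<delta>(1) by (intro exI[of _ "min \<delta> 1"]) auto
  qed
  moreover have "has_dir_deriv b ?T z (taylor (N - Suc (length bs)) (mshift (mcount [b]) (mshift (mcount bs) f)) z z)"
    by (rule has_dir_deriv_taylor[OF b])
  ultimately have "((\<lambda>t. ?E t + ?T (z + t *\<^sub>R b)) has_vector_derivative 0 + taylor (N - Suc (length bs)) (mshift (mcount [b]) (mshift (mcount bs) f)) z z) (at 0)"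
    by (rule has_vector_derivative_add)
  then show ?thesis using z by (simp add: taylor_self mshift_Cons jet_def) (simp add: mshift_def)
qed

lemma continuous_jet:
  assumes C: "class_C_fin N V f" and adm: "admissible N" and bs: "set bs \<subseteq> Basis" "length bs \<le> N"
  shows "continuous_on UNIV (jet bs)"
proof -
  have "isCont (jet bs) z" for z
  proof (cases "z \<in> V")
    case False
    have "continuous_on (- V) (pderivs bs F0)"
      by (rule Ck_continuous[OF Ck_pderivs[OF Ck_F0[of N] bs]])
    then have "continuous_on (- V) (jet bs)"
      by (rule continuous_on_eq) (simp add: jet_def)
    then show ?thesis using continuous_on_eq_continuous_at[OF open_Compl[OF closed_V]] False by auto
  next
    case z: True
    let ?T = "taylor (N - length bs) (mshift (mcount bs) f) z"
    have "((\<lambda>x. jet bs x - ?T x) \<longlongrightarrow> 0) (at z)"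
    proof (rule tendstoI)
      fix \<epsilon> :: real assume "0 < \<epsilon>"
      then have \<epsilon>: "0 < \<epsilon> / 2" by simp
      obtain \<delta> where \<delta>: "0 < \<delta>" "\<And>x. norm (x - z) < \<delta> \<Longrightarrow> \<bar>jet bs x - ?T x\<bar> \<le> \<epsilon> / 2 * norm (x - z) ^ (N - length bs)"
        using jet_estimate[OF C adm z \<epsilon>] bs by metis
      have "\<forall>\<^sub>F x in at z. norm (x - z) < min \<delta> 1"
        using \<delta> by (auto simp: eventually_at dist_norm intro!: exI[of _ "min \<delta> 1"])
      then show "\<forall>\<^sub>F x in at z. dist (jet bs x - ?T x) 0 < \<epsilon>"
      proof eventually_elim
        case (elim x)
        have "\<epsilon> / 2 * norm (x - z) ^ (N - length bs) \<le> \<epsilon> / 2 * 1"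
          using elim \<epsilon> by (intro mult_left_mono power_le_one) auto
        with \<delta>(2)[of x] elim have "\<bar>jet bs x - ?T x\<bar> \<le> \<epsilon> / 2 * 1" by linarith
        then show ?case using \<epsilon> by (simp add: dist_norm)
      qed
    qed
    moreover have "(?T \<longlongrightarrow> ?T z) (at z)"
    proof -
      have "continuous_on UNIV ?T" by (rule Ck_continuous[OF Ck_taylor])
      then have "isCont ?T z" by (simp add: continuous_on_eq_continuous_at)
      then show ?thesis by (simp only: isCont_def)
    qed
    ultimately have "((\<lambda>x. (jet bs x - ?T x) + ?T x) \<longlongrightarrow> 0 + ?T z) (at z)"
      by (rule tendsto_add)
    moreover have "?T z = jet bs z"
      using z by (simp add: taylor_self jet_def) (simp add: mshift_def)
    ultimately show ?thesis by (simp add: isCont_def)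
  qed
  then show ?thesis by (simp add: continuous_on_eq_continuous_at)
qed

lemma jet_Nil: "jet [] = F0"
  by (auto simp: jet_def F0_def mcount_def fun_eq_iff)

theorem F0_extends:
  assumes "class_C_fin N V f" "admissible N"
  shows "Ck N UNIV F0" "\<And>bs z. set bs \<subseteq> Basis \<Longrightarrow> length bs \<le> N \<Longrightarrow> z \<in> V \<Longrightarrow> pderivs bs F0 z = f (mcount bs) z"
  using Ck_family[of N jet, OF continuous_jet[OF assms] has_dir_deriv_jet[OF assms]]
  by (auto simp: jet_Nil, simp add: jet_def)

end

text \<open>Near \<open>z\<close> each entry of the jet stays within 1 of a polynomial. For infinite
  m this bounds the coefficients against which the degrees are chosen.\<close>

lemma (in whitney) class_C_locally_bounded:
  fixes f :: "'a mindex \<Rightarrow> 'a \<Rightarrow> real"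
  assumes "class_C_fin N V f" "s \<in> mindices" "mlength s \<le> N" "z \<in> V"
  shows "\<exists>B \<delta>. 0 < \<delta> \<and> (\<forall>x\<in>V. norm (x - z) < \<delta> \<longrightarrow> \<bar>f s x\<bar> \<le> B)"
proof -
  let ?T = "taylor (N - mlength s) (mshift s f) z"
  obtain \<delta> where \<delta>0: "0 < \<delta>" and D: "\<forall>x\<in>V. \<forall>y\<in>V. norm (x - z) < \<delta> \<and> norm (y - z) < \<delta> \<longrightarrow>
      (\<forall>k\<in>mindices. mlength k \<le> N \<longrightarrow> norm (taylor_rem N f k x y) \<le> norm (x - y) ^ (N - mlength k) * 1)"
    using assms(1)[unfolded class_C_fin_def, rule_format, OF assms(4), of 1] by auto
  have \<delta>: "0 < \<delta>" "\<And>x. x \<in> V \<Longrightarrow> norm (x - z) < \<delta> \<Longrightarrow> \<bar>taylor_rem N f s x z\<bar> \<le> norm (x - z) ^ (N - mlength s) * 1"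
    using \<delta>0 D[rule_format, OF _ assms(4) _ assms(2,3)] by auto
  have "bounded (?T ` cball z 1)"
    by (intro compact_imp_bounded compact_continuous_image continuous_on_subset[OF Ck_continuous[OF Ck_taylor]]) auto
  then obtain B where B: "\<And>x. x \<in> cball z 1 \<Longrightarrow> \<bar>?T x\<bar> \<le> B" by (auto simp: bounded_iff simp del: mem_cball)
  have "\<bar>f s x\<bar> \<le> B + 1" if "x \<in> V" "norm (x - z) < min \<delta> 1" for x
  proof -
    have "norm (x - z) ^ (N - mlength s) \<le> 1" using that by (intro power_le_one) auto
    then have "\<bar>f s x - ?T x\<bar> \<le> 1"
      using \<delta>(2)[of x] that by (simp add: taylor_rem_taylor)
    moreover have "\<bar>?T x\<bar> \<le> B" using that by (intro B) (simp add: dist_norm norm_minus_commute)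
    ultimately show ?thesis by linarith
  qed
  then show ?thesis using \<delta>(1) by (intro exI[of _ "B + 1"] exI[of _ "min \<delta> 1"]) auto
qed

text \<open>For $m = \infty$ the degree at an index is the largest one compatible with the radius.\<close>

lemma (in whitney) admissible_degrees:
  fixes f :: "'a mindex \<Rightarrow> 'a \<Rightarrow> real"
  assumes "\<And>N. N \<ge> 1 \<Longrightarrow> class_C_fin N V f"
  shows "\<exists>M. \<forall>N. whitney_jet.admissible V f M N"
proof -
  interpret wj: whitney_jet V f M for M by unfold_locales
  define S where "S = (\<lambda>i N. \<Sum>s\<in>mindices_le N. \<bar>f s (anchor i)\<bar>)"
  \<comment> \<open>The first condition makes the set finite, so that \<open>Max\<close> is
    meaningful; the second bounds \<open>rad i * S i N\<close> by \<open>1 / N\<close>. Zero always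
    qualifies.\<close>
  define G where "G = (\<lambda>i. {N. real N * rad i \<le> 1 \<and> rad i * real N * S i N \<le> 1})"
  define M where "M = (\<lambda>i. Max (G i))"
  have fin: "finite (G i)" for i
  proof (rule finite_subset)
    show "G i \<subseteq> {..nat \<lceil>1 / rad i\<rceil>}"
    proof
      fix N assume "N \<in> G i"
      then have "real N \<le> 1 / rad i" using rad_pos[of i] by (simp add: G_def field_simps)
      then show "N \<in> {..nat \<lceil>1 / rad i\<rceil>}" by simp linarith
    qed
  qed simp
  have MG: "M i \<in> G i" for i
    unfolding M_def by (rule Max_in[OF fin]) (auto simp: G_def intro: exI[of _ 0])
  have "wj.admissible M N" for N
    unfolding wj.admissible_def
  proof (intro ballI allI impI)
    fix z and \<epsilon> :: real assume z: "z \<in> V" and \<epsilon>: "0 < \<epsilon>"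
    \<comment> \<open>Degrees of at least \<open>K\<close> exceed \<open>N\<close> and satisfy
      \<open>1 / M i \<le> \<epsilon>\<close>; close to \<open>z\<close> the bounded coefficients
      and small radii put \<open>K\<close> into \<open>G i\<close>.\<close>
    define K where "K = max (Suc N) (nat \<lceil>1 / \<epsilon>\<rceil>)"
    have ex: "\<exists>B \<delta>. 0 < \<delta> \<and> (\<forall>x\<in>V. norm (x - z) < \<delta> \<longrightarrow> \<bar>f s x\<bar> \<le> B)" if "s \<in> mindices_le K" for s
      by (rule class_C_locally_bounded[OF assms[of K]]) (use that z in \<open>auto simp: K_def\<close>)
    have "\<forall>s\<in>mindices_le K. \<exists>p. 0 < snd p \<and> (\<forall>x\<in>V. norm (x - z) < snd p \<longrightarrow> \<bar>f s x\<bar> \<le> fst p)"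
    proof
      fix s :: "'a mindex" assume "s \<in> mindices_le K"
      then obtain B \<delta> where "0 < \<delta> \<and> (\<forall>x\<in>V. norm (x - z) < \<delta> \<longrightarrow> \<bar>f s x\<bar> \<le> B)" using ex by blast
      then show "\<exists>p. 0 < snd p \<and> (\<forall>x\<in>V. norm (x - z) < snd p \<longrightarrow> \<bar>f s x\<bar> \<le> fst p)"
        by (intro exI[of _ "(B, \<delta>)"]) simp
    qed
    from bchoice[OF this] obtain p where
      p: "\<forall>s\<in>mindices_le K. 0 < snd (p s) \<and> (\<forall>x\<in>V. norm (x - z) < snd (p s) \<longrightarrow> \<bar>f s x\<bar> \<le> fst (p s))" by blast
    define B where "B = (\<lambda>s. fst (p s))"
    define \<delta>s where "\<delta>s = (\<lambda>s. snd (p s))"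
    have B: "\<And>s. s \<in> mindices_le K \<Longrightarrow> 0 < \<delta>s s" "\<And>s x. s \<in> mindices_le K \<Longrightarrow> x \<in> V \<Longrightarrow> norm (x - z) < \<delta>s s \<Longrightarrow> \<bar>f s x\<bar> \<le> B s"
      using p by (auto simp: B_def \<delta>s_def)
    define \<delta>1 where "\<delta>1 = Min (\<delta>s ` mindices_le K)"
    have ne: "(\<lambda>_. 0) \<in> mindices_le K" by (simp add: mindices_def mlength_def)
    have \<delta>1: "0 < \<delta>1" unfolding \<delta>1_def using ne B(1) finite_mindices by (subst Min_gr_iff) auto
    define BB where "BB = sum B (mindices_le K)"
    define \<delta> where "\<delta> = min \<delta>1 (min (1 / real K) (1 / (real K * (\<bar>BB\<bar> + 1))))"
    have K: "1 \<le> K" by (simp add: K_def)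
    have \<delta>: "0 < \<delta>" using \<delta>1 K by (simp add: \<delta>_def)
    have "N \<le> M i \<and> rad i * (\<Sum>s\<in>mindices_le (M i) - mindices_le N. \<bar>f s (anchor i)\<bar>) \<le> \<epsilon>"
      if i: "norm (anchor i - z) < \<delta>" "rad i < \<delta>" for i
    proof -
      have "S i K \<le> BB" unfolding S_def BB_def
      proof (rule sum_mono)
        fix s :: "'a mindex" assume s: "s \<in> mindices_le K"
        have "\<delta>1 \<le> \<delta>s s" unfolding \<delta>1_def using s finite_mindices by (intro Min_le) auto
        then show "\<bar>f s (anchor i)\<bar> \<le> B s" using i anchor by (intro B s) (auto simp: \<delta>_def)
      qed
      then have SK: "S i K \<le> \<bar>BB\<bar> + 1" by linarith
      have "real K * rad i \<le> 1" using i K by (auto simp: \<delta>_def field_simps)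
      moreover have "rad i * real K * S i K \<le> 1"
      proof -
        have "rad i * real K * S i K \<le> rad i * real K * (\<bar>BB\<bar> + 1)"
          using SK rad_pos[of i] by (intro mult_left_mono) auto
        also have "\<dots> \<le> (1 / (real K * (\<bar>BB\<bar> + 1))) * real K * (\<bar>BB\<bar> + 1)"
          using i by (intro mult_right_mono) (auto simp: \<delta>_def)
        also have "\<dots> = 1" using K by simp
        finally show ?thesis .
      qed
      ultimately have "K \<in> G i" by (simp add: G_def)
      then have KM: "K \<le> M i" unfolding M_def using fin by (intro Max_ge) auto
      have "1 / \<epsilon> \<le> real K" unfolding K_def by linarith
      have Mpos: "0 < real (M i)" using KM K by simp
      have "(\<Sum>s\<in>mindices_le (M i) - mindices_le N. \<bar>f s (anchor i)\<bar>) \<le> S i (M i)"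
        unfolding S_def by (intro sum_mono2 finite_mindices) auto
      then have "rad i * (\<Sum>s\<in>mindices_le (M i) - mindices_le N. \<bar>f s (anchor i)\<bar>) \<le> rad i * S i (M i)"
        using rad_pos[of i] by (intro mult_left_mono) auto
      also have "\<dots> \<le> 1 / real (M i)"
        using MG[of i] Mpos by (simp add: G_def field_simps)
      also have "\<dots> \<le> \<epsilon>"
      proof -
        have "1 / \<epsilon> \<le> real (M i)" using \<open>1 / \<epsilon> \<le> real K\<close> KM by linarith
        then show ?thesis using \<epsilon> Mpos by (simp add: field_simps)
      qed
      finally show ?thesis using KM by (simp add: K_def)
    qed
    then show "\<exists>\<delta>>0. \<forall>i\<in>Idx. norm (anchor i - z) < \<delta> \<and> rad i < \<delta> \<longrightarrow>
         N \<le> M i \<and> rad i * (\<Sum>s\<in>mindices_le (M i) - mindices_le N. \<bar>f s (anchor i)\<bar>) \<le> \<epsilon>"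
      using \<delta> by blast
  qed
  then show ?thesis by blast
qed

theorem whitney_smooth_extension:
  fixes V :: "'a::euclidean_space set" and f :: "'a mindex \<Rightarrow> 'a \<Rightarrow> real"
  assumes "closed V" "V \<noteq> {}" "class_C m V f"
  shows "\<exists>F. (\<forall>n. Ck n (- V) F) \<and> (\<forall>n. enat n \<le> m \<longrightarrow> Ck n UNIV F) \<and>
    (\<forall>bs z. set bs \<subseteq> Basis \<longrightarrow> enat (length bs) \<le> m \<longrightarrow> z \<in> V \<longrightarrow> pderivs bs F z = f (mcount bs) z)"
proof -
  interpret whitney V using assms by unfold_locales auto
  show ?thesis
  proof (cases m)
    case (enat N)
    interpret wj: whitney_jet V f "\<lambda>_. N" by unfold_locales
    have "wj.admissible N" unfolding wj.admissible_def by (auto intro!: exI[of _ 1])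
    moreover have "class_C_fin N V f" using assms enat by (simp add: class_C_def)
    ultimately show ?thesis
      using wj.F0_extends[of N] wj.Ck_F0 Ck_lower[of N UNIV wj.F0] enat
      by (intro exI[of _ wj.F0]) auto
  next
    case infinity
    then have C: "class_C_fin N V f" if "N \<ge> 1" for N using assms that by (simp add: class_C_def)
    obtain M where M: "\<And>N. whitney_jet.admissible V f M N" using admissible_degrees[OF C] by blast
    interpret wj: whitney_jet V f M by unfold_locales
    note E = wj.F0_extends[OF C M]
    \<comment> \<open>For infinite m the hypothesis only speaks of orders at least 1, hence
      \<open>Suc n\<close>.\<close>
    have "Ck n UNIV wj.F0" for n using Ck_lower[OF E(1)[of "Suc n"], of n] by simp
    moreover have "pderivs bs wj.F0 z = f (mcount bs) z" if "set bs \<subseteq> Basis" "z \<in> V" for bs z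
      using E(2)[of "Suc (length bs)" bs z] that by simp
    ultimately show ?thesis using wj.Ck_F0 by (intro exI[of _ wj.F0]) auto
  qed
qed

section \<open>Real analyticity with quantitative control\<close>

text \<open>Monomials are indexed by lists of basis vectors rather than multi-indices: the coefficients
  are not unique, but products become concatenations.\<close>

abbreviation blists :: "nat \<Rightarrow> 'a::euclidean_space list set" where
  "blists q \<equiv> {bs. set bs \<subseteq> Basis \<and> length bs = q}"

lemma finite_blists: "finite (blists q)"
  by (rule finite_lists_length_eq) simp

definition lmono :: "'a::euclidean_space list \<Rightarrow> 'a \<Rightarrow> real" where
  "lmono bs t = (\<Prod>b\<leftarrow>bs. t \<bullet> b)"

lemma lmono_simps [simp]: "lmono [] t = 1" "lmono (b # bs) t = (t \<bullet> b) * lmono bs t"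
  "lmono (bs @ cs) t = lmono bs t * lmono cs t"
  by (simp_all add: lmono_def)

lemma lmono_abs_le: "set bs \<subseteq> Basis \<Longrightarrow> \<bar>lmono bs t\<bar> \<le> norm t ^ length bs"
proof (induction bs)
  case (Cons b bs)
  then have "\<bar>t \<bullet> b\<bar> * \<bar>lmono bs t\<bar> \<le> norm t * norm t ^ length bs"
    by (intro mult_mono Basis_le_norm) auto
  then show ?case by (simp add: abs_mult)
qed simp

text \<open>\<open>\<beta>\<close> dominates the l1 norm of one choice of coefficients. This norm is
  subadditive and submultiplicative, so estimates of series reduce to those of scalar
  series.\<close>

definition hpoly :: "nat \<Rightarrow> real \<Rightarrow> ('a::euclidean_space \<Rightarrow> real) \<Rightarrow> bool" where
  "hpoly q \<beta> p \<longleftrightarrow> (\<exists>c. (\<Sum>bs\<in>blists q. \<bar>c bs\<bar>) \<le> \<beta> \<and> (\<forall>t. p t = (\<Sum>bs\<in>blists q. c bs * lmono bs t)))"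

lemma hpolyI: "(\<Sum>bs\<in>blists q. \<bar>c bs\<bar>) \<le> \<beta> \<Longrightarrow> (\<And>t. p t = (\<Sum>bs\<in>blists q. c bs * lmono bs t)) \<Longrightarrow> hpoly q \<beta> p"
  unfolding hpoly_def by blast

lemma hpoly_nonneg: "hpoly q \<beta> p \<Longrightarrow> 0 \<le> \<beta>"
  unfolding hpoly_def by (meson order_trans sum_nonneg abs_ge_zero)

lemma hpoly_bound: "hpoly q \<beta> p \<Longrightarrow> \<bar>p t\<bar> \<le> \<beta> * norm t ^ q"
proof -
  assume "hpoly q \<beta> p"
  then obtain c where c: "(\<Sum>bs\<in>blists q. \<bar>c bs\<bar>) \<le> \<beta>" "p t = (\<Sum>bs\<in>blists q. c bs * lmono bs t)"
    unfolding hpoly_def by blast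
  have "\<bar>p t\<bar> \<le> (\<Sum>bs\<in>blists q. \<bar>c bs\<bar> * norm t ^ q)"
    unfolding c(2) using lmono_abs_le
    by (intro order_trans[OF sum_abs] sum_mono) (auto simp: abs_mult intro!: mult_left_mono)
  also have "\<dots> \<le> \<beta> * norm t ^ q"
    unfolding sum_distrib_right[symmetric] using c by (intro mult_right_mono) auto
  finally show ?thesis .
qed

lemma hpoly_weaken: "hpoly q \<beta> p \<Longrightarrow> \<beta> \<le> \<beta>' \<Longrightarrow> hpoly q \<beta>' p"
  unfolding hpoly_def by (meson order_trans)

lemma hpoly_zero: "0 \<le> \<beta> \<Longrightarrow> hpoly q \<beta> (\<lambda>t. 0)"
  by (rule hpolyI[where c = "\<lambda>_. 0"]) auto

lemma blists_0: "blists 0 = {[]}"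
  by auto

lemma hpoly_const: "hpoly 0 \<bar>c\<bar> (\<lambda>t. c)"
  by (rule hpolyI[where c = "\<lambda>_. c"]) (simp_all only: blists_0, simp_all)

lemma hpoly_0_const: "hpoly 0 \<beta> p \<Longrightarrow> p t = p s"
  unfolding hpoly_def by (auto simp: blists_0)

lemma hpoly_inner: "hpoly 1 (\<Sum>b\<in>Basis. \<bar>v \<bullet> b\<bar>) (\<lambda>t. t \<bullet> v)"
proof -
  have 1: "blists 1 = (\<lambda>b. [b]) ` (Basis :: 'a set)"
    by (auto simp: length_Suc_conv)
  show ?thesis
  proof (rule hpolyI[where c = "\<lambda>bs. v \<bullet> hd bs"])
    show "t \<bullet> v = (\<Sum>bs\<in>blists 1. (v \<bullet> hd bs) * lmono bs t)" for t
      unfolding 1 by (subst sum.reindex) (auto simp: inj_on_def euclidean_inner[of t v] mult.commute)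
  qed (unfold 1, subst sum.reindex, auto simp: inj_on_def)
qed

lemma hpoly_add: "hpoly q \<beta> p \<Longrightarrow> hpoly q \<beta>' p' \<Longrightarrow> hpoly q (\<beta> + \<beta>') (\<lambda>t. p t + p' t)"
proof -
  assume "hpoly q \<beta> p" "hpoly q \<beta>' p'"
  then obtain c c' where c: "(\<Sum>bs\<in>blists q. \<bar>c bs\<bar>) \<le> \<beta>" "\<And>t. p t = (\<Sum>bs\<in>blists q. c bs * lmono bs t)"
    "(\<Sum>bs\<in>blists q. \<bar>c' bs\<bar>) \<le> \<beta>'" "\<And>t. p' t = (\<Sum>bs\<in>blists q. c' bs * lmono bs t)"
    unfolding hpoly_def by blast
  have "(\<Sum>bs\<in>blists q. \<bar>c bs + c' bs\<bar>) \<le> (\<Sum>bs\<in>blists q. \<bar>c bs\<bar> + \<bar>c' bs\<bar>)"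
    by (intro sum_mono) simp
  then show ?thesis using c
    by (intro hpolyI[where c = "\<lambda>bs. c bs + c' bs"]) (simp_all add: sum.distrib algebra_simps)
qed

lemma hpoly_sum: "(\<And>i. i \<in> A \<Longrightarrow> hpoly q (\<beta> i) (p i)) \<Longrightarrow> hpoly q (\<Sum>i\<in>A. \<beta> i) (\<lambda>t. \<Sum>i\<in>A. p i t)"
  by (induction A rule: infinite_finite_induct) (auto intro: hpoly_zero hpoly_add)

lemma hpoly_cmult: "hpoly q \<beta> p \<Longrightarrow> hpoly q (\<bar>a\<bar> * \<beta>) (\<lambda>t. a * p t)"
proof -
  assume "hpoly q \<beta> p"
  then obtain c where c: "(\<Sum>bs\<in>blists q. \<bar>c bs\<bar>) \<le> \<beta>" "\<And>t. p t = (\<Sum>bs\<in>blists q. c bs * lmono bs t)"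
    unfolding hpoly_def by blast
  then show ?thesis
    by (intro hpolyI[where c = "\<lambda>bs. a * c bs"])
      (simp_all add: abs_mult sum_distrib_left[symmetric] mult.assoc mult_left_mono)
qed

text \<open>Cutting lists after \<open>q\<close> entries is a bijection; it turns the product of two
  coefficient systems into a single one.\<close>

lemma sum_blists_append:
  "(\<Sum>bs\<in>blists (q + r). g (take q bs) (drop q bs)) = (\<Sum>as\<in>blists q. \<Sum>bs\<in>blists r. g as bs)"
  unfolding sum.cartesian_product
  by (rule sum.reindex_bij_witness[of _ "\<lambda>(as, bs). as @ bs" "\<lambda>bs. (take q bs, drop q bs)"])
    (auto dest: in_set_takeD in_set_dropD)

lemma hpoly_mult: "hpoly q \<beta> p \<Longrightarrow> hpoly r \<gamma> p' \<Longrightarrow> hpoly (q + r) (\<beta> * \<gamma>) (\<lambda>t. p t * p' t)"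
proof -
  assume *: "hpoly q \<beta> p" "hpoly r \<gamma> p'"
  then obtain c c' where c: "(\<Sum>bs\<in>blists q. \<bar>c bs\<bar>) \<le> \<beta>" "\<And>t. p t = (\<Sum>bs\<in>blists q. c bs * lmono bs t)"
    "(\<Sum>bs\<in>blists r. \<bar>c' bs\<bar>) \<le> \<gamma>" "\<And>t. p' t = (\<Sum>bs\<in>blists r. c' bs * lmono bs t)"
    unfolding hpoly_def by blast
  show ?thesis
  proof (rule hpolyI[where c = "\<lambda>bs. c (take q bs) * c' (drop q bs)"])
    have "(\<Sum>bs\<in>blists (q + r). \<bar>c (take q bs) * c' (drop q bs)\<bar>) = (\<Sum>bs\<in>blists q. \<bar>c bs\<bar>) * (\<Sum>bs\<in>blists r. \<bar>c' bs\<bar>)"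
      using sum_blists_append[of "\<lambda>as bs. \<bar>c as * c' bs\<bar>" q r] by (simp add: abs_mult sum_product)
    also have "\<dots> \<le> \<beta> * \<gamma>" using c hpoly_nonneg[OF *(1)] by (intro mult_mono) (auto intro: sum_nonneg)
    finally show "(\<Sum>bs\<in>blists (q + r). \<bar>c (take q bs) * c' (drop q bs)\<bar>) \<le> \<beta> * \<gamma>" .
    fix t
    have "(\<Sum>bs\<in>blists (q + r). c (take q bs) * c' (drop q bs) * lmono bs t)
       = (\<Sum>bs\<in>blists (q + r). (c (take q bs) * lmono (take q bs) t) * (c' (drop q bs) * lmono (drop q bs) t))"
    proof (rule sum.cong[OF refl])
      fix bs :: "'a list"
      have "lmono bs t = lmono (take q bs) t * lmono (drop q bs) t"
        using lmono_simps(3)[of "take q bs" "drop q bs" t] by simp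
      then show "c (take q bs) * c' (drop q bs) * lmono bs t = (c (take q bs) * lmono (take q bs) t) * (c' (drop q bs) * lmono (drop q bs) t)"
        by (simp add: mult_ac)
    qed
    also have "\<dots> = p t * p' t"
      using sum_blists_append[of "\<lambda>as bs. (c as * lmono as t) * (c' bs * lmono bs t)" q r] by (simp add: c sum_product)
    finally show "p t * p' t = (\<Sum>bs\<in>blists (q + r). c (take q bs) * c' (drop q bs) * lmono bs t)" by simp
  qed
qed

lemma hpoly_power: "hpoly q \<beta> p \<Longrightarrow> hpoly (q * n) (\<beta> ^ n) (\<lambda>t. p t ^ n)"
proof (induction n)
  case 0
  then show ?case using hpoly_const[of 1] by simp
next
  case (Suc n)
  then show ?case using hpoly_mult[of q \<beta> p "q * n" "\<beta> ^ n" "\<lambda>t. p t ^ n"] by simp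
qed

text \<open>For a fixed degree only finitely many coefficients are involved, and each is an
  absolutely convergent series.\<close>

lemma hpoly_suminf:
  fixes p :: "nat \<Rightarrow> 'a::euclidean_space \<Rightarrow> real"
  assumes "\<And>i. hpoly q (\<beta> i) (p i)" "summable \<beta>"
  shows "hpoly q (\<Sum>i. \<beta> i) (\<lambda>t. \<Sum>i. p i t)"
proof -
  have "\<forall>i. \<exists>c. (\<Sum>bs\<in>blists q. \<bar>c bs\<bar>) \<le> \<beta> i \<and> (\<forall>t. p i t = (\<Sum>bs\<in>blists q. c bs * lmono bs t))"
    using assms(1) unfolding hpoly_def by blast
  from choice[OF this] obtain c where
    "\<forall>i. (\<Sum>bs\<in>blists q. \<bar>c i bs\<bar>) \<le> \<beta> i \<and> (\<forall>t. p i t = (\<Sum>bs\<in>blists q. c i bs * lmono bs t))"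
    by (elim exE)
  then have c: "\<And>i. (\<Sum>bs\<in>blists q. \<bar>c i bs\<bar>) \<le> \<beta> i" "\<And>i t. p i t = (\<Sum>bs\<in>blists q. c i bs * lmono bs t)"
    by blast+
  have le: "\<bar>c i bs\<bar> \<le> \<beta> i" if "bs \<in> blists q" for i bs
    using c(1)[of i] member_le_sum[OF that _ finite_blists, of "\<lambda>bs. \<bar>c i bs\<bar>"] by simp
  have s: "summable (\<lambda>i. \<bar>c i bs\<bar>)" if "bs \<in> blists q" for bs
    by (rule summable_comparison_test'[OF assms(2)]) (use le[OF that] in auto)
  have s': "summable (\<lambda>i. c i bs)" if "bs \<in> blists q" for bs
    by (rule summable_rabs_cancel[OF s[OF that]])
  show ?thesis
  proof (rule hpolyI[where c = "\<lambda>bs. \<Sum>i. c i bs"])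
    have "(\<Sum>bs\<in>blists q. \<bar>\<Sum>i. c i bs\<bar>) \<le> (\<Sum>bs\<in>blists q. \<Sum>i. \<bar>c i bs\<bar>)"
      by (intro sum_mono summable_rabs s)
    also have "\<dots> = (\<Sum>i. \<Sum>bs\<in>blists q. \<bar>c i bs\<bar>)" by (rule suminf_sum[symmetric]) (rule s)
    also have "\<dots> \<le> (\<Sum>i. \<beta> i)" using c(1) assms(2) by (intro suminf_le summable_sum s)
    finally show "(\<Sum>bs\<in>blists q. \<bar>\<Sum>i. c i bs\<bar>) \<le> (\<Sum>i. \<beta> i)" .
    fix t
    have "(\<Sum>i. p i t) = (\<Sum>bs\<in>blists q. \<Sum>i. c i bs * lmono bs t)"
      unfolding c(2) by (rule suminf_sum) (intro summable_mult2 s')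
    also have "\<dots> = (\<Sum>bs\<in>blists q. (\<Sum>i. c i bs) * lmono bs t)"
      by (intro sum.cong refl suminf_mult2[symmetric] s')
    finally show "(\<Sum>i. p i t) = (\<Sum>bs\<in>blists q. (\<Sum>i. c i bs) * lmono bs t)" .
  qed
qed

text \<open>Coefficients dominated by \<open>B * K ^ q\<close>: a power series converging at least
  for \<open>norm t < 1 / K\<close>. Both numbers are explicit because infinitely many functions
  will be summed, which requires one \<open>K\<close> and summable \<open>B\<close>.\<close>

definition analytic :: "'a::euclidean_space \<Rightarrow> real \<Rightarrow> real \<Rightarrow> ('a \<Rightarrow> real) \<Rightarrow> bool" where
  "analytic \<xi> B K f \<longleftrightarrow> 0 < K \<and> (\<exists>p. (\<forall>q. hpoly q (B * K ^ q) (p q)) \<and> (\<forall>t. K * norm t < 1 \<longrightarrow> (\<lambda>q. p q t) sums f (\<xi> + t)))"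

lemma analyticD:
  assumes "analytic \<xi> B K f"
  shows "\<exists>p. 0 < K \<and> 0 \<le> B \<and> (\<forall>q. hpoly q (B * K ^ q) (p q)) \<and> (\<forall>t. K * norm t < 1 \<longrightarrow> (\<lambda>q. p q t) sums f (\<xi> + t)) \<and>
    (\<forall>q t. \<bar>p q t\<bar> \<le> B * (K * norm t) ^ q) \<and> (\<forall>t. K * norm t < 1 \<longrightarrow> summable (\<lambda>q. \<bar>p q t\<bar>))"
proof -
  obtain p where p: "0 < K" "\<And>q. hpoly q (B * K ^ q) (p q)" "\<And>t. K * norm t < 1 \<Longrightarrow> (\<lambda>q. p q t) sums f (\<xi> + t)"
    using assms unfolding analytic_def by blast
  have b: "\<bar>p q t\<bar> \<le> B * (K * norm t) ^ q" for q t
    using hpoly_bound[OF p(2)[of q], of t] by (simp add: power_mult_distrib)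
  have "summable (\<lambda>q. \<bar>p q t\<bar>)" if "K * norm t < 1" for t
  proof (rule summable_comparison_test')
    show "summable (\<lambda>q. B * (K * norm t) ^ q)"
      using p(1) that by (intro summable_mult summable_geometric) simp
  qed (use b in simp)
  moreover have "0 \<le> B" using hpoly_nonneg[OF p(2)[of 0]] by simp
  ultimately show ?thesis using p b by (intro exI[of _ p]) auto
qed

lemma analytic_weaken:
  assumes "analytic \<xi> B K f" "B \<le> B'" "K \<le> K'" shows "analytic \<xi> B' K' f"
proof -
  from analyticD[OF assms(1)] obtain p where "0 < K" "0 \<le> B" "\<forall>q. hpoly q (B * K ^ q) (p q)" "\<forall>t. K * norm t < 1 \<longrightarrow> (\<lambda>q. p q t) sums f (\<xi> + t)"
    "\<forall>q t. \<bar>p q t\<bar> \<le> B * (K * norm t) ^ q" "\<forall>t. K * norm t < 1 \<longrightarrow> summable (\<lambda>q. \<bar>p q t\<bar>)"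
    by (elim exE conjE)
  note p = this[rule_format]
  have "hpoly q (B' * K' ^ q) (p q)" for q
    by (rule hpoly_weaken[OF p(3)]) (use p assms in \<open>auto intro!: mult_mono power_mono\<close>)
  moreover have "K * norm t < 1" if "K' * norm t < 1" for t
    using that assms(3) mult_right_mono[OF assms(3), of "norm t"] by simp
  ultimately show ?thesis unfolding analytic_def using p assms by (intro conjI exI[of _ p]) auto
qed

text \<open>The functions agree only near the centre, so the rate is raised until the ball on which
  the series must converge fits into that neighbourhood.\<close>

lemma analytic_cong:
  assumes "analytic \<xi> B K f" "0 < r" "\<And>x. norm (x - \<xi>) < r \<Longrightarrow> f x = g x"
  shows "analytic \<xi> B (max K (1 / r)) g"
proof -
  have "analytic \<xi> B (max K (1 / r)) f" by (rule analytic_weaken[OF assms(1)]) auto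
  moreover have "f (\<xi> + t) = g (\<xi> + t)" if "max K (1 / r) * norm t < 1" for t
  proof -
    have "(1 / r) * norm t < 1"
      using that mult_right_mono[of "1 / r" "max K (1 / r)" "norm t"] by simp
    then show ?thesis using assms by (intro assms(3)) (simp add: field_simps)
  qed
  ultimately show ?thesis unfolding analytic_def by force
qed

text \<open>The part of degree q of the Cauchy product has q + 1 terms, and
  \<open>q + 1 \<le> 2 ^ q\<close> is absorbed by doubling the rate.\<close>

lemma analytic_mult:
  assumes "analytic \<xi> B K f" "analytic \<xi> B' K g"
  shows "analytic \<xi> (B * B') (2 * K) (\<lambda>x. f x * g x)"
proof -
  from analyticD[OF assms(1)] obtain p where "0 < K" "0 \<le> B" "\<forall>q. hpoly q (B * K ^ q) (p q)" "\<forall>t. K * norm t < 1 \<longrightarrow> (\<lambda>q. p q t) sums f (\<xi> + t)"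
    "\<forall>q t. \<bar>p q t\<bar> \<le> B * (K * norm t) ^ q" "\<forall>t. K * norm t < 1 \<longrightarrow> summable (\<lambda>q. \<bar>p q t\<bar>)"
    by (elim exE conjE)
  note p = this[rule_format]
  from analyticD[OF assms(2)] obtain r where "0 < K" "0 \<le> B'" "\<forall>q. hpoly q (B' * K ^ q) (r q)" "\<forall>t. K * norm t < 1 \<longrightarrow> (\<lambda>q. r q t) sums g (\<xi> + t)"
    "\<forall>q t. \<bar>r q t\<bar> \<le> B' * (K * norm t) ^ q" "\<forall>t. K * norm t < 1 \<longrightarrow> summable (\<lambda>q. \<bar>r q t\<bar>)"
    by (elim exE conjE)
  note r = this[rule_format]
  define P where "P = (\<lambda>q t. \<Sum>i\<le>q. p i t * r (q - i) t)"
  have "hpoly q (B * B' * (2 * K) ^ q) (P q)" for q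
  proof (rule hpoly_weaken)
    show "hpoly q (\<Sum>i\<le>q. B * K ^ i * (B' * K ^ (q - i))) (P q)"
      unfolding P_def using hpoly_mult[OF p(3) r(3)] by (intro hpoly_sum) (metis atMost_iff le_add_diff_inverse)
    have "(\<Sum>i\<le>q. B * K ^ i * (B' * K ^ (q - i))) = (\<Sum>i\<le>q. B * B' * K ^ q)"
      by (intro sum.cong refl) (auto simp: mult_ac simp flip: power_add)
    also have "\<dots> = B * B' * (real (Suc q) * K ^ q)" by simp
    also have "\<dots> \<le> B * B' * (2 ^ q * K ^ q)"
    proof -
      have "real (Suc q) \<le> 2 ^ q" using less_exp[of q] by (metis Suc_leI of_nat_le_iff of_nat_numeral of_nat_power)
      then show ?thesis using p r by (intro mult_left_mono mult_right_mono) auto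
    qed
    finally show "(\<Sum>i\<le>q. B * K ^ i * (B' * K ^ (q - i))) \<le> B * B' * (2 * K) ^ q"
      by (simp add: power_mult_distrib)
  qed
  moreover have "(\<lambda>q. P q t) sums (f (\<xi> + t) * g (\<xi> + t))" if "2 * K * norm t < 1" for t
  proof -
    have "0 \<le> K * norm t" using p(1) by simp
    then have t: "K * norm t < 1" using that unfolding mult.assoc by linarith
    show ?thesis
      unfolding P_def using Cauchy_product_sums[of "\<lambda>q. p q t" "\<lambda>q. r q t"] p(4,6)[OF t] r(4,6)[OF t]
      by (simp add: sums_iff)
  qed
  ultimately show ?thesis unfolding analytic_def using p(1) by (intro conjI exI[of _ P] allI impI) simp_all
qed

text \<open>The terms of the reciprocal series, obtained by equating the Cauchy product with 1
  degree by degree; \<open>a\<close> is the constant term.\<close>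

fun recip :: "real \<Rightarrow> (nat \<Rightarrow> 'a \<Rightarrow> real) \<Rightarrow> nat \<Rightarrow> 'a \<Rightarrow> real" where
  "recip a p 0 = (\<lambda>t. 1 / a)"
| "recip a p (Suc q) = (\<lambda>t. (- 1 / a) * (\<Sum>j\<le>q. p (Suc j) t * recip a p (q - j) t))"

lemma analytic_inverse:
  assumes "analytic \<xi> B K f" "f \<xi> \<noteq> 0"
  shows "\<exists>B' K'. analytic \<xi> B' K' (\<lambda>x. inverse (f x))"
proof -
  from analyticD[OF assms(1)] obtain p where "0 < K" "0 \<le> B" "\<forall>q. hpoly q (B * K ^ q) (p q)" "\<forall>t. K * norm t < 1 \<longrightarrow> (\<lambda>q. p q t) sums f (\<xi> + t)"
    "\<forall>q t. \<bar>p q t\<bar> \<le> B * (K * norm t) ^ q" "\<forall>t. K * norm t < 1 \<longrightarrow> summable (\<lambda>q. \<bar>p q t\<bar>)"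
    by (elim exE conjE)
  note p = this[rule_format]
  define a where "a = f \<xi>"
  \<comment> \<open>\<open>p 0\<close> is a constant polynomial, and only it survives at t =
    0.\<close>
  have p0: "p 0 t = a" for t
  proof -
    have "p q 0 = 0" if "q \<noteq> 0" for q using p(5)[of q 0] that by (simp add: power_0_left)
    then have "(\<lambda>q. p q 0) sums p 0 0" using sums_finite[of "{0}" "\<lambda>q. p q 0"] by auto
    moreover have "(\<lambda>q. p q 0) sums f \<xi>" using p(4)[of 0] by simp
    ultimately have "p 0 0 = a" using sums_unique2 a_def by blast
    then show ?thesis using hpoly_0_const p(3)[of 0] by (metis power_0)
  qed
  have a: "a \<noteq> 0" using assms by (simp add: a_def)
  define \<beta> where "\<beta> = 1 / \<bar>a\<bar>"
  have \<beta>: "0 < \<beta>" using a by (simp add: \<beta>_def)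
  \<comment> \<open>The factor \<open>m\<close> absorbs \<open>B * \<beta>\<close> in the recursion,
    and the factor 2 in \<open>K'\<close> leaves a sum of powers of 1/2, which is at most 1.\<close>
  define m where "m = max 1 (B * \<beta>)"
  define K' where "K' = 2 * K * m"
  have K': "0 < K'" "K \<le> K'" using p(1) by (auto simp: K'_def m_def)
  let ?r = "recip a p"
  have hpr: "hpoly q (\<beta> * K' ^ q) (?r q)" for q
  proof (induction q rule: less_induct)
    case (less q)
    show ?case
    proof (cases q)
      case 0
      then show ?thesis using hpoly_const[of "1 / a"] by (simp add: \<beta>_def)
    next
      case (Suc k)
      have "hpoly q (\<Sum>j\<le>k. B * K ^ Suc j * (\<beta> * K' ^ (k - j))) (\<lambda>t. \<Sum>j\<le>k. p (Suc j) t * ?r (k - j) t)"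
      proof (rule hpoly_sum)
        fix j assume "j \<in> {..k}"
        then have "Suc j + (k - j) = q" using Suc by simp
        then show "hpoly q (B * K ^ Suc j * (\<beta> * K' ^ (k - j))) (\<lambda>t. p (Suc j) t * ?r (k - j) t)"
          using hpoly_mult[OF p(3)[of "Suc j"] less[of "k - j"]] Suc by simp
      qed
      then have "hpoly q (\<beta> * (\<Sum>j\<le>k. B * K ^ Suc j * (\<beta> * K' ^ (k - j)))) (?r q)"
        using hpoly_cmult[of q _ _ "- 1 / a"] Suc by (simp add: \<beta>_def)
      then show ?thesis
      proof (rule hpoly_weaken)
        have "(\<Sum>j\<le>k. B * K ^ Suc j * (\<beta> * K' ^ (k - j))) \<le> (\<Sum>j\<le>k. K' ^ q * (1 / 2) ^ Suc j)"
        proof (rule sum_mono)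
          fix j assume j: "j \<in> {..k}"
          have m: "B * \<beta> \<le> m ^ Suc j"
            using self_le_power[of m "Suc j"] by (simp add: m_def)
          have "B * K ^ Suc j * (\<beta> * K' ^ (k - j)) = (B * \<beta>) * (K ^ Suc j * K' ^ (k - j))" by simp
          also have "\<dots> \<le> m ^ Suc j * (K ^ Suc j * K' ^ (k - j))"
            using p(1) K' m by (intro mult_right_mono) auto
          also have "\<dots> = (1 / 2) ^ Suc j * (K' ^ Suc j * K' ^ (k - j))"
            unfolding K'_def by (simp add: power_mult_distrib power_one_over field_simps)
          also have "K' ^ Suc j * K' ^ (k - j) = K' ^ q"
            using j Suc by (simp del: power_Suc flip: power_add)
          finally show "B * K ^ Suc j * (\<beta> * K' ^ (k - j)) \<le> K' ^ q * (1 / 2) ^ Suc j" by (simp add: mult.commute)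
        qed
        also have "\<dots> = K' ^ q * (\<Sum>j\<le>k. (1 / 2) ^ Suc j)" by (simp add: sum_distrib_left)
        also have "(\<Sum>j\<le>k. (1 / 2 :: real) ^ Suc j) \<le> 1"
        proof -
          have "(\<Sum>j\<le>k. (1 / 2 :: real) ^ Suc j) = 1 - (1 / 2) ^ Suc k" by (induction k) auto
          then show ?thesis by simp
        qed
        finally show "\<beta> * (\<Sum>j\<le>k. B * K ^ Suc j * (\<beta> * K' ^ (k - j))) \<le> \<beta> * K' ^ q"
          using \<beta> K' by (simp add: mult_left_mono)
      qed
    qed
  qed
  have sumsr: "(\<lambda>q. ?r q t) sums inverse (f (\<xi> + t))" if t': "K' * norm t < 1" for t
  proof -
    have t: "K * norm t < 1" using t' K' mult_right_mono[OF K'(2), of "norm t"] by simp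
    have rb: "norm \<bar>?r q t\<bar> \<le> \<beta> * (K' * norm t) ^ q" for q
      using hpoly_bound[OF hpr, of q t] by (simp add: power_mult_distrib)
    have "summable (\<lambda>q. \<beta> * (K' * norm t) ^ q)"
      using t' K' by (intro summable_mult summable_geometric) simp
    then have sr: "summable (\<lambda>q. \<bar>?r q t\<bar>)"
      by (rule summable_comparison_test'[where N = 0]) (rule rb)
    have "(\<Sum>i\<le>q. p i t * ?r (q - i) t) = (if q = 0 then 1 else 0)" for q
    proof (cases q)
      case (Suc k)
      have "(\<Sum>i\<le>Suc k. p i t * ?r (Suc k - i) t) = p 0 t * ?r (Suc k) t + (\<Sum>j\<le>k. p (Suc j) t * ?r (k - j) t)"
        by (subst sum.atMost_Suc_shift) simp
      also have "\<dots> = 0" using a by (simp add: p0)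
      finally show ?thesis using Suc by simp
    qed (use a p0 in simp)
    then have "(\<lambda>q. if q = 0 then 1 else 0) sums ((\<Sum>q. p q t) * (\<Sum>q. ?r q t))"
      using Cauchy_product_sums[of "\<lambda>q. p q t" "\<lambda>q. ?r q t"] p(6)[OF t] sr by simp
    moreover have "(\<lambda>q::nat. if q = 0 then 1 else (0::real)) sums 1" using sums_single[of 0 "\<lambda>_. 1::real"] by simp
    ultimately have "f (\<xi> + t) * (\<Sum>q. ?r q t) = 1" using p(4)[OF t] sums_unique2 sums_unique by metis
    then have "(\<Sum>q. ?r q t) = inverse (f (\<xi> + t))"
      by (simp add: inverse_unique[symmetric])
    then show ?thesis using summable_rabs_cancel[OF sr] by (simp add: sums_iff)
  qed
  have "analytic \<xi> \<beta> K' (\<lambda>x. inverse (f x))"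
    unfolding analytic_def using hpr sumsr K'(1) by (intro conjI exI[of _ ?r] allI impI) simp_all
  then show ?thesis by (intro exI)
qed

text \<open>The common rate lets the double series be summed in the other order: Tannery's theorem
  applies with \<open>B i / (1 - K * norm t)\<close> as dominating sequence.\<close>

lemma analytic_suminf:
  assumes G: "\<And>i::nat. analytic \<xi> (B i) K (G i)" and "summable B"
  shows "analytic \<xi> (\<Sum>i. B i) K (\<lambda>x. \<Sum>i. G i x)"
proof -
  have "\<forall>i. \<exists>p. (\<forall>q. hpoly q (B i * K ^ q) (p q)) \<and> (\<forall>t. K * norm t < 1 \<longrightarrow> (\<lambda>q. p q t) sums G i (\<xi> + t))"
    using G unfolding analytic_def by blast
  from choice[OF this] obtain p where
    p: "\<And>i q. hpoly q (B i * K ^ q) (p i q)" "\<And>i t. K * norm t < 1 \<Longrightarrow> (\<lambda>q. p i q t) sums G i (\<xi> + t)"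
    by blast
  have K: "0 < K" using G[of 0] by (simp add: analytic_def)
  have b: "\<bar>p i q t\<bar> \<le> B i * (K * norm t) ^ q" for i q t
    using hpoly_bound[OF p(1)[of q i], of t] by (simp add: power_mult_distrib)
  have B0: "0 \<le> B i" for i using hpoly_nonneg[OF p(1)[of 0 i]] by simp
  define P where "P = (\<lambda>q t. \<Sum>i. p i q t)"
  have "hpoly q ((\<Sum>i. B i) * K ^ q) (P q)" for q
    using hpoly_suminf[OF p(1) summable_mult2[OF assms(2)], of q] suminf_mult2[OF assms(2)] by (simp add: P_def)
  moreover have "(\<lambda>q. P q t) sums (\<Sum>i. G i (\<xi> + t))" if t: "K * norm t < 1" for t
  proof -
    let ?x = "K * norm t"
    have x: "0 \<le> ?x" using K by simp
    have sp: "summable (\<lambda>i. p i q t)" for q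
    proof (rule summable_rabs_cancel, rule summable_comparison_test')
      show "summable (\<lambda>i. B i * ?x ^ q)" by (intro summable_mult2 assms)
    qed (use b in simp)
    let ?h = "\<lambda>Q i. \<Sum>q<Q. p i q t"
    have partial: "(\<Sum>q<Q. P q t) = (\<Sum>i. ?h Q i)" for Q
      unfolding P_def by (rule suminf_sum[symmetric]) (rule sp)
    have geo: "(\<Sum>q<Q. ?x ^ q) \<le> 1 / (1 - ?x)" for Q
    proof -
      have "(\<Sum>q<Q. ?x ^ q) \<le> (\<Sum>q. ?x ^ q)" using x t by (intro sum_le_suminf summable_geometric) auto
      then show ?thesis using x t suminf_geometric[of ?x] by simp
    qed
    have hb: "norm (?h Q i) \<le> B i * (1 / (1 - ?x))" for Q i
    proof -
      have "norm (?h Q i) \<le> (\<Sum>q<Q. B i * ?x ^ q)" using b by (intro sum_norm_le) simp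
      also have "\<dots> \<le> B i * (1 / (1 - ?x))" unfolding sum_distrib_left[symmetric] using B0 geo by (intro mult_left_mono)
      finally show ?thesis .
    qed
    have "(\<lambda>Q. ?h Q i) \<longlonglongrightarrow> G i (\<xi> + t)" for i
      using p(2)[OF t, of i] by (simp add: sums_def)
    moreover have "\<forall>\<^sub>F (i, Q) in at_top \<times>\<^sub>F sequentially. norm (?h Q i) \<le> B i * (1 / (1 - ?x))"
      using hb by (intro always_eventually) auto
    moreover have "summable (\<lambda>i. B i * (1 / (1 - ?x)))" by (intro summable_mult2 assms)
    ultimately have "(\<lambda>Q. \<Sum>i. ?h Q i) \<longlonglongrightarrow> (\<Sum>i. G i (\<xi> + t))"
      using tannerys_theorem[of "\<lambda>i Q. ?h Q i" "\<lambda>i. G i (\<xi> + t)" sequentially "\<lambda>i. B i * (1 / (1 - ?x))"] by simp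
    then show ?thesis unfolding sums_def partial .
  qed
  ultimately show ?thesis unfolding analytic_def using K by (intro conjI exI[of _ P]) auto
qed

section \<open>Gaussian mollification\<close>

lemma has_bochner_integral_gauss:
  "has_bochner_integral lborel (\<lambda>y::'a::euclidean_space. exp (- (y \<bullet> y))) (sqrt pi ^ DIM('a))"
proof (rule has_bochner_integral_nn_integral)
  \<comment> \<open>The known moment is over the half-line, hence the factor 2.\<close>
  have "has_bochner_integral lborel (\<lambda>x. exp (- x\<^sup>2)) (2 *\<^sub>R (sqrt pi / 2))"
    by (rule has_bochner_integral_even_function[OF gaussian_moment_0]) simp
  then have 1: "(\<integral>\<^sup>+x. ennreal (exp (- x\<^sup>2)) \<partial>lborel) = ennreal (sqrt pi)"
    by (subst nn_integral_eq_integral) (auto simp: has_bochner_integral_iff)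
  have "exp (- (y \<bullet> y)) = (\<Prod>b\<in>Basis. exp (- (y \<bullet> b)\<^sup>2))" for y :: 'a
    by (simp add: euclidean_inner[of y y] exp_sum[symmetric] sum_negf power2_eq_square)
  then have "(\<integral>\<^sup>+y. ennreal (exp (- (y \<bullet> y))) \<partial>(lborel :: 'a measure)) = (\<integral>\<^sup>+y. (\<Prod>b\<in>Basis. ennreal (exp (- (y \<bullet> b)\<^sup>2))) \<partial>(lborel :: 'a measure))"
    by (simp add: prod_ennreal)
  also have "\<dots> = (\<Prod>b\<in>(Basis :: 'a set). (\<integral>\<^sup>+x. ennreal (exp (- x\<^sup>2)) \<partial>lborel))"
    by (rule nn_integral_lborel_prod) auto
  also have "\<dots> = ennreal (sqrt pi ^ DIM('a))"
    by (simp add: 1 prod_ennreal ennreal_power)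
  finally show "(\<integral>\<^sup>+y. ennreal (exp (- (y \<bullet> y))) \<partial>(lborel :: 'a measure)) = ennreal (sqrt pi ^ DIM('a))" .
qed auto

definition gauss :: "'a::euclidean_space \<Rightarrow> real" where
  "gauss y = exp (- (y \<bullet> y)) / sqrt pi ^ DIM('a)"

lemma gauss_pos: "0 < gauss y"
  by (simp add: gauss_def)

lemma integrable_gauss [simp]: "integrable lborel (gauss :: 'a::euclidean_space \<Rightarrow> real)"
  and integral_gauss [simp]: "(\<integral>y. gauss y \<partial>(lborel :: 'a::euclidean_space measure)) = 1"
  using has_bochner_integral_gauss[where 'a='a] by (auto simp: gauss_def[abs_def] has_bochner_integral_iff)

lemma gauss_measurable [measurable]: "gauss \<in> borel_measurable borel"
  unfolding gauss_def[abs_def] by (intro borel_measurable_continuous_onI continuous_intros) simp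

lemma integrable_bounded_gauss:
  fixes h :: "'a::euclidean_space \<Rightarrow> real"
  assumes [measurable]: "h \<in> borel_measurable borel" and "\<And>y. \<bar>h y\<bar> \<le> C"
  shows "integrable lborel (\<lambda>y. h y * gauss y)"
proof (rule Bochner_Integration.integrable_bound[of lborel "\<lambda>y. C * gauss y"])
  show "AE x in lborel. norm (h x * gauss x) \<le> norm (C * gauss x)"
  proof (intro AE_I2)
    fix x
    have "\<bar>h x\<bar> * gauss x \<le> \<bar>C\<bar> * gauss x"
      using assms(2)[of x] gauss_pos[of x] by (intro mult_right_mono) auto
    then show "norm (h x * gauss x) \<le> norm (C * gauss x)"
      using gauss_pos[of x] by (simp add: abs_mult)
  qed
qed auto

lemma gauss_average_le:
  fixes h :: "'a::euclidean_space \<Rightarrow> real"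
  assumes "h \<in> borel_measurable borel" "\<And>y. \<bar>h y\<bar> \<le> C"
  shows "\<bar>\<integral>y. h y * gauss y \<partial>lborel\<bar> \<le> C"
proof -
  have "\<bar>\<integral>y. h y * gauss y \<partial>lborel\<bar> \<le> (\<integral>y. \<bar>h y * gauss y\<bar> \<partial>lborel)"
    by (rule integral_abs_bound)
  also have "\<dots> \<le> (\<integral>y. C * gauss y \<partial>(lborel :: 'a measure))"
  proof (rule Bochner_Integration.integral_mono)
    show "integrable lborel (\<lambda>y. \<bar>h y * gauss y\<bar>)"
      using integrable_bounded_gauss[OF assms] by simp
    show "\<bar>h y * gauss y\<bar> \<le> C * gauss y" for y
      using assms(2)[of y] gauss_pos[of y] by (simp add: abs_mult)
  qed simp
  finally show ?thesis by simp
qed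

lemma gauss_tail:
  assumes "0 < \<eta>"
  shows "\<exists>R>0. (\<integral>y. indicator {y :: 'a::euclidean_space. R < norm y} y * gauss y \<partial>lborel) < \<eta>"
proof -
  have "(\<lambda>k. \<integral>y. indicator {y :: 'a. real k < norm y} y * gauss y \<partial>lborel) \<longlonglongrightarrow> (\<integral>y. 0 \<partial>(lborel :: 'a measure))"
  proof (rule integral_dominated_convergence[where w = gauss])
    show "AE y in lborel. (\<lambda>k. indicator {y :: 'a. real k < norm y} y * gauss y) \<longlonglongrightarrow> 0"
    proof (intro AE_I2 tendsto_eventually)
      fix y :: 'a
      obtain k :: nat where "norm y \<le> real k" using real_arch_simple by blast
      then show "\<forall>\<^sub>F k in sequentially. indicator {y :: 'a. real k < norm y} y * gauss y = 0"
        by (intro eventually_sequentiallyI[of k]) (auto simp: indicator_def)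
    qed
    show "AE y in lborel. norm (indicator {y :: 'a. real k < norm y} y * gauss y) \<le> gauss y" for k
      using gauss_pos[THEN less_imp_le] by (intro AE_I2) (auto simp: indicator_def)
  qed auto
  then have "\<forall>\<^sub>F k in sequentially. (\<integral>y. indicator {y :: 'a. real k < norm y} y * gauss y \<partial>lborel) < \<eta>"
    using assms by (auto simp: order_tendsto_iff)
  then obtain k0 where k0: "\<And>k. k \<ge> k0 \<Longrightarrow> (\<integral>y. indicator {y :: 'a. real k < norm y} y * gauss y \<partial>lborel) < \<eta>"
    by (auto simp: eventually_sequentially)
  show ?thesis using k0[of "Suc k0"] by (intro exI[of _ "real (Suc k0)"]) (auto simp del: of_nat_Suc)
qed

definition supported :: "'a::euclidean_space set \<Rightarrow> ('a \<Rightarrow> real) \<Rightarrow> bool" where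
  "supported K g \<longleftrightarrow> compact K \<and> continuous_on UNIV g \<and> (\<forall>x. x \<notin> K \<longrightarrow> g x = 0)"

lemma supported_bounded:
  assumes "supported K g" shows "\<exists>C\<ge>0. \<forall>x. \<bar>g x\<bar> \<le> C"
  using Ck_bd_compact_support[of 0 g K] assms by (auto simp: supported_def)

lemma supported_measurable: "supported K g \<Longrightarrow> g \<in> borel_measurable borel"
  by (auto simp: supported_def intro: borel_measurable_continuous_onI)

lemma supported_integrable:
  assumes "supported K g" shows "integrable lborel g"
proof -
  have "integrable lborel (\<lambda>x. indicator K x *\<^sub>R g x)"
    using assms by (intro borel_integrable_compact) (auto simp: supported_def intro: continuous_on_subset)
  moreover have "(\<lambda>x. indicator K x *\<^sub>R g x) = g"
    using assms by (auto simp: supported_def indicator_def fun_eq_iff)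
  ultimately show ?thesis by (simp only:)
qed

lemma supported_uniform:
  assumes "supported K g" "0 < \<eta>"
  shows "\<exists>\<delta>>0. \<forall>x y. norm (x - y) < \<delta> \<longrightarrow> \<bar>g x - g y\<bar> < \<eta>"
proof -
  have K: "compact K" "\<And>x. x \<notin> K \<Longrightarrow> g x = 0" "continuous_on UNIV g" using assms by (auto simp: supported_def)
  obtain R where R: "\<And>x. x \<in> K \<Longrightarrow> norm x \<le> R" using compact_imp_bounded[OF K(1)] by (auto simp: bounded_iff)
  have "uniformly_continuous_on (cball 0 (R + 1)) g"
    by (intro compact_uniformly_continuous continuous_on_subset[OF K(3)]) auto
  then obtain \<delta> where \<delta>: "0 < \<delta>" "\<And>x y. \<lbrakk>x \<in> cball 0 (R + 1); y \<in> cball 0 (R + 1); dist y x < \<delta>\<rbrakk> \<Longrightarrow> dist (g y) (g x) < \<eta>"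
    using assms(2) unfolding uniformly_continuous_on_def by metis
  have "\<bar>g x - g y\<bar> < \<eta>" if xy: "norm (x - y) < min \<delta> 1" for x y
  proof (cases "x \<in> K \<or> y \<in> K")
    case True
    have "norm x \<le> norm (x - y) + norm y" "norm y \<le> norm (x - y) + norm x"
      using norm_triangle_sub[of x y] norm_triangle_sub[of y x] by (simp_all add: norm_minus_commute)
    then have "x \<in> cball 0 (R + 1)" "y \<in> cball 0 (R + 1)" using True R[of x] R[of y] xy by auto
    then show ?thesis using \<delta>(2)[of y x] xy by (simp add: dist_norm)
  next
    case False
    then show ?thesis using K(2) assms(2) by simp
  qed
  then show ?thesis using \<delta>(1) by (intro exI[of _ "min \<delta> 1"]) auto
qed

text \<open>In this form \<open>x\<close> enters through \<open>g\<close>, so derivatives fall on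
  \<open>g\<close> and errors are averages against a probability density. In the form of
  \<open>mollify_kernel\<close>, \<open>x\<close> enters through the Gaussian, which gives
  analyticity.\<close>

definition mollify :: "real \<Rightarrow> ('a \<Rightarrow> real) \<Rightarrow> 'a::euclidean_space \<Rightarrow> real" where
  "mollify \<epsilon> g x = (\<integral>y. g (x - \<epsilon> *\<^sub>R y) * gauss y \<partial>lborel)"

lemma mollify_integrable: "supported K g \<Longrightarrow> integrable lborel (\<lambda>y. g (x - \<epsilon> *\<^sub>R y) * gauss y)"
proof -
  assume g: "supported K g"
  then obtain C where "\<And>x. \<bar>g x\<bar> \<le> C" using supported_bounded by blast
  moreover have "(\<lambda>y. g (x - \<epsilon> *\<^sub>R y)) \<in> borel_measurable borel"
    using supported_measurable[OF g] by measurable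
  ultimately show ?thesis by (intro integrable_bounded_gauss)
qed

lemma continuous_mollify:
  assumes g: "supported K g" shows "continuous_on UNIV (mollify \<epsilon> g)"
  unfolding continuous_on_iff
proof (intro ballI allI impI)
  fix x and e :: real assume e: "0 < e"
  then have "0 < e / 2" by simp
  from supported_uniform[OF g this] obtain \<delta> where
    \<delta>: "0 < \<delta>" "\<And>x y. norm (x - y) < \<delta> \<Longrightarrow> \<bar>g x - g y\<bar> < e / 2" by blast
  have m [measurable]: "g \<in> borel_measurable borel" by (rule supported_measurable[OF g])
  have "dist (mollify \<epsilon> g x') (mollify \<epsilon> g x) < e" if "dist x' x < \<delta>" for x'
  proof -
    have "mollify \<epsilon> g x' - mollify \<epsilon> g x = (\<integral>y. (g (x' - \<epsilon> *\<^sub>R y) - g (x - \<epsilon> *\<^sub>R y)) * gauss y \<partial>lborel)"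
      unfolding mollify_def left_diff_distrib using mollify_integrable[OF g] by (intro Bochner_Integration.integral_diff[symmetric]) auto
    also have "\<bar>\<dots>\<bar> \<le> e / 2"
      by (rule gauss_average_le) (measurable, use \<delta>(2) that in \<open>auto simp: dist_norm intro!: less_imp_le\<close>)
    finally show ?thesis using e by (simp add: dist_norm)
  qed
  then show "\<exists>\<delta>>0. \<forall>x'\<in>UNIV. dist x' x < \<delta> \<longrightarrow> dist (mollify \<epsilon> g x') (mollify \<epsilon> g x) < e"
    using \<delta>(1) by blast
qed

lemma mvt_dir:
  fixes g g' :: "'a::euclidean_space \<Rightarrow> real"
  assumes "\<And>z. has_dir_deriv b g z (g' z)"
  shows "\<exists>s. \<bar>s\<bar> \<le> \<bar>t\<bar> \<and> g (z + t *\<^sub>R b) - g z = t * g' (z + s *\<^sub>R b)"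
proof -
  have d: "((\<lambda>t. g (z + t *\<^sub>R b)) has_real_derivative g' (z + s *\<^sub>R b)) (at s)" for s
    using has_dir_deriv_along[OF assms] by (simp add: has_real_derivative_iff_has_vector_derivative)
  consider "t = 0" | "0 < t" | "t < 0" by linarith
  then show ?thesis
  proof cases
    case 2
    from MVT2[OF this, of "\<lambda>t. g (z + t *\<^sub>R b)" "\<lambda>s. g' (z + s *\<^sub>R b)"] d show ?thesis by force
  next
    case 3
    from MVT2[OF this, of "\<lambda>t. g (z + t *\<^sub>R b)" "\<lambda>s. g' (z + s *\<^sub>R b)"] d
    obtain s where s: "t < s" "s < 0" "g (z + 0 *\<^sub>R b) - g (z + t *\<^sub>R b) = (0 - t) * g' (z + s *\<^sub>R b)" by blast
    then have "g (z + t *\<^sub>R b) - g z = t * g' (z + s *\<^sub>R b)" by simp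
    then show ?thesis using s by (intro exI[of _ s]) auto
  qed simp
qed

text \<open>By the mean value theorem and the uniform continuity of \<open>g'\<close>, the
  difference quotients of \<open>g\<close> converge uniformly; averaging preserves the
  bound.\<close>

lemma has_dir_deriv_mollify:
  assumes g: "supported K g" and g': "supported K' g'" and d: "\<And>z. has_dir_deriv b g z (g' z)" and b: "b \<in> Basis"
  shows "has_dir_deriv b (mollify \<epsilon> g) x (mollify \<epsilon> g' x)"
proof -
  have m [measurable]: "g \<in> borel_measurable borel" "g' \<in> borel_measurable borel"
    using supported_measurable g g' by auto
  let ?E = "\<lambda>t. mollify \<epsilon> g (x + t *\<^sub>R b) - mollify \<epsilon> g x - t * mollify \<epsilon> g' x"
  have "(?E has_vector_derivative 0) (at 0)"
  proof (rule has_vector_derivative_zeroI)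
    fix \<eta> :: real assume "0 < \<eta>"
    from supported_uniform[OF g' this] obtain \<delta> where
      \<delta>: "0 < \<delta>" "\<And>x y. norm (x - y) < \<delta> \<Longrightarrow> \<bar>g' x - g' y\<bar> < \<eta>" by blast
    have "\<bar>?E t\<bar> \<le> \<eta> * \<bar>t\<bar>" if t: "\<bar>t\<bar> < \<delta>" for t
    proof -
      have pt: "\<bar>g (z + t *\<^sub>R b) - g z - t * g' z\<bar> \<le> \<eta> * \<bar>t\<bar>" for z
      proof -
        obtain s where s: "\<bar>s\<bar> \<le> \<bar>t\<bar>" "g (z + t *\<^sub>R b) - g z = t * g' (z + s *\<^sub>R b)"
          using mvt_dir[OF d] by blast
        have "\<bar>g (z + t *\<^sub>R b) - g z - t * g' z\<bar> = \<bar>t\<bar> * \<bar>g' (z + s *\<^sub>R b) - g' z\<bar>"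
          by (simp add: s(2) abs_mult[symmetric] right_diff_distrib)
        also have "\<dots> \<le> \<bar>t\<bar> * \<eta>"
          using \<delta>(2)[of "z + s *\<^sub>R b" z] s t b by (intro mult_left_mono) auto
        finally show ?thesis by (simp add: mult.commute)
      qed
      have "?E t = (\<integral>y. (g ((x - \<epsilon> *\<^sub>R y) + t *\<^sub>R b) - g (x - \<epsilon> *\<^sub>R y) - t * g' (x - \<epsilon> *\<^sub>R y)) * gauss y \<partial>lborel)"
      proof -
        have "?E t = (\<integral>y. g (x + t *\<^sub>R b - \<epsilon> *\<^sub>R y) * gauss y - g (x - \<epsilon> *\<^sub>R y) * gauss y - t * (g' (x - \<epsilon> *\<^sub>R y) * gauss y) \<partial>lborel)"
          unfolding mollify_def using mollify_integrable[OF g] mollify_integrable[OF g'] by simp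
        also have "\<dots> = (\<integral>y. (g ((x - \<epsilon> *\<^sub>R y) + t *\<^sub>R b) - g (x - \<epsilon> *\<^sub>R y) - t * g' (x - \<epsilon> *\<^sub>R y)) * gauss y \<partial>lborel)"
          by (intro Bochner_Integration.integral_cong refl) (simp add: algebra_simps)
        finally show ?thesis .
      qed
      also have "\<bar>\<dots>\<bar> \<le> \<eta> * \<bar>t\<bar>"
        by (rule gauss_average_le) (measurable, rule pt)
      finally show ?thesis .
    qed
    then show "\<exists>\<delta>>0. \<forall>t. \<bar>t\<bar> < \<delta> \<longrightarrow> \<bar>?E t\<bar> \<le> \<eta> * \<bar>t\<bar>" using \<delta>(1) by blast
  qed simp
  moreover have "((\<lambda>t. mollify \<epsilon> g x + t * mollify \<epsilon> g' x) has_vector_derivative mollify \<epsilon> g' x) (at 0)"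
    by (auto intro!: derivative_eq_intros simp: has_real_derivative_iff_has_vector_derivative[symmetric])
  ultimately have "((\<lambda>t. ?E t + (mollify \<epsilon> g x + t * mollify \<epsilon> g' x)) has_vector_derivative 0 + mollify \<epsilon> g' x) (at 0)"
    by (rule has_vector_derivative_add)
  then show ?thesis by simp
qed

lemma supported_pderivs:
  assumes "\<And>n. Ck n UNIV g" "compact K" "\<And>x. x \<notin> K \<Longrightarrow> g x = 0" "set bs \<subseteq> Basis"
  shows "supported K (pderivs bs g)"
proof -
  have "pderivs bs g z = 0" if "z \<notin> K" for z
    by (rule pderivs_vanish[of "- K"]) (use assms that compact_imp_closed[OF assms(2)] in auto)
  then show ?thesis
    using Ck_continuous[OF Ck_pderivs[OF assms(1) assms(4) order_refl]] assms by (auto simp: supported_def)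
qed

lemma Ck_mollify:
  assumes "\<And>n. Ck n UNIV g" "compact K" "\<And>x. x \<notin> K \<Longrightarrow> g x = 0"
  shows "Ck n UNIV (mollify \<epsilon> g)" "set bs \<subseteq> Basis \<Longrightarrow> pderivs bs (mollify \<epsilon> g) = mollify \<epsilon> (pderivs bs g)"
proof -
  have sp: "supported K (pderivs bs g)" if "set bs \<subseteq> Basis" for bs
    by (rule supported_pderivs) (use assms that in auto)
  have d: "has_dir_deriv b (mollify \<epsilon> (pderivs bs g)) z (mollify \<epsilon> (pderivs (b # bs) g) z)"
    if "set bs \<subseteq> Basis" "b \<in> Basis" for bs b z
  proof (rule has_dir_deriv_mollify[OF sp[OF that(1)] sp[of "b # bs"]])
    show "has_dir_deriv b (pderivs bs g) z (pderivs (b # bs) g z)" for z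
      using Ck_has_dir_deriv[OF Ck_pderivs[OF assms(1) that(1), of "Suc (length bs)"]] that by simp
  qed (use that in auto)
  have F: "Ck n UNIV (mollify \<epsilon> (pderivs [] g))" "set bs \<subseteq> Basis \<Longrightarrow> length bs \<le> n \<Longrightarrow> pderivs bs (mollify \<epsilon> (pderivs [] g)) = mollify \<epsilon> (pderivs bs g)" for n bs
    using Ck_family[of n "\<lambda>bs. mollify \<epsilon> (pderivs bs g)"] continuous_mollify[OF sp] d by blast+
  show "Ck n UNIV (mollify \<epsilon> g)" using F(1) by simp
  show "pderivs bs (mollify \<epsilon> g) = mollify \<epsilon> (pderivs bs g)" if "set bs \<subseteq> Basis"
    using F(2)[OF that order_refl] by simp
qed

lemma mollify_close:
  assumes g: "supported K g" and \<eta>: "0 < \<eta>"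
  shows "\<forall>\<^sub>F \<epsilon> in at_right 0. \<forall>x. \<bar>mollify \<epsilon> g x - g x\<bar> \<le> \<eta>"
proof -
  obtain C where C: "0 \<le> C" "\<And>x. \<bar>g x\<bar> \<le> C" using supported_bounded[OF g] by blast
  have "0 < \<eta> / 2" using \<eta> by simp
  from supported_uniform[OF g this] obtain \<delta> where
    \<delta>: "0 < \<delta>" "\<And>x y. norm (x - y) < \<delta> \<Longrightarrow> \<bar>g x - g y\<bar> < \<eta> / 2" by blast
  \<comment> \<open>For \<open>norm y \<le> R\<close> a small \<epsilon> keeps the displacement
    below \<delta>, at a cost of at most half of \<eta>; beyond \<open>R\<close> the values differ
    by at most 2 C, so the tail mass contributes at most the other half.\<close>
  have "0 < \<eta> / (4 * (C + 1))" using \<eta> C by simp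
  from gauss_tail[where 'a='a, OF this] obtain R where
    R: "0 < R" "(\<integral>y. indicator {y :: 'a. R < norm y} y * gauss y \<partial>lborel) < \<eta> / (4 * (C + 1))" by blast
  have m [measurable]: "g \<in> borel_measurable borel" by (rule supported_measurable[OF g])
  have "\<bar>mollify \<epsilon> g x - g x\<bar> \<le> \<eta>" if \<epsilon>: "0 < \<epsilon>" "\<epsilon> < \<delta> / R" for \<epsilon> x
  proof -
    have it: "integrable lborel (\<lambda>y. indicator {y :: 'a. R < norm y} y * gauss y)"
      by (rule integrable_bounded_gauss[of _ 1]) (auto simp: indicator_def)
    have ic: "integrable lborel (\<lambda>y. (g (x - \<epsilon> *\<^sub>R y) - g x) * gauss y)"
      unfolding left_diff_distrib using mollify_integrable[OF g] by (intro Bochner_Integration.integrable_diff) auto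
    have eq: "mollify \<epsilon> g x - g x = (\<integral>y. (g (x - \<epsilon> *\<^sub>R y) - g x) * gauss y \<partial>lborel)"
      unfolding mollify_def left_diff_distrib using mollify_integrable[OF g] by simp
    have "\<bar>mollify \<epsilon> g x - g x\<bar> \<le> (\<integral>y. \<bar>(g (x - \<epsilon> *\<^sub>R y) - g x) * gauss y\<bar> \<partial>lborel)"
      unfolding eq by (rule integral_abs_bound)
    also have "\<dots> \<le> (\<integral>y. \<eta> / 2 * gauss y + 2 * C * (indicator {y :: 'a. R < norm y} y * gauss y) \<partial>lborel)"
    proof (rule Bochner_Integration.integral_mono)
      show "integrable lborel (\<lambda>y. \<bar>(g (x - \<epsilon> *\<^sub>R y) - g x) * gauss y\<bar>)" using ic by simp
      show "integrable lborel (\<lambda>y. \<eta> / 2 * gauss y + 2 * C * (indicator {y :: 'a. R < norm y} y * gauss y))"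
        using it by simp
      fix y :: 'a
      have "\<bar>g (x - \<epsilon> *\<^sub>R y) - g x\<bar> \<le> \<eta> / 2 + 2 * C * indicator {y :: 'a. R < norm y} y"
      proof (cases "R < norm y")
        case True
        then show ?thesis using C(2)[of "x - \<epsilon> *\<^sub>R y"] C(2)[of x] \<eta> by auto
      next
        case False
        have "\<epsilon> * norm y \<le> \<epsilon> * R" using False \<epsilon> by simp
        also have "\<dots> < \<delta>" using \<epsilon> R by (simp add: field_simps)
        finally show ?thesis using \<delta>(2)[of "x - \<epsilon> *\<^sub>R y" x] \<epsilon> False by simp
      qed
      then have "\<bar>g (x - \<epsilon> *\<^sub>R y) - g x\<bar> * gauss y \<le> (\<eta> / 2 + 2 * C * indicator {y :: 'a. R < norm y} y) * gauss y"
        using gauss_pos[of y] by (intro mult_right_mono) auto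
      moreover have "\<bar>(g (x - \<epsilon> *\<^sub>R y) - g x) * gauss y\<bar> = \<bar>g (x - \<epsilon> *\<^sub>R y) - g x\<bar> * gauss y"
        using gauss_pos[of y] by (simp only: abs_mult abs_of_pos)
      moreover have "(\<eta> / 2 + 2 * C * indicator {y :: 'a. R < norm y} y) * gauss y
          = \<eta> / 2 * gauss y + 2 * C * (indicator {y :: 'a. R < norm y} y * gauss y)"
        by (simp add: algebra_simps)
      ultimately show "\<bar>(g (x - \<epsilon> *\<^sub>R y) - g x) * gauss y\<bar> \<le> \<eta> / 2 * gauss y + 2 * C * (indicator {y :: 'a. R < norm y} y * gauss y)"
        by (simp only:)
    qed
    also have "\<dots> = \<eta> / 2 + 2 * C * (\<integral>y. indicator {y :: 'a. R < norm y} y * gauss y \<partial>lborel)"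
      using it by simp
    also have "\<dots> \<le> \<eta> / 2 + 2 * (C + 1) * (\<eta> / (4 * (C + 1)))"
    proof -
      have "0 \<le> (\<integral>y. indicator {y :: 'a. R < norm y} y * gauss y \<partial>lborel)"
        by (intro integral_nonneg_AE AE_I2 mult_nonneg_nonneg less_imp_le[OF gauss_pos]) simp
      then show ?thesis using R(2) C by (intro add_left_mono mult_mono) auto
    qed
    also have "\<dots> = \<eta>" using C by (simp add: field_simps)
    finally show ?thesis .
  qed
  then show ?thesis using \<delta>(1) R(1)
    by (intro eventually_at_rightI[of 0 "\<delta> / R"]) auto
qed

lemma mollify_kernel:
  fixes x :: "'a::euclidean_space"
  assumes g: "supported K g" and \<epsilon>: "0 < \<epsilon>"
  shows "mollify \<epsilon> g x = (\<integral>y. g y * gauss ((x - y) /\<^sub>R \<epsilon>) \<partial>lborel) / \<epsilon> ^ DIM('a)"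
proof -
  have m [measurable]: "g \<in> borel_measurable borel" by (rule supported_measurable[OF g])
  let ?f = "\<lambda>y. g y * gauss ((x - y) /\<^sub>R \<epsilon>)" and ?T = "\<lambda>y. x + (- \<epsilon>) *\<^sub>R y"
  have "(\<integral>y. ?f y \<partial>lborel) = (\<integral>y. ?f y \<partial>(density (distr lborel borel ?T) (\<lambda>_. ennreal (\<bar>- \<epsilon>\<bar> ^ DIM('a)))))"
    using arg_cong[OF lborel_affine[of "- \<epsilon>" x], of "\<lambda>M. \<integral>y. ?f y \<partial>M"] \<epsilon> by (simp add: ennreal_power)
  also have "\<dots> = (\<integral>y. \<epsilon> ^ DIM('a) *\<^sub>R ?f (?T y) \<partial>lborel)"
    using \<epsilon> by (subst integral_density) (auto simp: integral_distr)
  also have "\<dots> = \<epsilon> ^ DIM('a) * (\<integral>y. ?f (?T y) \<partial>lborel)" by simp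
  also have "(\<lambda>y. ?f (?T y)) = (\<lambda>y. g (x - \<epsilon> *\<^sub>R y) * gauss y)" using \<epsilon> by simp
  finally show ?thesis using \<epsilon> by (simp add: mollify_def)
qed

section \<open>Mollified functions are entire\<close>

lemma sum_prod_blists: "(\<Sum>bs\<in>blists q. \<Prod>b\<leftarrow>bs. \<phi> b) = (\<Sum>b\<in>Basis. \<phi> b) ^ q"
  for \<phi> :: "'a::euclidean_space \<Rightarrow> real"
proof (induction q)
  case (Suc q)
  have "(\<Sum>bs\<in>blists (Suc q). \<Prod>b\<leftarrow>bs. \<phi> b) = (\<Sum>(b, bs)\<in>Basis \<times> blists q. \<phi> b * (\<Prod>b\<leftarrow>bs. \<phi> b))"
    by (rule sum.reindex_bij_witness[of _ "\<lambda>(b, bs). b # bs" "\<lambda>bs. (hd bs, tl bs)"])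
      (auto simp: length_Suc_conv)
  also have "\<dots> = (\<Sum>b\<in>Basis. \<phi> b) * (\<Sum>bs\<in>blists q. \<Prod>b\<leftarrow>bs. \<phi> b)"
    by (simp add: sum.cartesian_product[symmetric] sum_product)
  finally show ?case using Suc by simp
qed (simp add: blists_0[simplified])

text \<open>The multinomial expansion of a power of the inner product; since the indices are lists,
  repetition replaces the multinomial coefficients.\<close>

lemma sum_lmono_mult: "(\<Sum>bs\<in>blists q. lmono bs v * lmono bs t) = (t \<bullet> v) ^ q"
proof -
  have "lmono bs v * lmono bs t = (\<Prod>b\<leftarrow>bs. (t \<bullet> b) * (v \<bullet> b))" for bs
    by (induction bs) (auto simp: mult_ac)
  then show ?thesis using sum_prod_blists[of "\<lambda>b. (t \<bullet> b) * (v \<bullet> b)" q] by (simp add: euclidean_inner[of t v])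
qed

lemma sum_abs_lmono: "(\<Sum>bs\<in>blists q. \<bar>lmono bs v\<bar>) = (\<Sum>b\<in>Basis. \<bar>v \<bullet> b\<bar>) ^ q"
proof -
  have "\<bar>lmono bs v\<bar> = (\<Prod>b\<leftarrow>bs. \<bar>v \<bullet> b\<bar>)" for bs
    by (induction bs) (auto simp: abs_mult)
  then show ?thesis using sum_prod_blists[of "\<lambda>b. \<bar>v \<bullet> b\<bar>" q] by simp
qed

lemma continuous_lmono: "continuous_on U v \<Longrightarrow> continuous_on U (\<lambda>y. lmono bs (v y))"
  by (induction bs) (auto intro!: continuous_intros)

lemma supported_mult:
  "supported K w \<Longrightarrow> continuous_on UNIV h \<Longrightarrow> supported K (\<lambda>y. w y * h y)"
  by (auto simp: supported_def intro: continuous_on_mult)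

lemma supported_abs: "supported K w \<Longrightarrow> supported K (\<lambda>y. \<bar>w y\<bar>)"
  by (auto simp: supported_def intro: continuous_on_rabs)

text \<open>Expands the exponential under the integral. Since
  \<open>s ^ q / q! \<le> exp (r * s) / r ^ q\<close>, every \<open>r\<close> gives a rate
  \<open>1 / r\<close>, at the price of an exponential moment in the bound: the function is
  entire.\<close>

lemma analytic_exp_integral:
  fixes v :: "'a::euclidean_space \<Rightarrow> 'a"
  assumes w: "supported K w" and v: "continuous_on UNIV v" and r: "0 < r"
  shows "analytic 0 (\<integral>y. \<bar>w y\<bar> * exp (r * (\<Sum>b\<in>Basis. \<bar>v y \<bullet> b\<bar>)) \<partial>lborel) (1 / r) (\<lambda>t. \<integral>y. w y * exp (t \<bullet> v y) \<partial>lborel)"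
proof -
  define s where "s = (\<lambda>y. \<Sum>b\<in>Basis. \<bar>v y \<bullet> b\<bar>)"
  have cs: "continuous_on UNIV s" unfolding s_def by (intro continuous_intros v)
  have s0: "0 \<le> s y" for y unfolding s_def by (intro sum_nonneg) auto
  define B where "B = (\<integral>y. \<bar>w y\<bar> * exp (r * s y) \<partial>lborel)"
  have iB: "integrable lborel (\<lambda>y. \<bar>w y\<bar> * exp (r * s y))"
    by (intro supported_integrable[OF supported_mult[OF supported_abs[OF w]]] continuous_intros cs)
  define p where "p = (\<lambda>q t. \<integral>y. w y * ((t \<bullet> v y) ^ q / fact q) \<partial>lborel)"
  have sle: "s y ^ q / fact q \<le> exp (r * s y) * (1 / r) ^ q" for y q
    using power_le_fact_exp[of "r * s y" q] s0[of y] r by (simp add: field_simps power_mult_distrib)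
  have il: "integrable lborel (\<lambda>y. w y * (lmono bs (v y) / fact q))" for bs q
    by (intro supported_integrable[OF supported_mult[OF w]] continuous_intros continuous_lmono v) auto
  have "hpoly q (B * (1 / r) ^ q) (p q)" for q
  proof (rule hpolyI[where c = "\<lambda>bs. \<integral>y. w y * (lmono bs (v y) / fact q) \<partial>lborel"])
    have "(\<Sum>bs\<in>blists q. \<bar>\<integral>y. w y * (lmono bs (v y) / fact q) \<partial>lborel\<bar>)
        \<le> (\<Sum>bs\<in>blists q. \<integral>y. \<bar>w y * (lmono bs (v y) / fact q)\<bar> \<partial>lborel)"
      by (intro sum_mono integral_abs_bound)
    also have "\<dots> = (\<integral>y. (\<Sum>bs\<in>blists q. \<bar>w y * (lmono bs (v y) / fact q)\<bar>) \<partial>lborel)"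
      by (intro Bochner_Integration.integral_sum[symmetric] Bochner_Integration.integrable_abs il)
    also have "\<dots> = (\<integral>y. \<bar>w y\<bar> * (s y ^ q / fact q) \<partial>lborel)"
      by (intro Bochner_Integration.integral_cong refl)
        (simp add: abs_mult s_def sum_abs_lmono[symmetric] sum_distrib_left sum_divide_distrib)
    also have "\<dots> \<le> (\<integral>y. \<bar>w y\<bar> * exp (r * s y) * (1 / r) ^ q \<partial>lborel)"
    proof (rule Bochner_Integration.integral_mono)
      show "integrable lborel (\<lambda>y. \<bar>w y\<bar> * (s y ^ q / fact q))"
        by (intro supported_integrable[OF supported_mult[OF supported_abs[OF w]]] continuous_intros cs) auto
      show "\<bar>w y\<bar> * (s y ^ q / fact q) \<le> \<bar>w y\<bar> * exp (r * s y) * (1 / r) ^ q" for y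
        unfolding mult.assoc by (intro mult_left_mono sle) auto
    qed (use iB in simp)
    also have "\<dots> = B * (1 / r) ^ q" by (simp add: B_def)
    finally show "(\<Sum>bs\<in>blists q. \<bar>\<integral>y. w y * (lmono bs (v y) / fact q) \<partial>lborel\<bar>) \<le> B * (1 / r) ^ q" .
    fix t
    have "(\<Sum>bs\<in>blists q. (\<integral>y. w y * (lmono bs (v y) / fact q) \<partial>lborel) * lmono bs t)
        = (\<Sum>bs\<in>blists q. \<integral>y. w y * (lmono bs (v y) / fact q) * lmono bs t \<partial>lborel)"
      by (simp only: integral_mult_left_zero)
    also have "\<dots> = (\<integral>y. (\<Sum>bs\<in>blists q. w y * (lmono bs (v y) / fact q) * lmono bs t) \<partial>lborel)"
      by (intro Bochner_Integration.integral_sum[symmetric] Bochner_Integration.integrable_mult_left il)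
    also have "\<dots> = p q t"
      unfolding p_def sum_lmono_mult[symmetric]
      by (intro Bochner_Integration.integral_cong refl) (simp add: sum_distrib_left sum_divide_distrib mult.assoc)
    finally show "p q t = (\<Sum>bs\<in>blists q. (\<integral>y. w y * (lmono bs (v y) / fact q) \<partial>lborel) * lmono bs t)" by simp
  qed
  moreover have "(\<lambda>q. p q t) sums (\<integral>y. w y * exp (t \<bullet> v y) \<partial>lborel)" if t: "1 / r * norm t < 1" for t
  proof -
    let ?f = "\<lambda>q y. w y * ((t \<bullet> v y) ^ q / fact q)"
    have if': "integrable lborel (?f q)" for q
      by (intro supported_integrable[OF supported_mult[OF w]] continuous_intros v) auto
    have nt: "\<bar>t \<bullet> v y\<bar> \<le> norm t * s y" for y
    proof -
      have "\<bar>t \<bullet> v y\<bar> \<le> norm t * norm (v y)" by (rule Cauchy_Schwarz_ineq2)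
      also have "\<dots> \<le> norm t * s y" unfolding s_def by (intro mult_left_mono norm_le_l1) auto
      finally show ?thesis .
    qed
    have fb: "norm (?f q y) \<le> \<bar>w y\<bar> * exp (r * s y) * (1 / r * norm t) ^ q" for q y
    proof -
      have "\<bar>t \<bullet> v y\<bar> ^ q / fact q \<le> (norm t * s y) ^ q / fact q"
        using nt by (intro divide_right_mono power_mono) auto
      also have "\<dots> = norm t ^ q * (s y ^ q / fact q)" by (simp add: power_mult_distrib)
      also have "\<dots> \<le> norm t ^ q * (exp (r * s y) * (1 / r) ^ q)" by (intro mult_left_mono sle) auto
      also have "\<dots> = exp (r * s y) * (1 / r * norm t) ^ q" by (simp only: power_mult_distrib mult_ac)
      finally have "\<bar>w y\<bar> * (\<bar>t \<bullet> v y\<bar> ^ q / fact q) \<le> \<bar>w y\<bar> * (exp (r * s y) * (1 / r * norm t) ^ q)"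
        by (intro mult_left_mono) auto
      then show ?thesis by (simp only: real_norm_def abs_mult abs_divide power_abs abs_of_nonneg[OF fact_ge_zero] mult.assoc)
    qed
    have geo: "summable (\<lambda>q. (1 / r * norm t) ^ q)" using t r by (intro summable_geometric) simp
    have "(\<lambda>q. \<integral>y. ?f q y \<partial>lborel) sums (\<integral>y. (\<Sum>q. ?f q y) \<partial>lborel)"
    proof (rule sums_integral[OF if'])
      show "AE y in lborel. summable (\<lambda>q. norm (?f q y))"
        by (intro AE_I2 summable_comparison_test'[where N = 0, OF summable_mult[OF geo]]) (use fb in simp)
      show "summable (\<lambda>q. \<integral>y. norm (?f q y) \<partial>lborel)"
      proof (rule summable_comparison_test'[where N = 0, OF summable_mult[OF geo, of B]])
        fix q
        have "(\<integral>y. norm (?f q y) \<partial>lborel) \<le> (\<integral>y. \<bar>w y\<bar> * exp (r * s y) * (1 / r * norm t) ^ q \<partial>lborel)"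
          by (intro Bochner_Integration.integral_mono Bochner_Integration.integrable_norm
              Bochner_Integration.integrable_mult_left if' iB fb)
        also have "\<dots> = B * (1 / r * norm t) ^ q" unfolding B_def by simp
        finally show "norm (\<integral>y. norm (?f q y) \<partial>lborel) \<le> B * (1 / r * norm t) ^ q" by simp
      qed
    qed
    moreover have "(\<Sum>q. ?f q y) = w y * exp (t \<bullet> v y)" for y
    proof -
      have "(\<lambda>q. (t \<bullet> v y) ^ q / fact q) sums exp (t \<bullet> v y)"
        using exp_converges[of "t \<bullet> v y"] by (simp add: divide_inverse mult.commute)
      from sums_mult[OF this, of "w y"] show ?thesis by (simp add: sums_iff)
    qed
    ultimately show ?thesis by (simp add: p_def)
  qed
  ultimately show ?thesis
    unfolding analytic_def B_def s_def using r by (intro conjI exI[of _ p] allI impI) simp_all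
qed

text \<open>The same trade-off between rate and bound:
  \<open>(l * n) ^ j / j! \<le> exp (l * n * r^2) / r ^ (2 * j)\<close>, where n is the dimension
  and also the coefficient norm of \<open>t \<bullet> t\<close>.\<close>

lemma analytic_gaussian:
  fixes l r :: real
  assumes "0 \<le> l" "0 < r"
  shows "analytic 0 (exp (l * (DIM('a) * r\<^sup>2))) (1 / r) (\<lambda>t::'a::euclidean_space. exp (- l * (t \<bullet> t)))"
proof -
  define p where "p = (\<lambda>q (t::'a). if even q then (- l * (t \<bullet> t)) ^ (q div 2) / fact (q div 2) else 0)"
  have "hpoly 2 (\<Sum>b\<in>(Basis :: 'a set). 1) (\<lambda>t::'a. \<Sum>b\<in>Basis. (t \<bullet> b) * (t \<bullet> b))"
  proof (rule hpoly_sum)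
    fix b :: 'a assume b: "b \<in> Basis"
    have "(\<Sum>c\<in>(Basis :: 'a set). \<bar>b \<bullet> c\<bar>) = (\<Sum>c\<in>(Basis :: 'a set). if c = b then 1 else 0)"
      using b by (intro sum.cong) (auto simp: inner_Basis)
    also have "\<dots> = 1" using b by simp
    finally have "hpoly 1 1 (\<lambda>t::'a. t \<bullet> b)" using hpoly_inner[of b] by simp
    from hpoly_mult[OF this this] show "hpoly 2 1 (\<lambda>t::'a. (t \<bullet> b) * (t \<bullet> b))" by (simp add: numeral_2_eq_2)
  qed
  then have h2: "hpoly 2 (DIM('a)) (\<lambda>t::'a. t \<bullet> t)" by (simp add: euclidean_inner[symmetric])
  have "hpoly q (exp (l * (DIM('a) * r\<^sup>2)) * (1 / r) ^ q) (p q)" for q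
  proof (cases "even q")
    case True
    then obtain j where j: "q = 2 * j" by blast
    have "hpoly q (\<bar>1 / fact j\<bar> * (\<bar>- l\<bar> * DIM('a)) ^ j) (\<lambda>t::'a. (1 / fact j) * (- l * (t \<bullet> t)) ^ j)"
      unfolding j by (intro hpoly_cmult hpoly_power h2)
    moreover have "\<bar>1 / fact j\<bar> * (\<bar>- l\<bar> * DIM('a)) ^ j \<le> exp (l * (DIM('a) * r\<^sup>2)) * (1 / r) ^ q"
    proof -
      have "(l * (DIM('a) * r\<^sup>2)) ^ j \<le> fact j * exp (l * (DIM('a) * r\<^sup>2))"
        using assms by (intro power_le_fact_exp) auto
      then show ?thesis using assms unfolding j
        by (simp add: field_simps power_mult_distrib power_mult[symmetric])
    qed
    ultimately have "hpoly q (exp (l * (DIM('a) * r\<^sup>2)) * (1 / r) ^ q) (\<lambda>t::'a. (1 / fact j) * (- l * (t \<bullet> t)) ^ j)"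
      by (rule hpoly_weaken)
    then show ?thesis using j by (simp add: p_def)
  next
    case False
    then show ?thesis using assms by (auto simp: p_def intro!: hpoly_zero)
  qed
  moreover have "(\<lambda>q. p q t) sums exp (- l * (t \<bullet> t))" for t
  proof -
    have "(\<lambda>j. p (2 * j) t) sums exp (- l * (t \<bullet> t))"
      using exp_converges[of "- l * (t \<bullet> t)"] by (simp add: p_def divide_inverse mult.commute)
    moreover have "p q t = 0" if "q \<notin> range (\<lambda>j. 2 * j)" for q
      using that by (auto simp: p_def elim!: evenE)
    ultimately show ?thesis
      using sums_mono_reindex[of "\<lambda>j. 2 * j" "\<lambda>q. p q t"] by (simp add: strict_mono_def)
  qed
  ultimately show ?thesis unfolding analytic_def using assms by (intro conjI exI[of _ p] allI impI) auto
qed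

lemma analytic_shift: "analytic 0 B K h \<Longrightarrow> analytic \<xi> B K (\<lambda>x. h (x - \<xi>))"
  by (simp add: analytic_def)

text \<open>With the expansion centred at \<xi>, the kernel \<open>exp (- l * |x - y|^2)\<close> is
  the product of a Gaussian in x - \<xi>, the exponential of a linear form in x - \<xi>, and the
  constant \<open>exp (- l * |\<xi> - y|^2)\<close>. The last factor stays inside the bound; it is
  what makes the bound small far from the support.\<close>

lemma analytic_mollify:
  fixes \<xi> :: "'a::euclidean_space" and \<epsilon> r l c :: real
  assumes g: "supported K g" and \<epsilon>: "0 < \<epsilon>" and r: "0 < r"
  assumes l_def: "l = 1 / \<epsilon>\<^sup>2" and c_def: "c = 1 / (sqrt pi * \<epsilon>) ^ DIM('a)"
  shows "analytic \<xi> (exp (l * (DIM('a) * r\<^sup>2)) *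
      (\<integral>y. c * \<bar>g y\<bar> * exp (- l * (norm (\<xi> - y))\<^sup>2 + r * (2 * l * (\<Sum>b\<in>Basis. \<bar>(y - \<xi>) \<bullet> b\<bar>))) \<partial>lborel)) (2 / r) (mollify \<epsilon> g)"
proof -
  have l: "0 < l" and c: "0 < c" using \<epsilon> by (simp_all add: l_def c_def)
  define w where "w = (\<lambda>y. g y * (c * exp (- l * (norm (\<xi> - y))\<^sup>2)))"
  define v where "v = (\<lambda>y. (2 * l) *\<^sub>R (y - \<xi>))"
  have w: "supported K w" unfolding w_def by (intro supported_mult g continuous_intros)
  have v: "continuous_on UNIV v" unfolding v_def by (intro continuous_intros)
  have sv: "(\<Sum>b\<in>Basis. \<bar>v y \<bullet> b\<bar>) = 2 * l * (\<Sum>b\<in>Basis. \<bar>(y - \<xi>) \<bullet> b\<bar>)" for y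
    using l by (simp add: v_def abs_mult sum_distrib_left)
  have "analytic \<xi> (exp (l * (DIM('a) * r\<^sup>2)) * (\<integral>y. \<bar>w y\<bar> * exp (r * (\<Sum>b\<in>Basis. \<bar>v y \<bullet> b\<bar>)) \<partial>lborel)) (2 * (1 / r))
      (\<lambda>x. exp (- l * ((x - \<xi>) \<bullet> (x - \<xi>))) * (\<integral>y. w y * exp ((x - \<xi>) \<bullet> v y) \<partial>lborel))"
    using analytic_mult[OF analytic_shift[OF analytic_gaussian[of l r]] analytic_shift[OF analytic_exp_integral[OF w v r]]] l r by simp
  moreover have "(\<integral>y. \<bar>w y\<bar> * exp (r * (\<Sum>b\<in>Basis. \<bar>v y \<bullet> b\<bar>)) \<partial>lborel) =
      (\<integral>y. c * \<bar>g y\<bar> * exp (- l * (norm (\<xi> - y))\<^sup>2 + r * (2 * l * (\<Sum>b\<in>Basis. \<bar>(y - \<xi>) \<bullet> b\<bar>))) \<partial>lborel)"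
    unfolding sv w_def exp_add using c by (intro Bochner_Integration.integral_cong refl) (simp add: abs_mult mult_ac)
  moreover have "exp (- l * ((x - \<xi>) \<bullet> (x - \<xi>))) * (\<integral>y. w y * exp ((x - \<xi>) \<bullet> v y) \<partial>lborel) = mollify \<epsilon> g x" for x
  proof -
    have e: "exp (- l * ((x - \<xi>) \<bullet> (x - \<xi>))) * (exp (- l * (norm (\<xi> - y))\<^sup>2) * exp ((x - \<xi>) \<bullet> v y)) = exp (- (((x - y) /\<^sub>R \<epsilon>) \<bullet> ((x - y) /\<^sub>R \<epsilon>)))" for y
    proof -
      define u where "u = x - \<xi>"
      define u' where "u' = y - \<xi>"
      have "x - y = u - u'" "norm (\<xi> - y) = norm u'" by (simp_all add: u_def u'_def norm_minus_commute)
      then have "(x - y) \<bullet> (x - y) = u \<bullet> u + (norm (\<xi> - y))\<^sup>2 - 2 * (u \<bullet> u')"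
        by (simp add: power2_norm_eq_inner inner_diff_left inner_diff_right inner_commute[of u' u])
      moreover have "- (((x - y) /\<^sub>R \<epsilon>) \<bullet> ((x - y) /\<^sub>R \<epsilon>)) = - l * ((x - y) \<bullet> (x - y))"
        by (simp add: l_def power2_eq_square divide_inverse)
      moreover have "(x - \<xi>) \<bullet> v y = 2 * l * (u \<bullet> u')" by (simp add: v_def u_def u'_def)
      ultimately have "- (((x - y) /\<^sub>R \<epsilon>) \<bullet> ((x - y) /\<^sub>R \<epsilon>)) = - l * ((x - \<xi>) \<bullet> (x - \<xi>)) + (- l * (norm (\<xi> - y))\<^sup>2 + (x - \<xi>) \<bullet> v y)"
        unfolding u_def[symmetric] by (simp add: right_diff_distrib distrib_left)
      then show ?thesis by (simp only: exp_add)
    qed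
    have "exp (- l * ((x - \<xi>) \<bullet> (x - \<xi>))) * (\<integral>y. w y * exp ((x - \<xi>) \<bullet> v y) \<partial>lborel)
        = (\<integral>y. g y * c * (exp (- l * ((x - \<xi>) \<bullet> (x - \<xi>))) * (exp (- l * (norm (\<xi> - y))\<^sup>2) * exp ((x - \<xi>) \<bullet> v y))) \<partial>lborel)"
      unfolding w_def by (subst integral_mult_right_zero[symmetric]) (simp only: mult_ac)
    also have "\<dots> = (\<integral>y. g y * gauss ((x - y) /\<^sub>R \<epsilon>) / \<epsilon> ^ DIM('a) \<partial>lborel)"
      unfolding e gauss_def c_def by (simp add: power_mult_distrib mult_ac)
    also have "\<dots> = mollify \<epsilon> g x" unfolding mollify_kernel[OF g \<epsilon>] by simp
    finally show ?thesis .
  qed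
  ultimately show ?thesis by simp
qed

text \<open>\<open>power_le_fact_exp\<close> at \<open>a / \<epsilon>^2\<close> bounds the
  exponential by a multiple of \<open>\<epsilon> ^ (2 * n)\<close>, which leaves
  \<open>\<epsilon> ^ n\<close> after the division.\<close>

lemma power_exp_small:
  fixes a c \<eta> :: real
  assumes "0 < a" "0 < \<eta>" "0 < n"
  shows "\<forall>\<^sub>F \<epsilon> in at_right 0. c / \<epsilon> ^ n * exp (- a / \<epsilon>\<^sup>2) \<le> \<eta>"
proof -
  define A where "A = \<bar>c\<bar> * fact n / a ^ n"
  have A: "0 \<le> A" using assms by (simp add: A_def)
  have "c / \<epsilon> ^ n * exp (- a / \<epsilon>\<^sup>2) \<le> \<eta>" if \<epsilon>: "0 < \<epsilon>" "\<epsilon> < min 1 (\<eta> / (A + 1))" for \<epsilon>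
  proof -
    have "(a / \<epsilon>\<^sup>2) ^ n \<le> fact n * exp (a / \<epsilon>\<^sup>2)" using assms by (intro power_le_fact_exp) auto
    then have "exp (- a / \<epsilon>\<^sup>2) \<le> fact n * (\<epsilon> ^ n * \<epsilon> ^ n) / a ^ n"
      using assms \<epsilon> by (simp add: exp_minus field_simps power_divide power_mult[symmetric] power_add[symmetric] mult_2_right)
    then have "\<bar>c\<bar> / \<epsilon> ^ n * exp (- a / \<epsilon>\<^sup>2) \<le> \<bar>c\<bar> / \<epsilon> ^ n * (fact n * (\<epsilon> ^ n * \<epsilon> ^ n) / a ^ n)"
      using \<epsilon> by (intro mult_left_mono) auto
    also have "\<dots> = A * \<epsilon> ^ n" using \<epsilon> by (simp add: A_def)
    also have "\<dots> \<le> A * \<epsilon> ^ 1" using \<epsilon> A assms by (intro mult_left_mono power_decreasing) auto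
    also have "\<dots> \<le> (A + 1) * \<epsilon>" using \<epsilon> by simp
    also have "\<dots> \<le> \<eta>" using \<epsilon> A by (simp add: field_simps)
    finally have "\<bar>c\<bar> / \<epsilon> ^ n * exp (- a / \<epsilon>\<^sup>2) \<le> \<eta>" .
    moreover have "c / \<epsilon> ^ n * exp (- a / \<epsilon>\<^sup>2) \<le> \<bar>c\<bar> / \<epsilon> ^ n * exp (- a / \<epsilon>\<^sup>2)"
      using \<epsilon> by (intro mult_right_mono divide_right_mono) auto
    ultimately show ?thesis by linarith
  qed
  then show ?thesis using assms A by (intro eventually_at_rightI[of 0 "min 1 (\<eta> / (A + 1))"]) auto
qed

text \<open>One \<epsilon> achieves both closeness to \<open>g\<close> in C^N and small power series
  at every point of distance at least \<open>\<delta>0\<close> from \<open>K\<close>. The rate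
  \<open>16 * DIM('a) / \<delta>\<close> involves neither \<epsilon> nor \<open>\<delta>0\<close>,
  so different pieces can share it; \<epsilon> only influences the bound, which it brings down to
  \<eta>.\<close>

lemma analytic_approximation:
  fixes g :: "'a::euclidean_space \<Rightarrow> real"
  assumes "\<And>n. Ck n UNIV g" "compact K" "\<And>x. x \<notin> K \<Longrightarrow> g x = 0" and \<eta>: "0 < \<eta>" and \<delta>0: "0 < \<delta>0"
  shows "\<exists>G. (\<forall>n. Ck n UNIV G) \<and> Ck_bd N 1 \<eta> UNIV (\<lambda>x. G x - g x) \<and>
    (\<forall>\<xi> r. 0 < r \<longrightarrow> (\<exists>B. analytic \<xi> B (2 / r) G)) \<and>
    (\<forall>\<xi> \<delta>. \<delta>0 \<le> \<delta> \<and> (\<forall>y\<in>K. \<delta> \<le> norm (\<xi> - y)) \<longrightarrow> analytic \<xi> \<eta> (16 * DIM('a) / \<delta>) G)"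
proof -
  let ?n = "real DIM('a)"
  have n: "1 \<le> ?n" using DIM_positive[where 'a='a] by linarith
  have g: "supported K g" using supported_pderivs[of g K "[]"] assms by simp
  have sp: "supported K (pderivs bs g)" if "set bs \<subseteq> Basis" for bs
    by (rule supported_pderivs) (use assms that in auto)
  define I where "I = (\<integral>y. \<bar>g y\<bar> \<partial>lborel)"
  have I: "integrable lborel (\<lambda>y. \<bar>g y\<bar>)" using supported_integrable[OF supported_abs[OF g]] .
  have "\<forall>\<^sub>F \<epsilon> in at_right 0. \<forall>bs\<in>{bs. set bs \<subseteq> Basis \<and> length bs \<le> N}. \<forall>x. \<bar>mollify \<epsilon> (pderivs bs g) x - pderivs bs g x\<bar> \<le> \<eta>"
    by (intro eventually_ball_finite finite_lists_length_le finite_Basis ballI mollify_close[OF sp _] \<eta>) auto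
  moreover have "\<forall>\<^sub>F \<epsilon> in at_right 0. (I / sqrt pi ^ DIM('a)) / \<epsilon> ^ DIM('a) * exp (- (\<delta>0\<^sup>2 / 2) / \<epsilon>\<^sup>2) \<le> \<eta>"
    using \<delta>0 \<eta> DIM_positive by (intro power_exp_small) auto
  moreover have "\<forall>\<^sub>F \<epsilon> in at_right (0::real). 0 < \<epsilon>" by (rule eventually_at_right_less)
  ultimately have "\<forall>\<^sub>F \<epsilon> in at_right 0. (\<forall>bs\<in>{bs. set bs \<subseteq> Basis \<and> length bs \<le> N}. \<forall>x. \<bar>mollify \<epsilon> (pderivs bs g) x - pderivs bs g x\<bar> \<le> \<eta>) \<and>
      (I / sqrt pi ^ DIM('a)) / \<epsilon> ^ DIM('a) * exp (- (\<delta>0\<^sup>2 / 2) / \<epsilon>\<^sup>2) \<le> \<eta> \<and> 0 < \<epsilon>"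
    by eventually_elim auto
  then obtain \<epsilon> where \<epsilon>: "0 < \<epsilon>" "(I / sqrt pi ^ DIM('a)) / \<epsilon> ^ DIM('a) * exp (- (\<delta>0\<^sup>2 / 2) / \<epsilon>\<^sup>2) \<le> \<eta>"
    and close: "\<And>bs x. set bs \<subseteq> Basis \<Longrightarrow> length bs \<le> N \<Longrightarrow> \<bar>mollify \<epsilon> (pderivs bs g) x - pderivs bs g x\<bar> \<le> \<eta>"
    by (auto dest!: eventually_happens)
  have C: "Ck n UNIV (mollify \<epsilon> g)" "set bs \<subseteq> Basis \<Longrightarrow> pderivs bs (mollify \<epsilon> g) = mollify \<epsilon> (pderivs bs g)" for n bs
    using Ck_mollify[of g K] assms by blast+
  define l where "l = 1 / \<epsilon>\<^sup>2"
  have l: "0 < l" using \<epsilon> by (simp add: l_def)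
  have "Ck_bd N 1 \<eta> UNIV (\<lambda>x. mollify \<epsilon> g x - g x)"
    unfolding Ck_bd_iff
  proof (intro conjI allI impI ballI)
    show "Ck N UNIV (\<lambda>x. mollify \<epsilon> g x - g x)" by (intro Ck_diff C assms) auto
    fix bs :: "'a list" and z assume bs: "set bs \<subseteq> Basis \<and> length bs \<le> N"
    have "pderivs bs (\<lambda>x. mollify \<epsilon> g x - g x) z = mollify \<epsilon> (pderivs bs g) z - pderivs bs g z"
      using bs pderivs_diff[of UNIV z N "mollify \<epsilon> g" g bs] C assms by simp
    then show "norm (pderivs bs (\<lambda>x. mollify \<epsilon> g x - g x) z) \<le> \<eta> / 1 ^ length bs"
      using close bs by simp
  qed
  moreover have "\<exists>B. analytic \<xi> B (2 / r) (mollify \<epsilon> g)" if "0 < r" for \<xi> r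
    using analytic_mollify[OF g \<epsilon>(1) that refl refl] by blast
  moreover have "analytic \<xi> \<eta> (16 * ?n / \<delta>) (mollify \<epsilon> g)" if \<delta>: "\<delta>0 \<le> \<delta>" and far: "\<And>y. y \<in> K \<Longrightarrow> \<delta> \<le> norm (\<xi> - y)" for \<xi> \<delta>
  proof -
    \<comment> \<open>With D the distance from \<xi> to y, this \<open>r\<close> makes each of the
      two positive exponents at most \<open>l * D^2 / 4\<close>, so that half of the decay
      \<open>- l * D^2\<close> survives.\<close>
    define r where "r = \<delta> / (8 * ?n)"
    have d: "0 < \<delta>" using \<delta> \<delta>0 by simp
    have r: "0 < r" using d n by (simp add: r_def)
    define c where "c = 1 / (sqrt pi * \<epsilon>) ^ DIM('a)"
    have c: "0 < c" using \<epsilon> by (simp add: c_def)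
    let ?J = "\<lambda>y. c * \<bar>g y\<bar> * exp (- l * (norm (\<xi> - y))\<^sup>2 + r * (2 * l * (\<Sum>b\<in>Basis. \<bar>(y - \<xi>) \<bullet> b\<bar>)))"
    have "exp (l * (?n * r\<^sup>2)) * (\<integral>y. ?J y \<partial>lborel) = (\<integral>y. exp (l * (?n * r\<^sup>2)) * ?J y \<partial>lborel)" by simp
    also have "\<dots> \<le> (\<integral>y. (c * exp (- l * \<delta>0\<^sup>2 / 2)) * \<bar>g y\<bar> \<partial>lborel)"
    proof (rule Bochner_Integration.integral_mono)
      have "supported K (\<lambda>y. \<bar>g y\<bar> * (exp (l * (?n * r\<^sup>2)) * (c * exp (- l * (norm (\<xi> - y))\<^sup>2 + r * (2 * l * (\<Sum>b\<in>Basis. \<bar>(y - \<xi>) \<bullet> b\<bar>))))))"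
        by (intro supported_mult supported_abs g continuous_intros)
      from supported_integrable[OF this] show "integrable lborel (\<lambda>y. exp (l * (?n * r\<^sup>2)) * ?J y)"
        by (simp add: mult_ac)
      show "exp (l * (?n * r\<^sup>2)) * ?J y \<le> (c * exp (- l * \<delta>0\<^sup>2 / 2)) * \<bar>g y\<bar>" for y
      proof (cases "y \<in> K")
        case False
        then show ?thesis using g by (simp add: supported_def)
      next
        case True
        define D where "D = norm (\<xi> - y)"
        have D: "\<delta> \<le> D" "0 < D" using far[OF True] d by (auto simp: D_def)
        have "(\<Sum>b\<in>Basis. \<bar>(y - \<xi>) \<bullet> b\<bar>) \<le> (\<Sum>b\<in>(Basis::'a set). D)"
          unfolding D_def norm_minus_commute[of \<xi>] by (intro sum_mono Basis_le_norm)
        then have sle: "(\<Sum>b\<in>Basis. \<bar>(y - \<xi>) \<bullet> b\<bar>) \<le> ?n * D" by simp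
        have "r * (2 * l * (\<Sum>b\<in>Basis. \<bar>(y - \<xi>) \<bullet> b\<bar>)) \<le> r * (2 * l * (?n * D))"
          using r l sle by (intro mult_left_mono) auto
        also have "\<dots> = l * (\<delta> * D / 4)" using n by (simp add: r_def field_simps)
        also have "\<dots> \<le> l * (D * D / 4)" using D l by (intro mult_left_mono divide_right_mono mult_right_mono) auto
        finally have 1: "r * (2 * l * (\<Sum>b\<in>Basis. \<bar>(y - \<xi>) \<bullet> b\<bar>)) \<le> l * (D * D / 4)" .
        have "?n * r\<^sup>2 = \<delta> * \<delta> / (64 * ?n)" using n by (simp add: r_def power2_eq_square)
        also have "\<dots> \<le> D * D / 4"
        proof (rule frac_le)
          show "4 \<le> 64 * ?n" using n by linarith
          show "\<delta> * \<delta> \<le> D * D" using D d by (intro mult_mono) auto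
        qed (use D in auto)
        finally have 2: "l * (?n * r\<^sup>2) \<le> l * (D * D / 4)" using l by (intro mult_left_mono) auto
        have "\<delta>0 * \<delta>0 \<le> D * D" using \<delta> \<delta>0 D by (intro mult_mono) auto
        then have 3: "l * (\<delta>0 * \<delta>0) \<le> l * (D * D)" using l by (intro mult_left_mono) auto
        have "l * (?n * r\<^sup>2) + (- l * D\<^sup>2 + r * (2 * l * (\<Sum>b\<in>Basis. \<bar>(y - \<xi>) \<bullet> b\<bar>))) \<le> - l * \<delta>0\<^sup>2 / 2"
          using 1 2 3 by (simp add: power2_eq_square)
        then have "exp (l * (?n * r\<^sup>2)) * exp (- l * D\<^sup>2 + r * (2 * l * (\<Sum>b\<in>Basis. \<bar>(y - \<xi>) \<bullet> b\<bar>))) \<le> exp (- l * \<delta>0\<^sup>2 / 2)"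
          unfolding exp_add[symmetric] by simp
        then have "(c * \<bar>g y\<bar>) * (exp (l * (?n * r\<^sup>2)) * exp (- l * D\<^sup>2 + r * (2 * l * (\<Sum>b\<in>Basis. \<bar>(y - \<xi>) \<bullet> b\<bar>))))
            \<le> (c * \<bar>g y\<bar>) * exp (- l * \<delta>0\<^sup>2 / 2)"
          using c by (intro mult_left_mono) auto
        then show ?thesis by (simp only: D_def mult_ac)
      qed
    qed (use I in simp)
    also have "\<dots> = (I / sqrt pi ^ DIM('a)) / \<epsilon> ^ DIM('a) * exp (- (\<delta>0\<^sup>2 / 2) / \<epsilon>\<^sup>2)"
      by (simp add: I_def c_def l_def power_mult_distrib)
    also have "\<dots> \<le> \<eta>" by (rule \<epsilon>(2))
    finally have "exp (l * (?n * r\<^sup>2)) * (\<integral>y. ?J y \<partial>lborel) \<le> \<eta>" .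
    moreover have "2 / r = 16 * ?n / \<delta>" using n by (simp add: r_def)
    ultimately show ?thesis
      using analytic_weaken[OF analytic_mollify[OF g \<epsilon>(1) r l_def c_def, of \<xi>], of \<eta>] by simp
  qed
  ultimately show ?thesis using C(1) by (intro exI[of _ "mollify \<epsilon> g"]) auto
qed

section \<open>Series of smooth functions\<close>

text \<open>For \<open>D i\<close> only derivatives up to order \<open>i\<close> are bounded. For
  derivatives of a fixed order that covers all but finitely many terms, which is enough for the
  Weierstrass test.\<close>

lemma Ck_series:
  fixes D :: "nat \<Rightarrow> 'a::euclidean_space \<Rightarrow> real"
  assumes D: "\<And>i n. Ck n UNIV (D i)" and b: "\<And>i. Ck_bd i 1 (a i) UNIV (D i)" and a: "summable a"
  shows "Ck n UNIV (\<lambda>x. \<Sum>i. D i x)"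
    and "set bs \<subseteq> Basis \<Longrightarrow> pderivs bs (\<lambda>x. \<Sum>i. D i x) z = (\<Sum>i. pderivs bs (D i) z)"
proof -
  define J where "J = (\<lambda>bs x. \<Sum>i. pderivs bs (D i) x)"
  have ev: "\<forall>\<^sub>F i in sequentially. \<forall>x\<in>UNIV. norm (pderivs bs (D i) x) \<le> a i" if "set bs \<subseteq> Basis" for bs
  proof (rule eventually_sequentiallyI[of "length bs"], intro ballI)
    fix i x assume "length bs \<le> i"
    then show "norm (pderivs bs (D i) x) \<le> a i" using Ck_bd_pderivs[OF b that, of i x] by simp
  qed
  have ul: "uniform_limit UNIV (\<lambda>n x. \<Sum>i<n. pderivs bs (D i) x) (J bs) sequentially" if "set bs \<subseteq> Basis" for bs
    unfolding J_def by (rule Weierstrass_m_test_ev[OF ev[OF that] a])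
  have sm: "summable (\<lambda>i. pderivs bs (D i) x)" if "set bs \<subseteq> Basis" for bs x
    by (rule summable_comparison_test_ev[OF _ a]) (use ev[OF that] in eventually_elim, auto)
  have Cp: "Ck m UNIV (pderivs bs (D i))" if "set bs \<subseteq> Basis" for m bs i
    using Ck_pderivs[OF D that, of "m + length bs"] by simp
  have cont: "continuous_on UNIV (J bs)" if "set bs \<subseteq> Basis" for bs
  proof (rule uniform_limit_theorem[OF _ ul[OF that]])
    show "\<forall>\<^sub>F n in sequentially. continuous_on UNIV (\<lambda>x. \<Sum>i<n. pderivs bs (D i) x)"
      by (intro always_eventually allI continuous_on_sum Ck_continuous[OF Cp[OF that]])
  qed simp
  have deriv: "has_dir_deriv c (J bs) z (J (c # bs) z)" if bs: "set bs \<subseteq> Basis" and c: "c \<in> Basis" for bs c z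
  proof -
    let ?f = "\<lambda>i t. pderivs bs (D i) (z + t *\<^sub>R c)" and ?f' = "\<lambda>i t. pderivs (c # bs) (D i) (z + t *\<^sub>R c)"
    have cbs: "set (c # bs) \<subseteq> Basis" using bs c by simp
    have "uniformly_convergent_on UNIV (\<lambda>n t. \<Sum>i<n. ?f' i t)"
      using uniform_limit_compose'[where B = UNIV and h = "\<lambda>t. z + t *\<^sub>R c", OF ul[OF cbs]]
      by (auto simp: uniformly_convergent_on_def)
    moreover have "(?f i has_real_derivative ?f' i t) (at t)" for i t
    proof -
      have "has_dir_deriv c (pderivs bs (D i)) x (pderiv_dir c (pderivs bs (D i)) x)" for x
        by (rule Ck_has_dir_deriv[OF Cp[OF bs, of 1]]) (use c in auto)
      from has_dir_deriv_along[OF this] show ?thesis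
        by (simp add: has_real_derivative_iff_has_vector_derivative)
    qed
    ultimately have "((\<lambda>t. \<Sum>i. ?f i t) has_real_derivative (\<Sum>i. ?f' i 0)) (at 0)"
      using sm[OF bs] by (intro has_field_derivative_series'(2)[where S = UNIV and x0 = 0]) auto
    then show ?thesis by (simp add: J_def has_real_derivative_iff_has_vector_derivative)
  qed
  have F: "Ck m UNIV (J [])" "set bs \<subseteq> Basis \<Longrightarrow> length bs \<le> m \<Longrightarrow> pderivs bs (J []) = J bs" for m bs
    using Ck_family[of m J] cont deriv by blast+
  show "Ck n UNIV (\<lambda>x. \<Sum>i. D i x)" using F(1) by (simp add: J_def)
  show "pderivs bs (\<lambda>x. \<Sum>i. D i x) z = (\<Sum>i. pderivs bs (D i) z)" if "set bs \<subseteq> Basis"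
    using F(2)[OF that order_refl] by (simp add: J_def)
qed

section \<open>Analytic perturbation off a closed set\<close>

text \<open>Local finiteness is stated as a distance, because that distance determines the common
  rate of analyticity of the mollified pieces.\<close>

locale smooth_partition =
  fixes V :: "'a::euclidean_space set" and \<phi> :: "nat \<Rightarrow> 'a \<Rightarrow> real" and K :: "nat \<Rightarrow> 'a set"
  assumes closed_V: "closed V" and V_nonempty: "V \<noteq> {}"
    and Ck_\<phi>: "Ck k UNIV (\<phi> n)"
    and compact_K: "compact (K n)" and K_disjoint: "K n \<inter> V = {}"
    and \<phi>_support: "x \<notin> K n \<Longrightarrow> \<phi> n x = 0"
    and \<phi>_nonneg: "0 \<le> \<phi> n x"
    and \<phi>_sums: "x \<notin> V \<Longrightarrow> (\<lambda>n. \<phi> n x) sums 1"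
    and K_locally_finite: "x \<notin> V \<Longrightarrow> \<exists>\<delta>>0. \<exists>N. \<forall>n\<ge>N. \<forall>y\<in>K n. \<delta> \<le> norm (x - y)"

lemma (in whitney) ex_smooth_partition: "\<exists>\<phi> K. smooth_partition V \<phi> K"
proof -
  \<comment> \<open>The countable index set is enumerated by naturals; a number that is not the code
    of an index gets the zero function with empty support.\<close>
  define N where "N = to_nat_on Idx ` Idx"
  define ix where "ix = from_nat_into Idx"
  define \<phi> where "\<phi> = (\<lambda>n x. if n \<in> N \<and> x \<notin> V then bump_at (ix n) x / wsum (\<lambda>_ _. 1) x else 0)"
  define K where "K = (\<lambda>n. if n \<in> N then closure {y. bump_at (ix n) y \<noteq> 0} else {})"
  have ix_to: "ix (to_nat_on Idx i) = i" if "i \<in> Idx" for i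
    unfolding ix_def using countable_Idx that by simp
  have ixN: "ix n \<in> Idx" "to_nat_on Idx (ix n) = n" if "n \<in> N" for n
    using that ix_to by (auto simp: N_def)
  have sub: "closure {y. bump_at i y \<noteq> 0} \<subseteq> cball (ctr i) (rad i)" for i
    using bump_at_support[of i] by (intro closure_minimal) (auto simp: dist_norm norm_minus_commute less_imp_le)
  have cK: "compact (K n)" for n
    unfolding K_def using sub bounded_subset[OF bounded_cball sub]
    by (auto simp: compact_eq_bounded_closed)
  have disj: "K n \<inter> V = {}" for n
  proof -
    have "x \<notin> V" if "n \<in> N" "x \<in> cball (ctr (ix n)) (rad (ix n))" for x
    proof
      assume "x \<in> V"
      then have "d (ctr (ix n)) \<le> rad (ix n)" using d_le[of x "ctr (ix n)"] that by (simp add: dist_norm)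
      then show False using ixN(1)[OF that(1)] rad_pos[of "ix n"] by (simp add: Idx_def)
    qed
    then have "x \<notin> V" if "x \<in> K n" for x
      using that sub[of "ix n"] by (cases "n \<in> N") (auto simp: K_def)
    then show ?thesis by auto
  qed
  have supp: "\<phi> n x = 0" if "x \<notin> K n" for n x
    using that closure_subset[of "{y. bump_at (ix n) y \<noteq> 0}"] by (auto simp: \<phi>_def K_def)
  have W1: "0 < wsum (\<lambda>_ _. 1) x" if "x \<notin> V" for x using wsum_1_ge[OF that] by linarith
  show ?thesis
  proof (intro exI, unfold_locales)
    show "Ck k UNIV (\<phi> n)" for k n
    proof (rule Ck_local)
      fix z :: 'a
      show "\<exists>W. open W \<and> z \<in> W \<and> Ck k W (\<phi> n)"
      proof (cases "z \<in> V")
        case True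
        have "open (- K n)" using cK compact_imp_closed by blast
        moreover have "Ck k (- K n) (\<phi> n)"
          using Ck_cong[of "- K n" "\<phi> n" "\<lambda>_. 0" k] supp Ck_zero \<open>open (- K n)\<close> by auto
        ultimately show ?thesis using True disj[of n] by (intro exI[of _ "- K n"]) auto
      next
        case False
        have o: "open (- V)" using closed_V by auto
        have "Ck k (- V) (\<lambda>x. bump_at (ix n) x / wsum (\<lambda>_ _. 1) x)"
          using W1 o by (intro Ck_divide Ck_subset[OF Ck_bump_at] Ck_wsum Ck_const) force+
        then have "Ck k (- V) (\<phi> n)"
          using Ck_cong[OF o, of "\<phi> n" "\<lambda>x. bump_at (ix n) x / wsum (\<lambda>_ _. 1) x" k]
            Ck_cong[OF o, of "\<phi> n" "\<lambda>_. 0" k] Ck_zero[OF o] by (cases "n \<in> N") (auto simp: \<phi>_def)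
        then show ?thesis using False o by (intro exI[of _ "- V"]) auto
      qed
    qed
    show "0 \<le> \<phi> n x" for n x
      using W1[of x] bump_at_nonneg[of "ix n" x] by (auto simp: \<phi>_def intro!: divide_nonneg_pos)
    show "(\<lambda>n. \<phi> n x) sums 1" if x: "x \<notin> V" for x
    proof -
      let ?A = "{i \<in> Idx. bump_at i x \<noteq> 0}"
      have "x \<in> nb x" using d_pos x by simp
      then have "?A \<subseteq> active x" by (auto simp: active_def)
      then have fin: "finite ?A" using active_finite_card[OF x] finite_subset by blast
      have "(\<lambda>n. \<phi> n x) sums (\<Sum>n\<in>to_nat_on Idx ` ?A. \<phi> n x)"
      proof (rule sums_finite)
        fix n assume n: "n \<notin> to_nat_on Idx ` ?A"
        show "\<phi> n x = 0"
        proof (rule ccontr)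
          assume "\<phi> n x \<noteq> 0"
          then have "n \<in> N" "bump_at (ix n) x \<noteq> 0" by (auto simp: \<phi>_def split: if_splits)
          then have "n \<in> to_nat_on Idx ` ?A"
            using ixN by (intro image_eqI[of _ _ "ix n"]) auto
          then show False using n by simp
        qed
      qed (use fin in simp)
      also have "(\<Sum>n\<in>to_nat_on Idx ` ?A. \<phi> n x) = (\<Sum>i\<in>?A. bump_at i x / wsum (\<lambda>_ _. 1) x)"
        using inj_on_subset[OF inj_on_to_nat_on[OF countable_Idx], of ?A] x
        by (subst sum.reindex) (auto simp: \<phi>_def N_def ix_to intro!: sum.cong)
      also have "\<dots> = 1"
        using W1[OF x] by (simp add: sum_divide_distrib[symmetric] wsum_def)
      finally show ?thesis .
    qed
    show "\<exists>\<delta>>0. \<exists>M. \<forall>n\<ge>M. \<forall>y\<in>K n. \<delta> \<le> norm (x - y)" if x: "x \<notin> V" for x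
    proof -
      have "finite (to_nat_on Idx ` active x)" using active_finite_card[OF x] by simp
      then obtain M where M: "\<And>n. n \<in> to_nat_on Idx ` active x \<Longrightarrow> n < M"
        by (meson finite_nat_set_iff_bounded)
      have "d x / 8 \<le> norm (x - y)" if n: "M \<le> n" and y: "y \<in> K n" for n y
      proof (rule ccontr)
        assume "\<not> d x / 8 \<le> norm (x - y)"
        then have "y \<in> nb x \<inter> closure {y. bump_at (ix n) y \<noteq> 0}" "n \<in> N"
          using y by (auto simp: dist_norm K_def split: if_splits)
        \<comment> \<open>The ball is open, so meeting the closure of a set means meeting the set
          itself; hence the count of active indices also controls the closed supports.\<close>
        then have "nb x \<inter> {y. bump_at (ix n) y \<noteq> 0} \<noteq> {}"
          using open_Int_closure_eq_empty[of "nb x" "{y. bump_at (ix n) y \<noteq> 0}"] by blast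
        then have "ix n \<in> active x" using ixN(1)[OF \<open>n \<in> N\<close>] by (auto simp: active_def)
        then have "n \<in> to_nat_on Idx ` active x" using ixN(2)[OF \<open>n \<in> N\<close>] by force
        then show False using M n by fastforce
      qed
      then show ?thesis using d_pos[OF x] by (intro exI[of _ "d x / 8"]) auto
    qed
  qed (use cK disj supp closed_V V_nonempty in auto)
qed

context smooth_partition
begin

lemma open_compl: "open (- V)" "open (- K n)"
  using closed_V compact_imp_closed[OF compact_K] by auto

text \<open>Off \<open>V\<close> the pieces \<open>g n\<close> add up to \<open>h\<close>, so
  \<open>h + D\<close> is the sum of the mollified pieces. \<open>D\<close> is smooth even across
  \<open>V\<close>, where \<open>h\<close> may blow up, since each piece lives away from
  \<open>V\<close> and its error is at most 2^-(n+1) in C^n.\<close>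

lemma analytic_perturbation:
  assumes h: "\<And>k. Ck k (- V) h"
  shows "\<exists>D. (\<forall>k. Ck k UNIV D) \<and> (\<forall>x. \<bar>D x\<bar> \<le> 1) \<and> (\<forall>\<xi>. \<xi> \<notin> V \<longrightarrow> (\<exists>B C. analytic \<xi> B C (\<lambda>x. h x + D x)))"
proof -
  let ?n = "real DIM('a)"
  \<comment> \<open>Extension by zero: nothing is known of \<open>h\<close> on \<open>V\<close>, but
    \<open>\<phi> n\<close> vanishes near each point of it.\<close>
  define g where "g = (\<lambda>n x. if x \<in> V then 0 else \<phi> n x * h x)"
  define a where "a = (\<lambda>n. (1 / 2 :: real) ^ Suc n)"
  have a: "a sums 1" unfolding a_def by (rule power_half_series)
  have g0: "g n x = 0" if "x \<notin> K n" for n x using \<phi>_support[OF that] by (simp add: g_def)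
  have Cg: "Ck k UNIV (g n)" for k n
  proof (rule Ck_local)
    fix z :: 'a
    show "\<exists>W. open W \<and> z \<in> W \<and> Ck k W (g n)"
    proof (cases "z \<in> V")
      case True
      have "Ck k (- K n) (g n)"
        using Ck_cong[OF open_compl(2), of n "g n" "\<lambda>_. 0" k] g0 Ck_zero[OF open_compl(2)] by auto
      then show ?thesis using True K_disjoint[of n] open_compl by (intro exI[of _ "- K n"]) auto
    next
      case False
      have "Ck k (- V) (\<lambda>x. \<phi> n x * h x)"
        by (intro Ck_mult open_compl Ck_subset[OF Ck_\<phi>] h) simp
      then have "Ck k (- V) (g n)"
        using Ck_cong[OF open_compl(1), of "g n" "\<lambda>x. \<phi> n x * h x" k] by (simp add: g_def)
      then show ?thesis using False open_compl by (intro exI[of _ "- V"]) auto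
    qed
  qed
  \<comment> \<open>The centre \<xi> is not known when \<open>G n\<close> is chosen, so smallness is
    required at all distances from \<open>1 / (n + 1)\<close> on; any given positive distance
    qualifies for large n.\<close>
  have "\<forall>n. \<exists>G. (\<forall>k. Ck k UNIV G) \<and> Ck_bd n 1 (a n) UNIV (\<lambda>x. G x - g n x) \<and>
    (\<forall>\<xi> r. 0 < r \<longrightarrow> (\<exists>B. analytic \<xi> B (2 / r) G)) \<and>
    (\<forall>\<xi> \<delta>. 1 / real (Suc n) \<le> \<delta> \<and> (\<forall>y\<in>K n. \<delta> \<le> norm (\<xi> - y)) \<longrightarrow> analytic \<xi> (a n) (16 * DIM('a) / \<delta>) G)"
    by (intro allI analytic_approximation Cg compact_K g0) (auto simp: a_def)
  from choice[OF this] obtain G where G: "\<And>n k. Ck k UNIV (G n)" "\<And>n. Ck_bd n 1 (a n) UNIV (\<lambda>x. G n x - g n x)"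
    "\<And>n \<xi> r. 0 < r \<Longrightarrow> \<exists>B. analytic \<xi> B (2 / r) (G n)"
    "\<And>n \<xi> \<delta>. 1 / real (Suc n) \<le> \<delta> \<Longrightarrow> (\<And>y. y \<in> K n \<Longrightarrow> \<delta> \<le> norm (\<xi> - y)) \<Longrightarrow> analytic \<xi> (a n) (16 * DIM('a) / \<delta>) (G n)"
    by blast
  define D where "D = (\<lambda>x. \<Sum>n. G n x - g n x)"
  have CD: "Ck k UNIV D" for k
    unfolding D_def by (rule Ck_series[OF _ G(2) sums_summable[OF a]]) (intro Ck_diff G Cg, simp)
  have Db: "norm (G n x - g n x) \<le> a n" for n x using Ck_bd_bound[OF G(2), of x n] by simp
  have sD: "summable (\<lambda>n. G n x - g n x)" for x
    by (rule summable_comparison_test'[where N = 0, OF sums_summable[OF a]]) (rule Db)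
  have "\<bar>D x\<bar> \<le> 1" for x
  proof -
    have "norm (\<Sum>n. G n x - g n x) \<le> (\<Sum>n. a n)"
      by (rule norm_suminf_le[OF Db sums_summable[OF a]])
    then show ?thesis using a by (simp add: D_def sums_iff)
  qed
  moreover have "\<exists>B C. analytic \<xi> B C (\<lambda>x. h x + D x)" if \<xi>: "\<xi> \<notin> V" for \<xi>
  proof -
    obtain \<delta> N where \<delta>: "0 < \<delta>" "\<And>n y. N \<le> n \<Longrightarrow> y \<in> K n \<Longrightarrow> \<delta> \<le> norm (\<xi> - y)"
      using K_locally_finite[OF \<xi>] by blast
    define C where "C = 16 * ?n / \<delta>"
    have C: "0 < C" using \<delta> DIM_positive[where 'a='a] by (simp add: C_def)
    obtain N' where N': "1 / real (Suc N') < \<delta>" using nat_approx_posE[OF \<delta>(1)] by blast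
    \<comment> \<open>The early pieces are entire and can be expanded with the same rate
      \<open>C\<close>; only their bounds are out of control, and finitely many of those do not
      affect summability.\<close>
    have "\<exists>B. analytic \<xi> B C (G n) \<and> (max N N' \<le> n \<longrightarrow> B = a n)" for n
    proof (cases "max N N' \<le> n")
      case True
      have "1 / real (Suc n) \<le> 1 / real (Suc N')" using True by (intro divide_left_mono) auto
      then have "1 / real (Suc n) \<le> \<delta>" using N' by linarith
      then have "analytic \<xi> (a n) (16 * DIM('a) / \<delta>) (G n)"
        by (rule G(4)) (use \<delta>(2) True in auto)
      then have "analytic \<xi> (a n) C (G n)" by (simp add: C_def)
      then show ?thesis by blast
    next
      case False
      then show ?thesis using G(3)[of "2 / C" \<xi> n] C by auto
    qed
    then obtain B where B: "\<And>n. analytic \<xi> (B n) C (G n)" "\<And>n. max N N' \<le> n \<Longrightarrow> B n = a n" by metis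
    have "summable B"
      using summable_cong[of B a] eventually_sequentiallyI[of "max N N'" "\<lambda>n. B n = a n"] B(2) sums_summable[OF a]
      by blast
    then have "analytic \<xi> (\<Sum>n. B n) C (\<lambda>x. \<Sum>n. G n x)" by (rule analytic_suminf[OF B(1)])
    then have "analytic \<xi> (\<Sum>n. B n) (max C (1 / infdist \<xi> V)) (\<lambda>x. h x + D x)"
    proof (rule analytic_cong)
      show "0 < infdist \<xi> V" using \<xi> closed_V V_nonempty by (meson infdist_pos_not_in_closed)
      fix x assume "norm (x - \<xi>) < infdist \<xi> V"
      then have x: "x \<notin> V" using infdist_le[of x V \<xi>] by (auto simp: dist_norm norm_minus_commute)
      have "(\<lambda>n. g n x) sums h x" using sums_mult2[OF \<phi>_sums[OF x], of "h x"] x by (simp add: g_def)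
      from sums_add[OF this summable_sums[OF sD[of x]]] show "(\<Sum>n. G n x) = h x + D x"
        by (simp add: D_def sums_iff)
    qed
    then show ?thesis by blast
  qed
  ultimately show ?thesis using CD by blast
qed

text \<open>The weights make the n-th term at most 2^-(n+2) in C^n, and these bounds add up to 1/2.
  Flatness comes from differentiating term by term, each term vanishing near every point of
  \<open>V\<close>.\<close>

lemma ex_flat_function:
  "\<exists>u :: 'a \<Rightarrow> real. (\<forall>k. Ck k UNIV u) \<and> (\<forall>x. 0 \<le> u x \<and> u x \<le> 1 / 2) \<and> (\<forall>x. x \<notin> V \<longrightarrow> 0 < u x) \<and>
    (\<forall>bs z. set bs \<subseteq> Basis \<longrightarrow> z \<in> V \<longrightarrow> pderivs bs u z = 0)"
proof -
  have "\<forall>n. \<exists>C\<ge>0. Ck_bd n 1 C UNIV (\<phi> n)"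
    using Ck_bd_compact_support[OF Ck_\<phi> compact_K \<phi>_support] by blast
  then obtain C where C: "\<And>n. 0 \<le> C n" "\<And>n. Ck_bd n 1 (C n) UNIV (\<phi> n)" by metis
  define a where "a = (\<lambda>n. (1 / 2 :: real) * (1 / 2) ^ Suc n)"
  have a: "a sums (1 / 2)" unfolding a_def using sums_mult[OF power_half_series, of "1 / 2"] by simp
  define e where "e = (\<lambda>n. a n / (C n + 1))"
  have e: "0 < e n" for n using C(1)[of n] by (simp add: e_def a_def add_nonneg_pos)
  have CkE: "Ck k UNIV (\<lambda>x. e n * \<phi> n x)" for k n
    by (intro Ck_mult Ck_const Ck_\<phi>) auto
  have sbE: "Ck_bd n 1 (a n) UNIV (\<lambda>x. e n * \<phi> n x)" for n
  proof (rule Ck_bd_mono)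
    show "Ck_bd n 1 (\<bar>e n\<bar> * C n) UNIV (\<lambda>x. e n * \<phi> n x)" using Ck_bd_scaleR[OF _ C(2), of n "e n"] by simp
    have "a n * C n \<le> a n * (C n + 1)" by (intro mult_left_mono) (auto simp: a_def)
    then show "\<bar>e n\<bar> * C n \<le> a n"
      using e[of n] C(1)[of n] by (simp add: e_def field_simps add_nonneg_pos)
  qed simp
  define u where "u = (\<lambda>x. \<Sum>n. e n * \<phi> n x)"
  note S = Ck_series[OF CkE sbE sums_summable[OF a]]
  have b: "norm (e n * \<phi> n x) \<le> a n" for n x using Ck_bd_bound[OF sbE, of x n] by simp
  have nn: "0 \<le> e n * \<phi> n x" for n x using e[of n] \<phi>_nonneg[of n x] by simp
  have s: "summable (\<lambda>n. e n * \<phi> n x)" for x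
    by (rule summable_comparison_test'[where N = 0, OF sums_summable[OF a]]) (rule b)
  have "Ck k UNIV u" for k unfolding u_def by (rule S(1))
  moreover have "0 \<le> u x" "u x \<le> 1 / 2" for x
  proof -
    show "0 \<le> u x" unfolding u_def by (intro suminf_nonneg s nn)
    have "norm (u x) \<le> (\<Sum>n. a n)"
      unfolding u_def by (rule norm_suminf_le[OF b sums_summable[OF a]])
    then show "u x \<le> 1 / 2" using sums_unique[OF a] by simp
  qed
  moreover have "0 < u x" if x: "x \<notin> V" for x
  proof -
    have "\<exists>n. \<phi> n x \<noteq> 0"
    proof (rule ccontr)
      assume "\<nexists>n. \<phi> n x \<noteq> 0"
      then have "(\<lambda>n. \<phi> n x) = (\<lambda>n. 0)" by auto
      then have "(\<lambda>n. 0 :: real) sums 1" using \<phi>_sums[OF x] by simp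
      then show False using sums_unique2[OF sums_zero] by fastforce
    qed
    then obtain n where "0 < e n * \<phi> n x" using e \<phi>_nonneg[of _ x] by (metis less_eq_real_def mult_pos_pos)
    then show ?thesis unfolding u_def by (intro suminf_pos2[OF s nn])
  qed
  moreover have "pderivs bs u z = 0" if "set bs \<subseteq> Basis" "z \<in> V" for bs z
  proof -
    have "pderivs bs (\<lambda>x. e n * \<phi> n x) z = 0" for n
      by (rule pderivs_vanish[OF open_compl(2)[of n]]) (use that K_disjoint[of n] \<phi>_support in auto)
    then show ?thesis unfolding u_def using S(2)[OF that(1)] by simp
  qed
  ultimately show ?thesis by (intro exI[of _ u]) auto
qed

end

theorem whitney_analytic_extension:
  fixes V :: "'a::euclidean_space set" and f :: "'a mindex \<Rightarrow> 'a \<Rightarrow> real"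
  assumes "closed V" "class_C m V f"
  shows "\<exists>F. (\<forall>n. enat n \<le> m \<longrightarrow> Ck n UNIV F) \<and>
    (\<forall>bs z. set bs \<subseteq> Basis \<longrightarrow> enat (length bs) \<le> m \<longrightarrow> z \<in> V \<longrightarrow> pderivs bs F z = f (mcount bs) z) \<and>
    (\<forall>\<xi>. \<xi> \<notin> V \<longrightarrow> (\<exists>B K. analytic \<xi> B K F))"
proof (cases "V = {}")
  \<comment> \<open>\<open>infdist\<close> to the empty set is 0 by convention, so a construction
    driven by the distance breaks down; here the zero function serves.\<close>
  case True
  have "analytic \<xi> 0 1 (\<lambda>_. 0)" for \<xi> :: 'a
    unfolding analytic_def by (auto intro!: exI[of _ "\<lambda>_ _. 0"] hpoly_zero)
  then show ?thesis using True Ck_zero by (intro exI[of _ "\<lambda>_. 0"]) auto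
next
  case False
  interpret whitney V using assms False by unfold_locales
  obtain \<phi> K where "smooth_partition V \<phi> K" using ex_smooth_partition by blast
  then interpret smooth_partition V \<phi> K .
  obtain F0 where F0: "\<And>n. Ck n (- V) F0" "\<And>n. enat n \<le> m \<Longrightarrow> Ck n UNIV F0"
    "\<And>bs z. set bs \<subseteq> Basis \<Longrightarrow> enat (length bs) \<le> m \<Longrightarrow> z \<in> V \<Longrightarrow> pderivs bs F0 z = f (mcount bs) z"
    using whitney_smooth_extension[OF assms(1) False assms(2)] by blast
  obtain u :: "'a \<Rightarrow> real" where u: "\<And>k. Ck k UNIV u" "\<And>x. 0 \<le> u x" "\<And>x. u x \<le> 1 / 2" "\<And>x. x \<notin> V \<Longrightarrow> 0 < u x"
    "\<And>bs z. set bs \<subseteq> Basis \<Longrightarrow> z \<in> V \<Longrightarrow> pderivs bs u z = 0"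
    using ex_flat_function by blast
  have "u x \<noteq> 0" if "x \<in> - V" for x using u(4)[of x] that by simp
  then have Cu: "Ck k (- V) (\<lambda>x. inverse (u x))" for k
    using Ck_inverse[OF open_compl(1), of u k] Ck_subset[OF u(1), of "- V" k] by simp
  obtain D1 where D1: "\<And>k. Ck k UNIV D1" "\<And>x. \<bar>D1 x\<bar> \<le> 1" "\<And>\<xi>. \<xi> \<notin> V \<Longrightarrow> \<exists>B C. analytic \<xi> B C (\<lambda>x. inverse (u x) + D1 x)"
    using analytic_perturbation[OF Cu] by blast
  have CF: "Ck k (- V) (\<lambda>x. F0 x * inverse (u x))" for k
    by (intro Ck_mult open_compl Cu F0(1))
  obtain D2 where D2: "\<And>k. Ck k UNIV D2" "\<And>\<xi>. \<xi> \<notin> V \<Longrightarrow> \<exists>B C. analytic \<xi> B C (\<lambda>x. F0 x * inverse (u x) + D2 x)"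
    using analytic_perturbation[OF CF] by blast
  have den: "0 < 1 + u x * D1 x" for x
  proof -
    have "\<bar>u x * D1 x\<bar> \<le> 1 / 2 * 1" unfolding abs_mult using u(2,3)[of x] D1(2)[of x] by (intro mult_mono) auto
    then show ?thesis by linarith
  qed
  \<comment> \<open>Writing \<open>F\<close> as \<open>F0\<close> plus a multiple of
    \<open>u\<close> makes sense on the whole space; the quotient involving \<open>1 / u\<close> is
    confined to the complement of \<open>V\<close>, where it yields analyticity.\<close>
  define Q where "Q = (\<lambda>x. (D2 x - F0 x * D1 x) / (1 + u x * D1 x))"
  define F where "F = (\<lambda>x. F0 x + u x * Q x)"
  have CQ: "Ck n UNIV Q" if "enat n \<le> m" for n
    unfolding Q_def
  proof (rule Ck_divide)
    show "1 + u x * D1 x \<noteq> 0" for x using den[of x] by linarith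
  qed (intro Ck_diff Ck_add Ck_mult Ck_const D1 D2 F0(2) u(1) that open_UNIV)+
  have "Ck n UNIV F" if "enat n \<le> m" for n
    unfolding F_def by (intro Ck_add Ck_mult CQ that F0(2) u(1)) auto
  moreover have "pderivs bs F z = f (mcount bs) z" if bs: "set bs \<subseteq> Basis" "enat (length bs) \<le> m" and z: "z \<in> V" for bs z
  proof -
    have "pderivs bs F z = pderivs bs F0 z + pderivs bs (\<lambda>x. u x * Q x) z"
      unfolding F_def by (rule pderivs_add[of UNIV _ "length bs"]) (use bs in \<open>auto intro!: F0(2) Ck_mult u(1) CQ\<close>)
    also have "pderivs bs (\<lambda>x. u x * Q x) z = 0"
      by (rule pderivs_flat_mult[OF u(1) CQ[OF bs(2)] bs(1)]) (use u(5) z in auto)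
    finally show ?thesis using F0(3)[OF bs z] by simp
  qed
  moreover have "\<exists>B K. analytic \<xi> B K F" if \<xi>: "\<xi> \<notin> V" for \<xi>
  proof -
    let ?h1 = "\<lambda>x. inverse (u x) + D1 x" and ?h2 = "\<lambda>x. F0 x * inverse (u x) + D2 x"
    have h1: "?h1 x = (1 + u x * D1 x) / u x" "?h1 x \<noteq> 0" if "x \<notin> V" for x
    proof -
      show "?h1 x = (1 + u x * D1 x) / u x" using u(4)[OF that] by (simp add: field_simps)
      then show "?h1 x \<noteq> 0" using den[of x] u(4)[OF that] by simp
    qed
    obtain B1 C1 where 1: "analytic \<xi> B1 C1 (\<lambda>x. inverse (?h1 x))"
      using D1(3)[OF \<xi>] analytic_inverse h1(2)[OF \<xi>] by blast
    obtain B2 C2 where 2: "analytic \<xi> B2 C2 ?h2" using D2(2)[OF \<xi>] by blast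
    have "analytic \<xi> (B2 * B1) (2 * max C1 C2) (\<lambda>x. ?h2 x * inverse (?h1 x))"
      by (intro analytic_mult analytic_weaken[OF 1] analytic_weaken[OF 2]) auto
    then have "analytic \<xi> (B2 * B1) (max (2 * max C1 C2) (1 / d \<xi>)) F"
    proof (rule analytic_cong[OF _ d_pos[OF \<xi>]])
      fix x assume "norm (x - \<xi>) < d \<xi>"
      then have x: "x \<notin> V" using d_le[of x \<xi>] by (auto simp: norm_minus_commute)
      have "?h2 x * inverse (?h1 x) = (F0 x + u x * D2 x) / (1 + u x * D1 x)"
      proof -
        have "?h2 x = (F0 x + u x * D2 x) / u x" using u(4)[OF x] by (simp add: field_simps)
        moreover have "a / u x * inverse (b / u x) = a / b" for a b using u(4)[OF x] by simp
        ultimately show ?thesis unfolding h1(1)[OF x] by (simp only:)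
      qed
      also have "\<dots> = F x"
        unfolding F_def Q_def using den[of x] by (simp add: field_simps)
      finally show "?h2 x * inverse (?h1 x) = F x" .
    qed
    then show ?thesis by blast
  qed
  ultimately show ?thesis by (intro exI[of _ F]) blast
qed

section \<open>Coordinates as sums of words\<close>

definition fin_seq :: "nat \<Rightarrow> (nat \<Rightarrow> real) \<Rightarrow> bool" where
  "fin_seq r x \<longleftrightarrow> (\<forall>j\<ge>2 ^ r. x j = 0)"

definition unit_seq :: "nat \<Rightarrow> nat \<Rightarrow> real" where
  "unit_seq k = (\<lambda>j. if j = k then 1 else 0)"

text \<open>Both the square of the unit with index \<open>k\<close> and the sign that it acquires
  under conjugation.\<close>

definition sgn_unit :: "nat \<Rightarrow> real" where
  "sgn_unit k = (if k = 0 then 1 else - 1)"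

lemma lower_upper_add [simp]:
  "lower r (\<lambda>j. x j + y j) = (\<lambda>j. lower r x j + lower r y j)"
  "upper r (\<lambda>j. x j + y j) = (\<lambda>j. upper r x j + upper r y j)"
  by (auto simp: lower_def upper_def)

lemma lower_upper_scale [simp]:
  "lower r (\<lambda>j. c * x j) = (\<lambda>j. c * lower r x j)"
  "upper r (\<lambda>j. c * x j) = (\<lambda>j. c * upper r x j)"
  by (auto simp: lower_def upper_def)

lemma lower_upper_dbl: "fin_seq r a \<Longrightarrow> lower r (dbl r a b) = a" "fin_seq r b \<Longrightarrow> upper r (dbl r a b) = b"
  by (auto simp: lower_def upper_def dbl_def fin_seq_def fun_eq_iff)

lemma fin_seq_lower_upper: "fin_seq r (lower r x)" "fin_seq r (upper r x)"
  by (auto simp: fin_seq_def lower_def upper_def)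

lemma dbl_lower_upper: "fin_seq (Suc r) x \<Longrightarrow> dbl r (lower r x) (upper r x) = x"
  by (auto simp: fin_seq_def dbl_def lower_def upper_def fun_eq_iff)

lemma seq_conj_add: "seq_conj r (\<lambda>j. x j + y j) = (\<lambda>j. seq_conj r x j + seq_conj r y j)"
  by (induction r arbitrary: x y) (auto simp: dbl_def fun_eq_iff)

lemma seq_conj_scale: "seq_conj r (\<lambda>j. c * x j) = (\<lambda>j. c * seq_conj r x j)"
  by (induction r arbitrary: x) (auto simp: dbl_def fun_eq_iff)

lemma seq_mult_add:
  "seq_mult r (\<lambda>j. x j + x' j) y = (\<lambda>j. seq_mult r x y j + seq_mult r x' y j)"
  "seq_mult r y (\<lambda>j. x j + x' j) = (\<lambda>j. seq_mult r y x j + seq_mult r y x' j)"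
  by (induction r arbitrary: x x' y) (auto simp: dbl_def fun_eq_iff Let_def seq_conj_add algebra_simps)

lemma seq_mult_scale:
  "seq_mult r (\<lambda>j. c * x j) y = (\<lambda>j. c * seq_mult r x y j)"
  "seq_mult r y (\<lambda>j. c * x j) = (\<lambda>j. c * seq_mult r y x j)"
  by (induction r arbitrary: x y) (auto simp: dbl_def fun_eq_iff Let_def seq_conj_scale algebra_simps)

lemma fin_seq_seq_mult: "fin_seq r (seq_mult r x y)"
  by (simp add: fin_seq_def seq_mult_vanishes)

lemma seq_conj_eq: "fin_seq r x \<Longrightarrow> seq_conj r x = (\<lambda>j. if j = 0 then x 0 else - x j)"
proof (induction r arbitrary: x)
  case 0
  then show ?case by (auto simp: fin_seq_def fun_eq_iff)
next
  case (Suc r)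
  then show ?case using Suc.IH[OF fin_seq_lower_upper(1), of x]
    by (auto simp: fun_eq_iff dbl_def lower_def upper_def fin_seq_def)
qed

lemma fin_seq_seq_conj: "fin_seq r x \<Longrightarrow> fin_seq r (seq_conj r x)"
  by (simp add: seq_conj_eq) (auto simp: fin_seq_def)

lemma seq_conj_conj: "fin_seq r x \<Longrightarrow> seq_conj r (seq_conj r x) = x"
  using seq_conj_eq[OF fin_seq_seq_conj[of r x]] by (auto simp: seq_conj_eq fun_eq_iff)

lemma seq_conj_uminus: "seq_conj r (\<lambda>j. - x j) = (\<lambda>j. - seq_conj r x j)"
  using seq_conj_scale[where c = "-1"] by simp

lemma seq_mult_uminus:
  "seq_mult r (\<lambda>j. - x j) y = (\<lambda>j. - seq_mult r x y j)"
  "seq_mult r y (\<lambda>j. - x j) = (\<lambda>j. - seq_mult r y x j)"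
  using seq_mult_scale[where c = "-1"] by simp_all

lemma seq_conj_diff: "seq_conj r (\<lambda>j. x j - y j) = (\<lambda>j. seq_conj r x j - seq_conj r y j)"
  using seq_conj_add[of r x "\<lambda>j. - y j"] by (simp add: seq_conj_uminus)

lemma seq_zero: "seq_conj r (\<lambda>j. 0) = (\<lambda>j. 0)" "seq_mult r (\<lambda>j. 0) y = (\<lambda>j. 0)" "seq_mult r y (\<lambda>j. 0) = (\<lambda>j. 0)"
  using seq_conj_scale[where c = 0] seq_mult_scale[where c = 0] by simp_all

text \<open>The induction uses bilinearity and the involution at the lower level, but never
  associativity, so the rule holds at every level.\<close>

lemma seq_conj_mult:
  "fin_seq r x \<Longrightarrow> fin_seq r y \<Longrightarrow> seq_conj r (seq_mult r x y) = seq_mult r (seq_conj r y) (seq_conj r x)"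
proof (induction r arbitrary: x y)
  case 0
  then show ?case by (auto simp: fun_eq_iff)
next
  case (Suc r)
  define a b c d where abcd: "a = lower r x" "b = upper r x" "c = lower r y" "d = upper r y"
  have C: "fin_seq r a" "fin_seq r b" "fin_seq r c" "fin_seq r d" by (simp_all add: abcd fin_seq_lower_upper)
  have m: "seq_mult (Suc r) x y = dbl r (\<lambda>j. seq_mult r a c j - seq_mult r (seq_conj r d) b j)
      (\<lambda>j. seq_mult r d a j + seq_mult r b (seq_conj r c) j)"
    by (simp add: abcd Let_def)
  have car1: "fin_seq r (\<lambda>j. seq_mult r a c j - seq_mult r (seq_conj r d) b j)"
    "fin_seq r (\<lambda>j. seq_mult r d a j + seq_mult r b (seq_conj r c) j)" "fin_seq r (\<lambda>j. - b j)" "fin_seq r (\<lambda>j. - d j)"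
    using fin_seq_seq_mult C by (auto simp: fin_seq_def)
  have cx: "seq_conj (Suc r) x = dbl r (seq_conj r a) (\<lambda>j. - b j)" "seq_conj (Suc r) y = dbl r (seq_conj r c) (\<lambda>j. - d j)"
    by (simp_all add: abcd)
  have "seq_conj (Suc r) (seq_mult (Suc r) x y) = dbl r (seq_conj r (\<lambda>j. seq_mult r a c j - seq_mult r (seq_conj r d) b j))
      (\<lambda>j. - (seq_mult r d a j + seq_mult r b (seq_conj r c) j))"
    unfolding m by (simp add: lower_upper_dbl car1)
  also have "\<dots> = dbl r (\<lambda>j. seq_mult r (seq_conj r c) (seq_conj r a) j - seq_mult r (seq_conj r b) d j)
      (\<lambda>j. - (seq_mult r d a j + seq_mult r b (seq_conj r c) j))"
    by (simp add: seq_conj_diff Suc.IH C fin_seq_seq_conj seq_conj_conj)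
  also have "\<dots> = seq_mult (Suc r) (seq_conj (Suc r) y) (seq_conj (Suc r) x)"
    unfolding cx by (simp add: Let_def lower_upper_dbl fin_seq_seq_conj C car1 seq_conj_uminus seq_mult_uminus seq_conj_conj)
  finally show ?case .
qed

lemma lower_upper_unit_seq:
  "k < 2 ^ r \<Longrightarrow> lower r (unit_seq k) = unit_seq k" "k < 2 ^ r \<Longrightarrow> upper r (unit_seq k) = (\<lambda>j. 0)"
  "2 ^ r \<le> k \<Longrightarrow> lower r (unit_seq k) = (\<lambda>j. 0)" "2 ^ r \<le> k \<Longrightarrow> k < 2 ^ Suc r \<Longrightarrow> upper r (unit_seq k) = unit_seq (k - 2 ^ r)"
  by (auto simp: lower_def upper_def unit_seq_def fun_eq_iff)

lemma fin_seq_unit_seq: "k < 2 ^ r \<Longrightarrow> fin_seq r (unit_seq k)"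
  by (auto simp: fin_seq_def unit_seq_def)

lemma seq_conj_unit: "k < 2 ^ r \<Longrightarrow> seq_conj r (unit_seq k) = (\<lambda>j. sgn_unit k * unit_seq k j)"
  using seq_conj_eq[OF fin_seq_unit_seq[of k r]] by (auto simp: unit_seq_def sgn_unit_def fun_eq_iff)

lemma sgn_unit_sq: "sgn_unit k * sgn_unit k = 1"
  by (simp add: sgn_unit_def)

lemma seq_mult_one: "fin_seq r x \<Longrightarrow> seq_mult r (unit_seq 0) x = x \<and> seq_mult r x (unit_seq 0) = x"
proof (induction r arbitrary: x)
  case 0
  then show ?case by (auto simp: fin_seq_def unit_seq_def fun_eq_iff)
next
  case (Suc r)
  have 1: "seq_conj r (unit_seq 0) = unit_seq 0" using seq_conj_unit[of 0 r] by (simp add: sgn_unit_def)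
  show ?case using Suc.IH[OF fin_seq_lower_upper(1)] Suc.IH[OF fin_seq_lower_upper(2)] dbl_lower_upper[OF Suc.prems]
    by (simp add: Let_def lower_upper_unit_seq seq_zero 1)
qed

text \<open>The two statements are needed together: doubling mixes left and right multiplication.\<close>

lemma seq_mult_unit_unit:
  "fin_seq r x \<Longrightarrow> k < 2 ^ r \<Longrightarrow>
     seq_mult r (unit_seq k) (seq_mult r (unit_seq k) x) = (\<lambda>j. sgn_unit k * x j) \<and>
     seq_mult r (seq_mult r x (unit_seq k)) (unit_seq k) = (\<lambda>j. sgn_unit k * x j)"
proof (induction r arbitrary: x k)
  case 0
  then show ?case by (auto simp: fin_seq_def unit_seq_def sgn_unit_def fun_eq_iff)
next
  case (Suc r)
  define c d where cd: "c = lower r x" "d = upper r x"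
  have C: "fin_seq r c" "fin_seq r d" by (simp_all add: cd fin_seq_lower_upper)
  have x: "x = dbl r c d" using dbl_lower_upper[OF Suc.prems(1)] by (simp add: cd)
  have scale_dbl: "(\<lambda>j. s * dbl r p q j) = dbl r (\<lambda>j. s * p j) (\<lambda>j. s * q j)" for s p q
    by (auto simp: dbl_def)
  have minus_dbl: "(\<lambda>j. - dbl r p q j) = dbl r (\<lambda>j. - p j) (\<lambda>j. - q j)" for p q
    by (auto simp: dbl_def)
  have carm: "fin_seq r (\<lambda>j. - seq_mult r p q j)" "fin_seq r (\<lambda>j. s * seq_mult r p q j)"
    "fin_seq r (\<lambda>j. - (s * seq_mult r p q j))" for p q s
    by (auto simp: fin_seq_def seq_mult_vanishes)
  show ?case
  proof (cases "k < 2 ^ r")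
    case True
    let ?e = "unit_seq k"
    have e: "lower r ?e = ?e" "upper r ?e = (\<lambda>j. 0)" using lower_upper_unit_seq True by auto
    have L: "seq_mult (Suc r) ?e (dbl r p q) = dbl r (seq_mult r ?e p) (seq_mult r q ?e)" if "fin_seq r p" "fin_seq r q" for p q
      using that by (simp add: Let_def lower_upper_dbl e seq_zero)
    have R: "seq_mult (Suc r) (dbl r p q) ?e = dbl r (seq_mult r p ?e) (\<lambda>j. sgn_unit k * seq_mult r q ?e j)" if "fin_seq r p" "fin_seq r q" for p q
      using that True by (simp add: Let_def lower_upper_dbl e seq_zero seq_conj_unit seq_mult_scale)
    show ?thesis
      unfolding x using Suc.IH[OF C(1) True] Suc.IH[OF C(2) True] C
      by (simp add: L R fin_seq_seq_mult carm scale_dbl seq_mult_scale mult.assoc[symmetric] sgn_unit_sq del: seq_mult.simps)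
  next
    case False
    define k' where "k' = k - 2 ^ r"
    let ?e = "unit_seq k" and ?b = "unit_seq k'"
    have k': "k' < 2 ^ r" "sgn_unit k = - 1" using Suc.prems(2) False by (auto simp: k'_def sgn_unit_def)
    have e: "lower r ?e = (\<lambda>j. 0)" "upper r ?e = ?b" using lower_upper_unit_seq False Suc.prems(2) by (auto simp: k'_def)
    have cb: "seq_conj r ?b = (\<lambda>j. sgn_unit k' * ?b j)" "fin_seq r ?b" using k' by (simp_all add: seq_conj_unit fin_seq_unit_seq)
    have L: "seq_mult (Suc r) ?e (dbl r p q) = dbl r (\<lambda>j. - seq_mult r (seq_conj r q) ?b j) (seq_mult r ?b (seq_conj r p))" if "fin_seq r p" "fin_seq r q" for p q
      using that by (simp add: Let_def lower_upper_dbl e seq_zero)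
    have R: "seq_mult (Suc r) (dbl r p q) ?e = dbl r (\<lambda>j. - (sgn_unit k' * seq_mult r ?b q j)) (seq_mult r ?b p)" if "fin_seq r p" "fin_seq r q" for p q
      using that by (simp add: Let_def lower_upper_dbl e seq_zero cb seq_mult_scale)
    show ?thesis
      unfolding x using Suc.IH[OF C(1) k'(1)] Suc.IH[OF C(2) k'(1)] C
      by (simp add: L R fin_seq_seq_mult carm scale_dbl minus_dbl seq_mult_scale seq_mult_uminus seq_conj_uminus seq_conj_mult seq_conj_scale
          fin_seq_seq_conj seq_conj_conj cb k' mult.assoc[symmetric] sgn_unit_sq del: seq_mult.simps)
  qed
qed

text \<open>The real part of a product pairs \<open>x\<close> with the conjugate of
  \<open>y\<close>. Taking \<open>y\<close> to be the conjugate of a unit extracts a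
  coordinate.\<close>

lemma seq_mult_coord_0:
  "fin_seq r x \<Longrightarrow> fin_seq r y \<Longrightarrow> seq_mult r x y 0 = (\<Sum>j<2 ^ r. x j * seq_conj r y j)"
proof (induction r arbitrary: x y)
  case (Suc r)
  define a b c d where abcd: "a = lower r x" "b = upper r x" "c = lower r y" "d = upper r y"
  have C: "fin_seq r a" "fin_seq r b" "fin_seq r c" "fin_seq r d" by (simp_all add: abcd fin_seq_lower_upper)
  have "seq_mult r (seq_conj r d) b 0 = (\<Sum>j<2 ^ r. seq_conj r d j * seq_conj r b j)"
    using Suc.IH C fin_seq_seq_conj by blast
  also have "\<dots> = (\<Sum>j<2 ^ r. b j * d j)"
    using C by (intro sum.cong) (auto simp: seq_conj_eq)
  finally have "seq_mult (Suc r) x y 0 = (\<Sum>j<2 ^ r. a j * seq_conj r c j) - (\<Sum>j<2 ^ r. b j * d j)"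
    using Suc.IH C by (simp add: Let_def dbl_def abcd)
  also have "\<dots> = (\<Sum>j<2 ^ r. x j * seq_conj (Suc r) y j) + (\<Sum>j<2 ^ r. x (2 ^ r + j) * seq_conj (Suc r) y (2 ^ r + j))"
    by (simp add: abcd dbl_def lower_def upper_def sum_negf)
  also have "\<dots> = (\<Sum>j<2 ^ Suc r. x j * seq_conj (Suc r) y j)"
    using sum.atLeastLessThan_concat[of 0 "2 ^ r" "2 ^ Suc r" "\<lambda>j. x j * seq_conj (Suc r) y j"]
      sum.shift_bounds_nat_ivl[of "\<lambda>j. x j * seq_conj (Suc r) y j" 0 "2 ^ r" "2 ^ r"]
    by (simp add: lessThan_atLeast0 add.commute mult_2 del: seq_conj.simps)
  finally show ?case .
qed simp

section \<open>Arithmetic of the algebra and extraction of coordinates\<close>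

abbreviation cd_one :: "'r::finite cd" where "cd_one \<equiv> cd_unit 0"

lemma fin_seq_cd_coord: "fin_seq CARD('r) (cd_coord (x :: 'r::finite cd))"
  by (simp add: fin_seq_def cd_coord_vanishes)

lemma cd_coord_unit: "k < 2 ^ CARD('r) \<Longrightarrow> cd_coord (cd_unit k :: 'r::finite cd) = unit_seq k"
  by (auto simp: cd_unit.rep_eq unit_seq_def)

lemma cd_distrib: "(x + y) * z = x * z + y * z" "z * (x + y) = z * x + z * y" for x y z :: "'r::finite cd"
  by (simp_all add: cd_coord_inject[symmetric] times_cd.rep_eq plus_cd.rep_eq seq_mult_add)

lemma cd_scaleR: "(c *\<^sub>R x) * y = c *\<^sub>R (x * y)" "x * (c *\<^sub>R y) = c *\<^sub>R (x * y)" for x y :: "'r::finite cd"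
  by (simp_all add: cd_coord_inject[symmetric] times_cd.rep_eq scaleR_cd.rep_eq seq_mult_scale)

lemma cd_one_mult: "cd_one * x = x" for x :: "'r::finite cd"
  using seq_mult_one[OF fin_seq_cd_coord[of x]] by (simp add: cd_coord_inject[symmetric] times_cd.rep_eq cd_coord_unit)

lemma cd_zero_mult: "0 * x = 0" "x * 0 = 0" for x :: "'r::finite cd"
  using cd_scaleR(1)[of 0 0 x] cd_scaleR(2)[of x 0 0] by simp_all

text \<open>Put \<open>y = x i_k^*\<close>. Its real part is the coordinate \<open>x_k\<close>, and
  \<open>y = 2 y_0 - y^*\<close>, where \<open>y^* = i_k x^*\<close> by
  \<open>seq_conj_mult\<close>. Multiplying by \<open>i_k\<close> on the left and using
  \<open>i_k (i_k w) = i_k^2 w\<close>, which holds for units, gives the formula without any general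
  associativity.\<close>

lemma cd_unit_mult_conj:
  fixes x :: "'r::finite cd"
  assumes k: "k < 2 ^ CARD('r)"
  shows "cd_unit k * (x * (sgn_unit k *\<^sub>R cd_unit k))
    = (2 * cd_coord x k) *\<^sub>R cd_unit k - sgn_unit k *\<^sub>R ((2 * cd_coord x 0) *\<^sub>R cd_one - x)"
    and "cd_coord (x * (sgn_unit k *\<^sub>R cd_unit k)) 0 = cd_coord x k"
proof -
  let ?r = "CARD('r)" and ?x = "cd_coord x" and ?e = "unit_seq k"
  let ?c = "seq_conj ?r"
  have Cx: "fin_seq ?r ?x" and Ce: "fin_seq ?r ?e" using fin_seq_cd_coord fin_seq_unit_seq k by auto
  define y where "y = seq_mult ?r ?x (?c ?e)"
  have Cy: "fin_seq ?r y" by (simp add: y_def fin_seq_seq_mult)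
  have y0: "y 0 = ?x k"
  proof -
    have "y 0 = (\<Sum>j<2 ^ ?r. ?x j * ?e j)"
      unfolding y_def using seq_mult_coord_0[OF Cx fin_seq_seq_conj[OF Ce]] by (simp add: seq_conj_conj[OF Ce])
    also have "\<dots> = ?x k" using k by (simp add: unit_seq_def if_distrib cong: if_cong)
    finally show ?thesis .
  qed
  have cy: "?c y = seq_mult ?r ?e (?c ?x)"
    unfolding y_def using seq_conj_mult[OF Cx fin_seq_seq_conj[OF Ce]] by (simp add: seq_conj_conj[OF Ce])
  have "y = (\<lambda>j. 2 * y 0 * unit_seq 0 j + - ?c y j)"
    using seq_conj_eq[OF Cy] by (auto simp: unit_seq_def fun_eq_iff)
  then have "seq_mult ?r ?e y = seq_mult ?r ?e (\<lambda>j. 2 * ?x k * unit_seq 0 j + - seq_mult ?r ?e (?c ?x) j)"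
    unfolding y0 cy by (rule arg_cong)
  also have "\<dots> = (\<lambda>j. 2 * ?x k * ?e j - sgn_unit k * ?c ?x j)"
    using seq_mult_one[OF Ce] seq_mult_unit_unit[OF fin_seq_seq_conj[OF Cx] k]
    by (simp only: seq_mult_add seq_mult_scale seq_mult_uminus) simp
  finally have ey: "seq_mult ?r ?e y = (\<lambda>j. 2 * ?x k * ?e j - sgn_unit k * ?c ?x j)" .
  have xe: "cd_coord (x * (sgn_unit k *\<^sub>R cd_unit k)) = y"
    unfolding y_def using k by (simp add: times_cd.rep_eq scaleR_cd.rep_eq cd_coord_unit seq_conj_unit)
  then show "cd_coord (x * (sgn_unit k *\<^sub>R cd_unit k)) 0 = cd_coord x k" using y0 by simp
  have cx: "?c ?x = (\<lambda>j. 2 * ?x 0 * unit_seq 0 j - ?x j)"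
    using seq_conj_eq[OF Cx] by (auto simp: unit_seq_def fun_eq_iff)
  show "cd_unit k * (x * (sgn_unit k *\<^sub>R cd_unit k))
    = (2 * cd_coord x k) *\<^sub>R cd_unit k - sgn_unit k *\<^sub>R ((2 * cd_coord x 0) *\<^sub>R cd_one - x)"
    unfolding cd_coord_inject[symmetric] times_cd.rep_eq[of "cd_unit k"] xe
    using k ey cx by (simp add: cd_coord_unit scaleR_cd.rep_eq minus_cd.rep_eq)
qed

lemma cd_representation: "(\<Sum>k<2 ^ CARD('r). cd_coord x k *\<^sub>R cd_unit k) = x" for x :: "'r::finite cd"
proof -
  have "(\<Sum>b\<in>Basis. (x \<bullet> b) *\<^sub>R b) = (\<Sum>k<2 ^ CARD('r). (x \<bullet> cd_unit k) *\<^sub>R cd_unit k)"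
    unfolding Basis_cd_def
  proof (subst sum.reindex)
    show "inj_on (cd_unit :: nat \<Rightarrow> 'r cd) {..<2 ^ CARD('r)}"
    proof (rule inj_onI)
      fix i j assume "i \<in> {..<2 ^ CARD('r)}" "j \<in> {..<2 ^ CARD('r)}" "cd_unit i = (cd_unit j :: 'r cd)"
      then have "unit_seq i i = unit_seq j i" using cd_coord_unit[where 'r='r] by (metis lessThan_iff)
      then show "i = j" by (simp add: unit_seq_def split: if_splits)
    qed
  qed simp
  then show ?thesis by (simp add: euclidean_representation inner_cd_unit)
qed

lemma sum_sgn_unit: "(\<Sum>k<2 ^ r. sgn_unit k) = 2 - 2 ^ r"
proof -
  have "(\<Sum>k<Suc n. sgn_unit k) = 1 - real n" for n by (induction n) (auto simp: sgn_unit_def)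
  from this[of "2 ^ r - 1"] show ?thesis by (simp add: of_nat_diff)
qed

text \<open>This is the formula $w^* = (2^r-2)^{-1}(-w + \sum_{k \ge 1} i_k (w i_k^*))$, solved for the real part.\<close>

lemma cd_real_part:
  fixes x :: "'r::finite cd"
  assumes "2 \<le> CARD('r)"
  shows "cd_coord x 0 *\<^sub>R cd_one = (1 / (2 * (2 ^ CARD('r) - 2))) *\<^sub>R
    ((\<Sum>k<2 ^ CARD('r). cd_unit k * (x * (sgn_unit k *\<^sub>R cd_unit k))) + (2 ^ CARD('r) - 4) *\<^sub>R x)"
proof -
  define N :: real where "N = 2 ^ CARD('r)"
  \<comment> \<open>At level 1 the divisor \<open>2 * (N - 2)\<close> would be zero.\<close>
  have "2 ^ 2 \<le> N" unfolding N_def using assms by (intro power_increasing) auto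
  then have N: "2 * (N - 2) \<noteq> 0" by simp
  \<comment> \<open>The term with k = 0 is \<open>x\<close> itself. In total the sum is
    \<open>2 x + (N - 2) x^*\<close> with \<open>x^* = 2 x_0 - x\<close>, which explains the
    correction \<open>(N - 4) *\<^sub>R x\<close>.\<close>
  have "(\<Sum>k<2 ^ CARD('r). cd_unit k * (x * (sgn_unit k *\<^sub>R cd_unit k)))
      = (\<Sum>k<2 ^ CARD('r). 2 *\<^sub>R (cd_coord x k *\<^sub>R cd_unit k)) - (\<Sum>k<2 ^ CARD('r). sgn_unit k *\<^sub>R ((2 * cd_coord x 0) *\<^sub>R cd_one - x))"
    unfolding sum_subtractf[symmetric] by (intro sum.cong refl) (simp add: cd_unit_mult_conj(1))
  also have "\<dots> = 2 *\<^sub>R x - (2 - N) *\<^sub>R ((2 * cd_coord x 0) *\<^sub>R cd_one - x)"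
    unfolding scaleR_right.sum[symmetric] cd_representation scaleR_left.sum[symmetric] sum_sgn_unit N_def ..
  also have "\<dots> + (N - 4) *\<^sub>R x = (2 * (N - 2)) *\<^sub>R (cd_coord x 0 *\<^sub>R cd_one)"
    by (simp add: algebra_simps) (simp flip: scaleR_add_left)
  finally show ?thesis using N unfolding N_def[symmetric] by simp
qed

section \<open>Finite sums of words of one degree\<close>

definition phrase :: "nat \<Rightarrow> ('r::finite cd ^ 'l::finite \<Rightarrow> 'r cd) \<Rightarrow> bool" where
  "phrase q f \<longleftrightarrow> (\<exists>ws. (\<forall>w\<in>set ws. word_degree w = q) \<and> (\<forall>z. f z = (\<Sum>w\<leftarrow>ws. word_eval w z)))"

lemma phrase_zero: "phrase q (\<lambda>z. 0)"
  unfolding phrase_def by (intro exI[of _ "[]"]) simp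

lemma phrase_const: "phrase 0 (\<lambda>z. c)"
  unfolding phrase_def by (intro exI[of _ "[Const c]"]) simp

lemma phrase_var: "phrase 1 (\<lambda>z. z $ p)"
  unfolding phrase_def by (intro exI[of _ "[Var p]"]) simp

lemma phrase_add: "phrase q f \<Longrightarrow> phrase q g \<Longrightarrow> phrase q (\<lambda>z. f z + g z)"
  unfolding phrase_def
proof (elim exE conjE)
  fix us ws assume "\<forall>w\<in>set us. word_degree w = q" "\<forall>z. f z = (\<Sum>w\<leftarrow>us. word_eval w z)"
    "\<forall>w\<in>set ws. word_degree w = q" "\<forall>z. g z = (\<Sum>w\<leftarrow>ws. word_eval w z)"
  then show "\<exists>ws. (\<forall>w\<in>set ws. word_degree w = q) \<and> (\<forall>z. f z + g z = (\<Sum>w\<leftarrow>ws. word_eval w z))"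
    by (intro exI[of _ "us @ ws"]) auto
qed

lemma phrase_sum: "(\<And>i. i \<in> A \<Longrightarrow> phrase q (f i)) \<Longrightarrow> phrase q (\<lambda>z. \<Sum>i\<in>A. f i z)"
  by (induction A rule: infinite_finite_induct) (auto intro: phrase_zero phrase_add)

lemma sum_list_mult:
  "(\<Sum>u\<leftarrow>us. word_eval u z) * (\<Sum>w\<leftarrow>ws. word_eval w z)
    = (\<Sum>v\<leftarrow>concat (map (\<lambda>u. map (Mult u) ws) us). word_eval v z)"
proof (induction us)
  case (Cons u us)
  have "word_eval u z * (\<Sum>w\<leftarrow>ws. word_eval w z) = (\<Sum>v\<leftarrow>map (Mult u) ws. word_eval v z)"
    by (induction ws) (auto simp: cd_distrib cd_zero_mult)
  then show ?case using Cons by (simp add: cd_distrib)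
qed (simp add: cd_zero_mult)

lemma phrase_mult: "phrase q f \<Longrightarrow> phrase q' g \<Longrightarrow> phrase (q + q') (\<lambda>z. f z * g z)"
  unfolding phrase_def
proof (elim exE conjE)
  fix us ws assume "\<forall>w\<in>set us. word_degree w = q" "\<forall>z. f z = (\<Sum>w\<leftarrow>us. word_eval w z)"
    "\<forall>w\<in>set ws. word_degree w = q'" "\<forall>z. g z = (\<Sum>w\<leftarrow>ws. word_eval w z)"
  then show "\<exists>ws. (\<forall>w\<in>set ws. word_degree w = q + q') \<and> (\<forall>z. f z * g z = (\<Sum>w\<leftarrow>ws. word_eval w z))"
    by (intro exI[of _ "concat (map (\<lambda>u. map (Mult u) ws) us)"]) (auto simp: sum_list_mult)
qed

lemma phrase_scaleR: "phrase q f \<Longrightarrow> phrase q (\<lambda>z. c *\<^sub>R f z)"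
  using phrase_mult[OF phrase_const[of "c *\<^sub>R cd_one"], of q f] by (simp add: cd_scaleR cd_one_mult)

lemma phrase_real_part:
  fixes f :: "'r::finite cd ^ 'l::finite \<Rightarrow> 'r cd"
  assumes "2 \<le> CARD('r)" "phrase q f"
  shows "phrase q (\<lambda>z. cd_coord (f z) 0 *\<^sub>R cd_one)"
proof -
  have "phrase q (\<lambda>z. cd_unit k * (f z * (sgn_unit k *\<^sub>R cd_unit k)))" for k
    using phrase_mult[OF phrase_const phrase_mult[OF assms(2) phrase_const]] by simp
  then show ?thesis
    unfolding cd_real_part[OF assms(1)] by (intro phrase_scaleR phrase_add phrase_sum assms(2))
qed

text \<open>The real part of \<open>z_p i_j^*\<close> is the \<open>j\<close>-th coordinate of the
  component \<open>p\<close>, and real parts of phrases are phrases by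
  \<open>cd_real_part\<close>.\<close>

lemma phrase_coord:
  fixes b :: "'r::finite cd ^ 'l::finite"
  assumes "2 \<le> CARD('r)" "b \<in> Basis"
  shows "phrase 1 (\<lambda>z. (z \<bullet> b) *\<^sub>R (cd_one :: 'r cd))"
proof -
  obtain p j where b: "b = axis p (cd_unit j)" and j: "j < 2 ^ CARD('r)"
    using assms(2) unfolding Basis_cd_power by blast
  have "phrase (1 + 0) (\<lambda>z :: 'r cd ^ 'l. z $ p * (sgn_unit j *\<^sub>R cd_unit j))"
    by (rule phrase_mult[OF phrase_var phrase_const])
  from phrase_real_part[OF assms(1) this] show ?thesis
    using j by (simp add: b inner_axis_cd_unit cd_unit_mult_conj(2))
qed

lemma phrase_lmono:
  fixes c :: "'r::finite cd" and bs :: "('r cd ^ 'l::finite) list"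
  assumes "2 \<le> CARD('r)" "set bs \<subseteq> Basis"
  shows "phrase (length bs) (\<lambda>z. lmono bs z *\<^sub>R c)"
  using assms(2)
proof (induction bs)
  case (Cons b bs)
  then have "phrase (1 + length bs) (\<lambda>z. ((z \<bullet> b) *\<^sub>R cd_one) * (lmono bs z *\<^sub>R c))"
    by (intro phrase_mult phrase_coord assms(1)) auto
  then show ?case by (simp add: cd_scaleR cd_one_mult mult.commute)
qed (simp add: phrase_const)

lemma phrase_hp:
  fixes c :: "'r::finite cd" and p :: "'r cd ^ 'l::finite \<Rightarrow> real"
  assumes "2 \<le> CARD('r)" "hpoly q \<beta> p"
  shows "phrase q (\<lambda>z. p z *\<^sub>R c)"
proof -
  obtain a where "\<And>t. p t = (\<Sum>bs\<in>blists q. a bs * lmono bs t)" using assms(2) unfolding hpoly_def by blast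
  then have "p z *\<^sub>R c = (\<Sum>bs\<in>blists q. a bs *\<^sub>R (lmono bs z *\<^sub>R c))" for z
    by (simp add: scaleR_sum_left)
  moreover have "phrase q (\<lambda>z. \<Sum>bs\<in>blists q. a bs *\<^sub>R (lmono bs z *\<^sub>R c))"
    by (intro phrase_sum phrase_scaleR) (use phrase_lmono[OF assms(1)] in auto)
  ultimately show ?thesis by simp
qed

text \<open>The finitely many real components get a common rate, their maximum. On the ball of
  radius \<open>1 / (2 * K)\<close> the bounds on the terms shrink by 1/2 per degree, which gives
  the uniform convergence required of the series of words.\<close>

lemma cd_analytic_onI:
  fixes F :: "'r::finite cd \<Rightarrow> 'r cd ^ 'l::finite \<Rightarrow> real"
  assumes r: "2 \<le> CARD('r)" and U: "open U"
    and F: "\<And>c \<xi>. c \<in> Basis \<Longrightarrow> \<xi> \<in> U \<Longrightarrow> \<exists>B K. analytic \<xi> B K (F c)"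
  shows "cd_analytic_on (\<lambda>z. \<Sum>c\<in>Basis. F c z *\<^sub>R c) U"
  unfolding cd_analytic_on_def
proof
  fix \<xi> assume \<xi>: "\<xi> \<in> U"
  have "\<forall>c\<in>Basis. \<exists>BK. analytic \<xi> (fst BK) (snd BK) (F c)" using F[OF _ \<xi>] by force
  from bchoice[OF this] obtain BK where BK: "\<And>c. c \<in> Basis \<Longrightarrow> analytic \<xi> (fst (BK c)) (snd (BK c)) (F c)" by blast
  define B where "B = (\<lambda>c. fst (BK c))"
  define K where "K = Max ((\<lambda>c. snd (BK c)) ` (Basis :: 'r cd set))"
  have anK: "analytic \<xi> (B c) K (F c)" if "c \<in> Basis" for c
    by (rule analytic_weaken[OF BK[OF that]]) (use that in \<open>auto simp: B_def K_def\<close>)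
  then have "\<forall>c\<in>Basis. \<exists>p. (\<forall>q. hpoly q (B c * K ^ q) (p q)) \<and> (\<forall>t. K * norm t < 1 \<longrightarrow> (\<lambda>q. p q t) sums F c (\<xi> + t))"
    unfolding analytic_def by blast
  from bchoice[OF this] obtain p where
    p: "\<forall>c\<in>Basis. (\<forall>q. hpoly q (B c * K ^ q) (p c q)) \<and> (\<forall>t. K * norm t < 1 \<longrightarrow> (\<lambda>q. p c q t) sums F c (\<xi> + t))" by blast
  have K: "0 < K" using anK SOME_Basis by (auto simp: analytic_def)
  have "\<forall>q. \<exists>ws. (\<forall>w\<in>set ws. word_degree w = q) \<and> (\<forall>z. (\<Sum>c\<in>Basis. p c q z *\<^sub>R c) = (\<Sum>w\<leftarrow>ws. word_eval w z))"
    unfolding phrase_def[symmetric] by (intro allI phrase_sum phrase_hp[OF r]) (use p in blast)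
  from choice[OF this] obtain P where P: "\<And>q w. w \<in> set (P q) \<Longrightarrow> word_degree w = q"
    "\<And>q z. (\<Sum>c\<in>Basis. p c q z *\<^sub>R c) = (\<Sum>w\<leftarrow>P q. word_eval w z)" by blast
  define W where "W = U \<inter> ball \<xi> (1 / (2 * K))"
  have t: "K * norm (z - \<xi>) \<le> 1 / 2" if "z \<in> W" for z
    using that K by (auto simp: W_def dist_norm norm_minus_commute field_simps)
  have "uniform_limit W (\<lambda>N z. \<Sum>q<N. \<Sum>c\<in>Basis. p c q (z - \<xi>) *\<^sub>R c) (\<lambda>z. \<Sum>q. \<Sum>c\<in>Basis. p c q (z - \<xi>) *\<^sub>R c) sequentially"
  proof (rule Weierstrass_m_test)
    show "norm (\<Sum>c\<in>Basis. p c q (z - \<xi>) *\<^sub>R c) \<le> (\<Sum>c\<in>(Basis :: 'r cd set). B c) * (1 / 2) ^ q" if "z \<in> W" for q z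
      unfolding sum_distrib_right
    proof (rule sum_norm_le)
      fix c :: "'r cd" assume c: "c \<in> Basis"
      have h: "hpoly q (B c * K ^ q) (p c q)" using p c by blast
      have "hpoly 0 (B c * K ^ 0) (p c 0)" using p c by blast
      from hpoly_nonneg[OF this] have B0: "0 \<le> B c" by simp
      have "\<bar>p c q (z - \<xi>)\<bar> \<le> B c * (K * norm (z - \<xi>)) ^ q"
        using hpoly_bound[OF h, of "z - \<xi>"] by (simp add: power_mult_distrib)
      also have "\<dots> \<le> B c * (1 / 2) ^ q" using t[OF that] K B0 by (intro mult_left_mono power_mono) auto
      finally show "norm (p c q (z - \<xi>) *\<^sub>R c) \<le> B c * (1 / 2) ^ q" using c by simp
    qed
    show "summable (\<lambda>q. (\<Sum>c\<in>(Basis :: 'r cd set). B c) * (1 / 2) ^ q)"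
      by (intro summable_mult summable_geometric) simp
  qed
  moreover have "(\<Sum>q. \<Sum>c\<in>Basis. p c q (z - \<xi>) *\<^sub>R c) = (\<Sum>c\<in>Basis. F c z *\<^sub>R c)" if z: "z \<in> W" for z
  proof -
    have "K * norm (z - \<xi>) < 1" using t[OF z] by linarith
    then have "(\<lambda>q. p c q (z - \<xi>)) sums F c z" if "c \<in> Basis" for c
      using p[rule_format, OF that] by (metis add_diff_cancel_left' add_diff_eq)
    then have "(\<lambda>q. \<Sum>c\<in>Basis. p c q (z - \<xi>) *\<^sub>R c) sums (\<Sum>c\<in>Basis. F c z *\<^sub>R c)"
      by (intro sums_sum bounded_linear.sums[OF bounded_linear_scaleR_left])
    then show ?thesis by (simp add: sums_iff)
  qed
  then have "uniform_limit W (\<lambda>N z. \<Sum>q<N. \<Sum>c\<in>Basis. p c q (z - \<xi>) *\<^sub>R c) (\<lambda>z. \<Sum>q. \<Sum>c\<in>Basis. p c q (z - \<xi>) *\<^sub>R c) sequentially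
      \<longleftrightarrow> uniform_limit W (\<lambda>N z. \<Sum>q<N. \<Sum>c\<in>Basis. p c q (z - \<xi>) *\<^sub>R c) (\<lambda>z. \<Sum>c\<in>Basis. F c z *\<^sub>R c) sequentially"
    by (intro uniform_limit_cong') simp_all
  ultimately have "uniform_limit W (\<lambda>N z. \<Sum>q<N. \<Sum>w\<leftarrow>P q. word_eval w (z - \<xi>)) (\<lambda>z. \<Sum>c\<in>Basis. F c z *\<^sub>R c) sequentially"
    unfolding P(2)[symmetric] by blast
  then show "\<exists>W. open W \<and> \<xi> \<in> W \<and> W \<subseteq> U \<and> (\<exists>P. (\<forall>q. \<forall>w\<in>set (P q). word_degree w = q) \<and>
        uniform_limit W (\<lambda>N z. \<Sum>q<N. \<Sum>w\<leftarrow>P q. word_eval w (z - \<xi>)) (\<lambda>z. \<Sum>c\<in>Basis. F c z *\<^sub>R c) sequentially)"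
    using U \<xi> K P(1) by (intro exI[of _ W] conjI exI[of _ P]) (auto simp: W_def)
qed

section \<open>Vector-valued jets\<close>

text \<open>Meant for the coordinate functionals and the two projections of the complexified
  algebra. These do not increase norms, so the same \<delta> works.\<close>

lemma class_C_fin_linear:
  assumes L: "bounded_linear L" and le: "\<And>x. norm (L x) \<le> norm x" and f: "class_C_fin m V f"
  shows "class_C_fin m V (\<lambda>k z. L (f k z))"
proof -
  have "taylor_rem m (\<lambda>k z. L (f k z)) k y z = L (taylor_rem m f k y z)" for k y z
    using L by (simp add: taylor_rem_def linear_diff linear_sum linear_scale bounded_linear.linear)
  then have le': "norm (taylor_rem m (\<lambda>k z. L (f k z)) k y z) \<le> norm (taylor_rem m f k y z)" for k y z
    using le by simp
  show ?thesis unfolding class_C_fin_def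
  proof (intro ballI allI impI)
    fix z and \<epsilon> :: real assume "z \<in> V" "0 < \<epsilon>"
    from f[unfolded class_C_fin_def, rule_format, OF this] obtain \<delta> where "0 < \<delta>" and
      D: "\<forall>x\<in>V. \<forall>y\<in>V. norm (x - z) < \<delta> \<and> norm (y - z) < \<delta> \<longrightarrow> (\<forall>k\<in>mindices. mlength k \<le> m \<longrightarrow>
        norm (taylor_rem m f k x y) \<le> norm (x - y) ^ (m - mlength k) * \<epsilon>)" by (elim exE conjE)
    then show "\<exists>\<delta>>0. \<forall>x\<in>V. \<forall>y\<in>V. norm (x - z) < \<delta> \<and> norm (y - z) < \<delta> \<longrightarrow> (\<forall>k\<in>mindices. mlength k \<le> m \<longrightarrow>
        norm (taylor_rem m (\<lambda>k z. L (f k z)) k x y) \<le> norm (x - y) ^ (m - mlength k) * \<epsilon>)"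
      by (intro exI[of _ \<delta>] conjI ballI impI order_trans[OF le']) simp_all
  qed
qed

lemma class_C_linear:
  assumes "bounded_linear L" "\<And>x. norm (L x) \<le> norm x" "class_C m V f"
  shows "class_C m V (\<lambda>k z. L (f k z))"
  using class_C_fin_linear[OF assms(1,2)] assms(3) by (cases m) (auto simp: class_C_def)

lemma cont_diff_on_iff_all_Ck: "cont_diff_on m U f \<longleftrightarrow> (\<forall>n. enat n \<le> m \<longrightarrow> Ck n U f)"
proof (cases m)
  case (enat N)
  then show ?thesis using Ck_lower[of N U f] by (auto simp: cont_diff_on_iff_Ck)
qed (simp add: cont_diff_on_infinity)

text \<open>Spells out a multi-index in the order fixed by \<open>basis_list\<close>, so that
  results about lists of directions apply to \<open>mpderiv\<close>.\<close>

definition mlist :: "'a::euclidean_space mindex \<Rightarrow> 'a list" where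
  "mlist k = concat (map (\<lambda>b. replicate (k b) b) basis_list)"

lemma mpderiv_mlist: "mpderiv k G = pderivs (mlist k) G"
  by (simp add: mpderiv_def mlist_def)

lemma mlist:
  fixes k :: "'a::euclidean_space mindex"
  assumes "k \<in> mindices"
  shows "set (mlist k) \<subseteq> Basis" "length (mlist k) = mlength k" "mcount (mlist k) = k"
proof -
  have "\<exists>bs :: 'a list. distinct bs \<and> set bs = Basis"
    using finite_distinct_list[OF finite_Basis] by blast
  from someI_ex[OF this] have bl: "distinct (basis_list :: 'a list)" "set (basis_list :: 'a list) = Basis"
    unfolding basis_list_def by auto
  have cr: "count_list (replicate n b) c = (if b = c then n else 0)" for n and b c :: 'a
    by (induction n) auto
  have cl: "count_list (concat (map (\<lambda>b. replicate (k b) b) L)) c = (if c \<in> set L then k c else 0)"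
    if "distinct L" for L and c :: 'a
    using that by (induction L) (auto simp: cr)
  show mcount: "mcount (mlist k) = k"
  proof (rule ext)
    show "mcount (mlist k) c = k c" for c
      unfolding mcount_def mlist_def cl[OF bl(1)] bl(2) using assms by (simp add: mindices_def)
  qed
  show sub: "set (mlist k) \<subseteq> Basis" 
  proof
    fix c assume "c \<in> set (mlist k)"
    then obtain b where "b \<in> set basis_list" "c \<in> set (replicate (k b) b)" unfolding mlist_def by auto
    then show "c \<in> Basis" using bl(2) in_set_replicate[of c "k b" b] by metis
  qed
  show "length (mlist k) = mlength k" using mlength_mi[OF sub] mcount by simp
qed

lemma cd_whitney_extension:
  fixes V :: "('r::finite cd ^ 'l::finite) set" and f :: "('r cd ^ 'l) mindex \<Rightarrow> 'r cd ^ 'l \<Rightarrow> 'r cd"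
  assumes r: "2 \<le> CARD('r)" and V: "closed V" and f: "class_C m V f"
  shows "\<exists>F. cont_diff_on m UNIV F \<and>
    (\<forall>z\<in>V. \<forall>k\<in>mindices. enat (mlength k) \<le> m \<longrightarrow> mpderiv k F z = f k z) \<and> cd_analytic_on F (UNIV - V)"
proof -
  have "\<forall>c\<in>Basis. \<exists>F. (\<forall>n. enat n \<le> m \<longrightarrow> Ck n UNIV F) \<and>
    (\<forall>bs z. set bs \<subseteq> Basis \<longrightarrow> enat (length bs) \<le> m \<longrightarrow> z \<in> V \<longrightarrow> pderivs bs F z = f (mcount bs) z \<bullet> c) \<and>
    (\<forall>\<xi>. \<xi> \<notin> V \<longrightarrow> (\<exists>B K. analytic \<xi> B K F))"
  proof
    fix c :: "'r cd" assume "c \<in> Basis"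
    then have "norm (x \<bullet> c) \<le> norm x" for x using Basis_le_norm by simp
    from class_C_linear[OF bounded_linear_inner_left this f]
    show "\<exists>F. (\<forall>n. enat n \<le> m \<longrightarrow> Ck n UNIV F) \<and>
      (\<forall>bs z. set bs \<subseteq> Basis \<longrightarrow> enat (length bs) \<le> m \<longrightarrow> z \<in> V \<longrightarrow> pderivs bs F z = f (mcount bs) z \<bullet> c) \<and>
      (\<forall>\<xi>. \<xi> \<notin> V \<longrightarrow> (\<exists>B K. analytic \<xi> B K F))"
      by (rule whitney_analytic_extension[OF V])
  qed
  from bchoice[OF this] obtain F where F: "\<And>c n. c \<in> Basis \<Longrightarrow> enat n \<le> m \<Longrightarrow> Ck n UNIV (F c)"
    "\<And>c bs z. c \<in> Basis \<Longrightarrow> set bs \<subseteq> Basis \<Longrightarrow> enat (length bs) \<le> m \<Longrightarrow> z \<in> V \<Longrightarrow> pderivs bs (F c) z = f (mcount bs) z \<bullet> c"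
    "\<And>c \<xi>. c \<in> Basis \<Longrightarrow> \<xi> \<notin> V \<Longrightarrow> \<exists>B K. analytic \<xi> B K (F c)" by blast
  let ?F = "\<lambda>z. \<Sum>c\<in>Basis. F c z *\<^sub>R c"
  have CF: "Ck n UNIV (\<lambda>z. F c z *\<^sub>R c)" if "c \<in> Basis" "enat n \<le> m" for c n
    by (rule Ck_linear[OF bounded_linear_scaleR_left open_UNIV F(1)[OF that]])
  have "cont_diff_on m UNIV ?F"
    unfolding cont_diff_on_iff_all_Ck by (intro allI impI Ck_sum open_UNIV CF)
  moreover have "mpderiv k ?F z = f k z" if z: "z \<in> V" and k: "k \<in> mindices" "enat (mlength k) \<le> m" for z k
  proof -
    let ?bs = "mlist k"
    note bs = mlist[OF k(1)]
    have m: "enat (length ?bs) \<le> m" using bs k by simp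
    have "pderivs ?bs ?F z = (\<Sum>c\<in>Basis. pderivs ?bs (\<lambda>z. F c z *\<^sub>R c) z)"
      by (rule pderivs_sum[OF open_UNIV UNIV_I CF[OF _ m] bs(1) order_refl])
    also have "\<dots> = (\<Sum>c\<in>Basis. (f k z \<bullet> c) *\<^sub>R c)"
    proof (rule sum.cong[OF refl])
      fix c :: "'r cd" assume c: "c \<in> Basis"
      have "pderivs ?bs (\<lambda>z. F c z *\<^sub>R c) z = pderivs ?bs (F c) z *\<^sub>R c"
        by (rule pderivs_linear[OF bounded_linear_scaleR_left open_UNIV UNIV_I F(1)[OF c m] bs(1) order_refl])
      then show "pderivs ?bs (\<lambda>z. F c z *\<^sub>R c) z = (f k z \<bullet> c) *\<^sub>R c"
        using F(2)[OF c bs(1) m z] bs(3) by simp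
    qed
    also have "\<dots> = f k z" by (rule euclidean_representation)
    finally show ?thesis by (simp add: mpderiv_mlist)
  qed
  moreover have "cd_analytic_on ?F (UNIV - V)"
    by (rule cd_analytic_onI[OF r]) (use V F(3) in \<open>auto intro: open_Diff\<close>)
  ultimately show ?thesis by (intro exI[of _ ?F]) blast
qed

theorem theorem6:
  fixes V :: "('r::finite cd ^ 'l::finite) set"
    and m :: enat
    and f :: "('r cd ^ 'l) mindex \<Rightarrow> 'r cd ^ 'l \<Rightarrow> 'r cd"
    and g :: "('r cd ^ 'l) mindex \<Rightarrow> 'r cd ^ 'l \<Rightarrow> 'r cd_complex"
  assumes "3 \<le> CARD('r)" and "closed V"
  shows "(class_C m V f \<longrightarrow>
      (\<exists>F :: 'r cd ^ 'l \<Rightarrow> 'r cd.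
        cont_diff_on m UNIV F \<and>
        (\<forall>z\<in>V. \<forall>k\<in>mindices. enat (mlength k) \<le> m \<longrightarrow> mpderiv k F z = f k z) \<and>
        cd_analytic_on F (UNIV - V))) \<and>
    (class_C m V g \<longrightarrow>
      (\<exists>G :: 'r cd ^ 'l \<Rightarrow> 'r cd_complex.
        cont_diff_on m UNIV G \<and>
        (\<forall>z\<in>V. \<forall>k\<in>mindices. enat (mlength k) \<le> m \<longrightarrow> mpderiv k G z = g k z) \<and>
        cd_complex_analytic_on G (UNIV - V)))"
proof (intro conjI impI)
  have r: "2 \<le> CARD('r)" using assms(1) by simp
  show "\<exists>F :: 'r cd ^ 'l \<Rightarrow> 'r cd. cont_diff_on m UNIV F \<and>
      (\<forall>z\<in>V. \<forall>k\<in>mindices. enat (mlength k) \<le> m \<longrightarrow> mpderiv k F z = f k z) \<and> cd_analytic_on F (UNIV - V)"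
    if "class_C m V f"
    by (rule cd_whitney_extension[OF r assms(2) that])
  assume g: "class_C m V g"
  have n: "norm (fst x) \<le> norm x" "norm (snd x) \<le> norm x" for x :: "'r cd_complex"
    using norm_fst_le[of "fst x" "snd x"] norm_snd_le[of "snd x" "fst x"] by simp_all
  have "class_C m V (\<lambda>k z. fst (g k z))" "class_C m V (\<lambda>k z. snd (g k z))"
    by (rule class_C_linear[OF bounded_linear_fst n(1) g], rule class_C_linear[OF bounded_linear_snd n(2) g])
  from cd_whitney_extension[OF r assms(2) this(1)] cd_whitney_extension[OF r assms(2) this(2)]
  obtain F1 F2 where
    F1: "cont_diff_on m UNIV F1" "\<And>z k. z\<in>V \<Longrightarrow> k\<in>mindices \<Longrightarrow> enat (mlength k) \<le> m \<Longrightarrow> mpderiv k F1 z = fst (g k z)"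
      "cd_analytic_on F1 (UNIV - V)" and
    F2: "cont_diff_on m UNIV F2" "\<And>z k. z\<in>V \<Longrightarrow> k\<in>mindices \<Longrightarrow> enat (mlength k) \<le> m \<Longrightarrow> mpderiv k F2 z = snd (g k z)"
      "cd_analytic_on F2 (UNIV - V)"
    by blast
  \<comment> \<open>Written as a sum of two linear images, so that the rules for sums and for
    bounded linear maps yield its smoothness and its derivatives.\<close>
  let ?G = "\<lambda>z. (F1 z, 0) + (0, F2 z)"
  have L: "bounded_linear (\<lambda>x::'r cd. (x, 0::'r cd))" "bounded_linear (\<lambda>x::'r cd. (0::'r cd, x))"
    by (intro bounded_linear_Pair bounded_linear_ident bounded_linear_zero)+
  have C: "Ck n UNIV F1" "Ck n UNIV F2" if "enat n \<le> m" for n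
    using F1(1) F2(1) that by (auto simp: cont_diff_on_iff_all_Ck)
  have "cont_diff_on m UNIV ?G"
    unfolding cont_diff_on_iff_all_Ck
    by (intro allI impI Ck_add open_UNIV Ck_linear[OF L(1)] Ck_linear[OF L(2)] C)
  moreover have "mpderiv k ?G z = g k z" if z: "z \<in> V" and k: "k \<in> mindices" "enat (mlength k) \<le> m" for z k
  proof -
    let ?bs = "mlist k"
    note bs = mlist[OF k(1)]
    have m: "enat (length ?bs) \<le> m" using bs k by simp
    have "pderivs ?bs ?G z = pderivs ?bs (\<lambda>z. (F1 z, 0)) z + pderivs ?bs (\<lambda>z. (0, F2 z)) z"
      by (rule pderivs_add[OF open_UNIV UNIV_I Ck_linear[OF L(1) open_UNIV C(1)[OF m]] Ck_linear[OF L(2) open_UNIV C(2)[OF m]] bs(1) order_refl])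
    also have "pderivs ?bs (\<lambda>z. (F1 z, 0 :: 'r cd)) z = (pderivs ?bs F1 z, 0)"
      by (rule pderivs_linear[OF L(1) open_UNIV UNIV_I C(1)[OF m] bs(1) order_refl])
    also have "pderivs ?bs (\<lambda>z. (0 :: 'r cd, F2 z)) z = (0, pderivs ?bs F2 z)"
      by (rule pderivs_linear[OF L(2) open_UNIV UNIV_I C(2)[OF m] bs(1) order_refl])
    finally show ?thesis using F1(2)[OF z k] F2(2)[OF z k] by (simp add: mpderiv_mlist)
  qed
  moreover have "cd_complex_analytic_on ?G (UNIV - V)"
    using F1(3) F2(3) by (simp add: cd_complex_analytic_on_def)
  ultimately show "\<exists>G :: 'r cd ^ 'l \<Rightarrow> 'r cd_complex. cont_diff_on m UNIV G \<and>
      (\<forall>z\<in>V. \<forall>k\<in>mindices. enat (mlength k) \<le> m \<longrightarrow> mpderiv k G z = g k z) \<and> cd_complex_analytic_on G (UNIV - V)"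
    by (intro exI[of _ ?G]) blast
qed

end
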